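(* If the linear space hypothesis (LSH) for $\mathrm{2SAT}_3$ is true, then $\mathrm{L}\neq\mathrm{NL}$.
   Context: Turing machines are multi-tape with a read-only input tape; space counts work tapes only. A polylogarithmic function is $\ell(n)=p(\log n)$ for a polynomial $p$. $\mathrm{2SAT}_3$: instances are 2CNF Boolean formulas in which each variable $v$ has at most 3 occurrences in total of the literals $v,\overline{v}$; the question is whether the formula is satisfiable. $m_{vbl}(x)$ is the number of variables of $x$. LSH for $\mathrm{2SAT}_3$: for every $\varepsilon\in(0,1)$ and every polylogarithmic function $\ell$, no deterministic Turing machine solves $\mathrm{2SAT}_3$ simultaneously in polynomial time using at most $m_{vbl}(x)^{\varepsilon}\ell(|x|)$ space on every instance $x$. *)

theory Defs
  imports Complex_Main "HOL-Library.Landau_Symbols" "HOL-Computational_Algebra.Polynomial"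
begin

section \<open>Multi-tape Turing machines with a read-only input tape\<close>

datatype move = MoveL | Stay | MoveR

datatype isym = LeftEnd | RightEnd | Bit bool

text \<open>
  A rule maps (state, scanned input symbol, scanned work symbols) to (new state, input head
  move, and for each work tape the written symbol and the head move). States and work symbols
  are natural numbers, the blank is 0. The sets of states and of work symbols of a machine are
  finite because the set of rules is required to be finite.
\<close>
record tm =
  work_tapes :: nat
  start :: nat
  accept :: nat
  reject :: nat
  rules :: "((nat \<times> isym \<times> nat list) \<times> (nat \<times> move \<times> (nat \<times> move) list)) set"

definition ntm :: "tm \<Rightarrow> bool" where
  "ntm M \<longleftrightarrow> finite (rules M) \<and> accept M \<noteq> reject M \<and>
     (\<forall>((q, a, ws), (q', d, ops)) \<in> rules M.
        q \<noteq> accept M \<and> q \<noteq> reject M \<and> length ws = work_tapes M \<and> length ops = work_tapes M)"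

definition dtm :: "tm \<Rightarrow> bool" where
  "dtm M \<longleftrightarrow> ntm M \<and> single_valued (rules M)"

text \<open>
  A work tape is one-way infinite, given by its contents and its head position. The input
  word \<open>x\<close> occupies the positions \<open>1, \<dots>, length x\<close> of the input tape, between end markers
  at the positions \<open>0\<close> and \<open>length x + 1\<close>.
\<close>
record config =
  state :: nat
  ipos :: nat
  work :: "((nat \<Rightarrow> nat) \<times> nat) list"

definition input_sym :: "bool list \<Rightarrow> nat \<Rightarrow> isym" where
  "input_sym x p = (if p = 0 then LeftEnd else if p \<le> length x then Bit (x ! (p - 1)) else RightEnd)"

text \<open>A left move at position 0 leaves the head in place.\<close>
fun shift :: "move \<Rightarrow> nat \<Rightarrow> nat" where
  "shift MoveL p = p - 1"
| "shift Stay p = p"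
| "shift MoveR p = Suc p"

definition init :: "tm \<Rightarrow> config" where
  "init M = \<lparr>state = start M, ipos = 0, work = replicate (work_tapes M) (\<lambda>_. 0, 0)\<rparr>"

definition step :: "tm \<Rightarrow> bool list \<Rightarrow> config \<Rightarrow> config \<Rightarrow> bool" where
  "step M x c c' \<longleftrightarrow> (\<exists>q d ops.
     ((state c, input_sym x (ipos c), map (\<lambda>(f, h). f h) (work c)), (q, d, ops)) \<in> rules M \<and>
     c' = \<lparr>state = q,
           ipos = min (shift d (ipos c)) (Suc (length x)),
           work = map2 (\<lambda>(a, e) (f, h). (f(h := a), shift e h)) ops (work c)\<rparr>)"

text \<open>Finite, possibly incomplete, computation paths.\<close>
definition computation :: "tm \<Rightarrow> bool list \<Rightarrow> config list \<Rightarrow> bool" where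
  "computation M x cs \<longleftrightarrow> cs \<noteq> [] \<and> hd cs = init M \<and> successively (step M x) cs"

definition accepts :: "tm \<Rightarrow> bool list \<Rightarrow> bool" where
  "accepts M x \<longleftrightarrow> (\<exists>cs. computation M x cs \<and> state (last cs) = accept M)"

definition rejects :: "tm \<Rightarrow> bool list \<Rightarrow> bool" where
  "rejects M x \<longleftrightarrow> (\<exists>cs. computation M x cs \<and> state (last cs) = reject M)"

text \<open>The number of distinct work tape cells, over all work tapes, scanned along a path.\<close>
definition space :: "config list \<Rightarrow> nat" where
  "space cs = card (\<Union>c\<in>set cs. {(i, snd (work c ! i)) | i. i < length (work c)})"

definition in_space :: "tm \<Rightarrow> bool list \<Rightarrow> real \<Rightarrow> bool" where
  "in_space M x s \<longleftrightarrow> (\<forall>cs. computation M x cs \<longrightarrow> real (space cs) \<le> s)"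

definition in_time :: "tm \<Rightarrow> bool list \<Rightarrow> nat \<Rightarrow> bool" where
  "in_time M x t \<longleftrightarrow> (\<forall>cs. computation M x cs \<longrightarrow> length cs - 1 \<le> t)"


section \<open>The classes L and NL\<close>

definition class_L :: "bool list set set" where
  "class_L = {A. \<exists>M (s :: nat \<Rightarrow> real). dtm M \<and> s \<in> O(\<lambda>n. ln (real n)) \<and>
     (\<forall>x. in_space M x (s (length x)) \<and>
          (x \<in> A \<longrightarrow> accepts M x) \<and> (x \<notin> A \<longrightarrow> rejects M x))}"

text \<open>
  The space bound holds on every computation path. As usual for space classes, a path need
  not halt.
\<close>
definition class_NL :: "bool list set set" where
  "class_NL = {A. \<exists>M (s :: nat \<Rightarrow> real). ntm M \<and> s \<in> O(\<lambda>n. ln (real n)) \<and>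
     (\<forall>x. in_space M x (s (length x)) \<and> (x \<in> A \<longleftrightarrow> accepts M x))}"


section \<open>2CNF formulas with at most three occurrences of each variable\<close>

datatype literal = Pos (var: nat) | Neg (var: nat)

type_synonym formula = "literal list list"

fun lit_true :: "(nat \<Rightarrow> bool) \<Rightarrow> literal \<Rightarrow> bool" where
  "lit_true \<sigma> (Pos v) = \<sigma> v"
| "lit_true \<sigma> (Neg v) = (\<not> \<sigma> v)"

definition satisfiable :: "formula \<Rightarrow> bool" where
  "satisfiable \<phi> \<longleftrightarrow> (\<exists>\<sigma>. \<forall>C\<in>set \<phi>. \<exists>l\<in>set C. lit_true \<sigma> l)"

definition m_vbl :: "formula \<Rightarrow> nat" where
  "m_vbl \<phi> = card (var ` set (concat \<phi>))"

text \<open>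
  Formulas have at least one clause and clauses one or two literals, so that every instance
  has a variable. Otherwise the bound \<open>m_vbl \<phi> powr \<epsilon> * l n\<close> would be 0 for the empty formula.
\<close>
definition is_2cnf :: "formula \<Rightarrow> bool" where
  "is_2cnf \<phi> \<longleftrightarrow> \<phi> \<noteq> [] \<and> (\<forall>C\<in>set \<phi>. length C \<in> {1, 2})"

definition instances_2SAT3 :: "formula set" where
  "instances_2SAT3 =
     {\<phi>. is_2cnf \<phi> \<and> (\<forall>v. length (filter (\<lambda>l. var l = v) (concat \<phi>)) \<le> 3)}"

text \<open>Binary representation of variable names, least significant digit first; 0 is the empty word.\<close>
fun bits :: "nat \<Rightarrow> bool list" where
  "bits n = (if n = 0 then [] else odd n # bits (n div 2))"

declare bits.simps [simp del]

text \<open>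
  Words over four tokens of two bits each: the digits \<open>[True, b]\<close>, the marker
  \<open>[False, False]\<close> opening a clause and the marker \<open>[False, True]\<close> opening a literal.
  The first digit of a literal is its sign, the others are its variable.
\<close>
definition enc_literal :: "literal \<Rightarrow> bool list" where
  "enc_literal l = [False, True] @ concat (map (\<lambda>b. [True, b]) (is_Pos l # bits (var l)))"

definition enc_clause :: "literal list \<Rightarrow> bool list" where
  "enc_clause C = [False, False] @ concat (map enc_literal C)"

definition encode :: "formula \<Rightarrow> bool list" where
  "encode \<phi> = concat (map enc_clause \<phi>)"


section \<open>The linear space hypothesis\<close>

definition polylog :: "(nat \<Rightarrow> real) \<Rightarrow> bool" where
  "polylog l \<longleftrightarrow> (\<exists>p :: real poly. \<forall>n\<ge>1. l n = poly p (log 2 (real n)))"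

text \<open>Polynomial time and the space bound refer to the same machine and hold simultaneously.\<close>
definition solves_2SAT3 :: "tm \<Rightarrow> real \<Rightarrow> (nat \<Rightarrow> real) \<Rightarrow> bool" where
  "solves_2SAT3 M \<epsilon> l \<longleftrightarrow> (\<exists>p :: nat poly. \<forall>\<phi>\<in>instances_2SAT3.
     let x = encode \<phi> in
       (satisfiable \<phi> \<longrightarrow> accepts M x) \<and> (\<not> satisfiable \<phi> \<longrightarrow> rejects M x) \<and>
       in_time M x (poly p (length x)) \<and>
       in_space M x (real (m_vbl \<phi>) powr \<epsilon> * l (length x)))"

definition LSH_2SAT3 :: bool where
  "LSH_2SAT3 \<longleftrightarrow> (\<forall>\<epsilon>::real. 0 < \<epsilon> \<and> \<epsilon> < 1 \<longrightarrow>
     (\<forall>l. polylog l \<longrightarrow> \<not> (\<exists>M. dtm M \<and> solves_2SAT3 M \<epsilon> l)))"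

end

theory Submission imports Defs "HOL-Real_Asymp.Real_Asymp" begin

text \<open>
  If L = NL, then unsatisfiability of 2CNF formulas, which is in NL because it means that some
  literal and its negation lie on a common cycle of the implication graph, is decided by a
  deterministic machine in logarithmic space. Such a machine halts without repeating a
  configuration, hence in polynomial time, and its space bound is polylogarithmic, hence below
  \<open>m powr \<epsilon> * l n\<close>. This contradicts LSH.

  The nondeterministic machine is obtained from a regular program (sequence, choice, iteration)
  over machine steps. It guesses the cycle with three pointers into the formula. Variable names
  can be as long as the input, so they are never copied but compared in place.
\<close>

section \<open>Regular programs\<close>

text \<open>The refuted property is unsatisfiability because its witness is a walk, which can be
  guessed edge by edge. The NL language is whatever the machine accepts, so no word is ever checked
  for being an encoding.

  The obstacle is a concrete machine with a space bound on every partial path, including those that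
  get stuck. Hence a program has one semantics for finished and one for interrupted executions, and
  it is refined in layers: tokens of the formula, several virtual input heads, the real input head
  with one counter per virtual head, cells of a work tape. Adjacent layers are related by
  simulations in both directions. A virtual head is a binary counter; to use it, the real head walks
  to its position while counting down and walks back while counting up.\<close>

datatype 'a rprog = Fail | Skip | Act 'a | Seq "'a rprog" "'a rprog" | Alt "'a rprog" "'a rprog"
  | Star "'a rprog"

fun sem :: "('a \<Rightarrow> ('s \<times> 's) set) \<Rightarrow> 'a rprog \<Rightarrow> ('s \<times> 's) set" where
  "sem A Fail = {}"
| "sem A Skip = Id"
| "sem A (Act a) = A a"
| "sem A (Seq p q) = sem A p O sem A q"
| "sem A (Alt p q) = sem A p \<union> sem A q"
| "sem A (Star p) = (sem A p)\<^sup>*"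

text \<open>All states met during a possibly incomplete execution, for space bounds.\<close>
fun pre :: "('a \<Rightarrow> ('s \<times> 's) set) \<Rightarrow> 'a rprog \<Rightarrow> ('s \<times> 's) set" where
  "pre A Fail = Id"
| "pre A Skip = Id"
| "pre A (Act a) = Id \<union> A a"
| "pre A (Seq p q) = pre A p \<union> sem A p O pre A q"
| "pre A (Alt p q) = pre A p \<union> pre A q"
| "pre A (Star p) = (sem A p)\<^sup>* O pre A p"

fun nullable :: "'a rprog \<Rightarrow> bool" where
  "nullable Fail = False"
| "nullable Skip = True"
| "nullable (Act a) = False"
| "nullable (Seq p q) = (nullable p \<and> nullable q)"
| "nullable (Alt p q) = (nullable p \<or> nullable q)"
| "nullable (Star p) = True"

text \<open>Partial derivatives in the sense of Antimirov; they become the states of the machine.\<close>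
fun ders :: "'a rprog \<Rightarrow> ('a \<times> 'a rprog) set" where
  "ders Fail = {}"
| "ders Skip = {}"
| "ders (Act a) = {(a, Skip)}"
| "ders (Seq p q) = (\<lambda>(a, r). (a, Seq r q)) ` ders p \<union> (if nullable p then ders q else {})"
| "ders (Alt p q) = ders p \<union> ders q"
| "ders (Star p) = (\<lambda>(a, r). (a, Seq r (Star p))) ` ders p"

text \<open>A finite superset of all iterated derivatives. Finiteness is what allows numbering them
  as machine states. For \<open>Seq p q\<close> the residuals of \<open>q\<close> alone are included
  because a derivative may pass over a nullable first component.\<close>

fun residuals :: "'a rprog \<Rightarrow> 'a rprog set" where
  "residuals Fail = {Fail}"
| "residuals Skip = {Skip}"
| "residuals (Act a) = {Act a, Skip}"
| "residuals (Seq p q) = (\<lambda>r. Seq r q) ` residuals p \<union> residuals q"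
| "residuals (Alt p q) = {Alt p q} \<union> residuals p \<union> residuals q"
| "residuals (Star p) = {Star p} \<union> (\<lambda>r. Seq r (Star p)) ` residuals p"

text \<open>The control state is the remaining program itself. There are no silent steps: an
  execution is finished when its residual is nullable, not when some end state is entered.\<close>

definition run :: "('a \<Rightarrow> ('s \<times> 's) set) \<Rightarrow> (('a rprog \<times> 's) \<times> ('a rprog \<times> 's)) set" where
  "run A = {((p, s), (p', s')). \<exists>a. (a, p') \<in> ders p \<and> (s, s') \<in> A a}"

lemma finite_ders: "finite (ders p)"
  by (induction p) auto

lemma finite_residuals: "finite (residuals p)"
  by (induction p) auto

lemma self_in_residuals: "p \<in> residuals p"
  by (induction p) auto

lemma residuals_closed: "r \<in> residuals p \<Longrightarrow> (a, r') \<in> ders r \<Longrightarrow> r' \<in> residuals p"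
proof (induction p arbitrary: r a r')
  case (Seq p q)
  then show ?case using self_in_residuals[of q] by (auto split: if_splits)
next
  case (Alt p q)
  then show ?case using self_in_residuals by auto blast+
next
  case (Star p)
  then show ?case using self_in_residuals[of p] by (auto split: if_splits)
qed auto

lemma ders_acts: "(a, r) \<in> ders p \<Longrightarrow> a \<in> set_rprog p \<and> set_rprog r \<subseteq> set_rprog p"
  by (induction p arbitrary: a r) (auto split: if_splits, blast+)

lemma residuals_acts: "r \<in> residuals p \<Longrightarrow> set_rprog r \<subseteq> set_rprog p"
  by (induction p arbitrary: r) (auto, blast+)

text \<open>The fundamental property of derivatives: an execution is either empty or splits off its
  first action.\<close>

lemma sem_ders:
  "(s, s') \<in> sem A p \<longleftrightarrow> nullable p \<and> s = s' \<or>
     (\<exists>a r s1. (a, r) \<in> ders p \<and> (s, s1) \<in> A a \<and> (s1, s') \<in> sem A r)"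
proof (induction p arbitrary: s s')
  case (Seq p q)
  have "(s, s') \<in> sem A (Seq p q) \<longleftrightarrow> nullable p \<and> (s, s') \<in> sem A q \<or>
     (\<exists>a r s1 s2. (a, r) \<in> ders p \<and> (s, s1) \<in> A a \<and> (s1, s2) \<in> sem A r \<and> (s2, s') \<in> sem A q)"
    using Seq.IH(1) by (auto simp: relcomp_unfold)
  also have "\<dots> \<longleftrightarrow> nullable p \<and> (nullable q \<and> s = s' \<or>
     (\<exists>a r s1. (a, r) \<in> ders q \<and> (s, s1) \<in> A a \<and> (s1, s') \<in> sem A r)) \<or>
     (\<exists>a r s1. (a, r) \<in> ders p \<and> (s, s1) \<in> A a \<and> (s1, s') \<in> sem A (Seq r q))"
    using Seq.IH(2)[of s s'] by (auto simp: relcomp_unfold)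
  also have "\<dots> \<longleftrightarrow> nullable (Seq p q) \<and> s = s' \<or>
     (\<exists>a r s1. (a, r) \<in> ders (Seq p q) \<and> (s, s1) \<in> A a \<and> (s1, s') \<in> sem A r)"
    by (auto simp del: sem.simps simp: image_iff Bex_def split_paired_Ex)
  finally show ?case .
next
  case (Star p)
  \<comment> \<open>\<open>D\<close> lacks only the identity that a nullable body contributes. This
    does not affect the reflexive transitive closure, and each iteration of \<open>D\<close> does
    begin with an action.\<close>
  define D where "D = {(s, s'). \<exists>a r s1. (a, r) \<in> ders p \<and> (s, s1) \<in> A a \<and> (s1, s') \<in> sem A r}"
  have "(sem A p)\<^sup>= = D\<^sup>="
    using Star.IH by (auto simp: D_def)
  then have eq: "(sem A p)\<^sup>* = D\<^sup>*" by (metis rtrancl_reflcl)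
  have "(s, s') \<in> D\<^sup>* \<longleftrightarrow> s = s' \<or> (s, s') \<in> D O D\<^sup>*"
    by (metis Un_iff pair_in_Id_conv rtrancl_unfold r_comp_rtrancl_eq)
  then have "(s, s') \<in> sem A (Star p) \<longleftrightarrow> s = s' \<or>
     (\<exists>a r s1. (a, r) \<in> ders p \<and> (s, s1) \<in> A a \<and> (s1, s') \<in> sem A (Seq r (Star p)))"
    unfolding sem.simps eq by (simp add: relcomp_unfold D_def) blast
  then show ?case
    by (simp del: sem.simps add: image_iff Bex_def split_paired_Ex) blast
next
  case (Alt p q)
  show ?case
    unfolding sem.simps ders.simps nullable.simps Un_iff Alt.IH(1)[of s s'] Alt.IH(2)[of s s'] by blast
qed auto

lemma run_sound:
  assumes "((p, s), (r, s')) \<in> (run A)\<^sup>*" "nullable r"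
  shows "(s, s') \<in> sem A p"
  using assms
proof (induction rule: converse_rtrancl_induct2)
  case refl
  then show ?case by (subst sem_ders) auto
next
  case (step p s p1 s1)
  then show ?case by (subst sem_ders) (auto simp: run_def)
qed

lemma pre_refl: "(s, s) \<in> pre A p"
  by (induction p) auto

lemma pre_ders:
  "(a, r) \<in> ders p \<Longrightarrow> (s, s1) \<in> A a \<Longrightarrow> (s1, s') \<in> pre A r \<Longrightarrow> (s, s') \<in> pre A p"
proof (induction p arbitrary: r s')
  case (Seq p q)
  have *: "(a, r) \<in> ders p \<Longrightarrow> (s1, s') \<in> sem A r \<Longrightarrow> (s, s') \<in> sem A p" for r s'
    using Seq.prems(2) by (subst sem_ders) auto
  have **: "nullable p \<Longrightarrow> (s, s) \<in> sem A p"
    by (subst sem_ders) auto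
  show ?case using Seq * ** by (auto split: if_splits) blast+
next
  case (Star p)
  from Star.prems obtain r1 where r: "(a, r1) \<in> ders p" "r = Seq r1 (Star p)" by auto
  have *: "(s1, s') \<in> sem A r1 \<Longrightarrow> (s, s') \<in> sem A p" for s'
    using Star.prems(2) r by (subst sem_ders) auto
  from Star.prems(3) r(2) consider "(s1, s') \<in> pre A r1"
    | "(s1, s') \<in> sem A r1 O (sem A p)\<^sup>* O pre A p" by auto
  then show ?case
  proof cases
    case 1
    then show ?thesis using Star.IH[OF r(1) Star.prems(2)] by auto
  next
    case 2
    then show ?thesis using * by (auto intro: converse_rtrancl_into_rtrancl)
  qed
qed auto

text \<open>In contrast to \<open>run_sound\<close>, the residual need not be nullable, so stuck and
  unfinished runs are covered. This is the source of all space bounds.\<close>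

lemma run_pre: "((p, s), (r, s')) \<in> (run A)\<^sup>* \<Longrightarrow> (s, s') \<in> pre A p"
proof (induction rule: converse_rtrancl_induct2)
  case refl
  then show ?case by (rule pre_refl)
next
  case (step p s p1 s1)
  then show ?case by (auto simp: run_def intro: pre_ders)
qed

lemma run_Seq: "((p, s), (r, s')) \<in> (run A)\<^sup>* \<Longrightarrow> ((Seq p q, s), (Seq r q, s')) \<in> (run A)\<^sup>*"
proof (induction rule: rtrancl_induct2)
  case (step r s' r1 s1)
  from step(2) have "((Seq r q, s'), (Seq r1 q, s1)) \<in> run A" by (force simp: run_def)
  with step show ?case by (meson rtrancl.rtrancl_into_rtrancl)
qed simp

lemma run_cases:
  assumes "((p, s), (r, s')) \<in> (run A)\<^sup>*"
  obtains "r = p" "s' = s"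
  | p1 s1 where "((p, s), (p1, s1)) \<in> run A" "((p1, s1), (r, s')) \<in> (run A)\<^sup>*"
  using assms by (metis converse_rtranclE prod.exhaust_sel prod.inject)

text \<open>A finished first component is not executed away; the first action of \<open>q\<close> is
  already a derivative of \<open>Seq p q\<close>. If \<open>q\<close> performs no action, the
  residual is \<open>Seq p q\<close> itself, hence the existential quantifier.\<close>

lemma run_Seq_nullable:
  assumes "((q, s), (r, s')) \<in> (run A)\<^sup>*" "nullable r" "nullable p"
  shows "\<exists>r'. nullable r' \<and> ((Seq p q, s), (r', s')) \<in> (run A)\<^sup>*"
  using assms(1)
proof (cases rule: run_cases)
  case 1
  with 1 assms show ?thesis by (intro exI[of _ "Seq p q"]) auto
next
  case (2 q1 s1)
  then have "((Seq p q, s), (q1, s1)) \<in> run A" using assms by (auto simp: run_def)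
  with 2 assms show ?thesis by (meson converse_rtrancl_into_rtrancl)
qed

lemma run_complete:
  "(s, s') \<in> sem A p \<Longrightarrow> \<exists>r. nullable r \<and> ((p, s), (r, s')) \<in> (run A)\<^sup>*"
proof (induction p arbitrary: s s')
  case Skip
  then show ?case by (intro exI[of _ Skip]) auto
next
  case (Act a)
  then have "((Act a, s), (Skip, s')) \<in> run A" by (auto simp: run_def)
  then show ?case by (intro exI[of _ Skip]) auto
next
  case (Seq p q)
  then obtain s1 where "(s, s1) \<in> sem A p" "(s1, s') \<in> sem A q" by auto
  with Seq.IH obtain r r' where r: "nullable r" "((p, s), (r, s1)) \<in> (run A)\<^sup>*"
    "nullable r'" "((q, s1), (r', s')) \<in> (run A)\<^sup>*" by metis
  from run_Seq_nullable[OF r(4,3,1)] run_Seq[OF r(2), of q] show ?case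
    by (meson rtrancl_trans)
next
  case (Alt p q)
  from Alt.prems consider "(s, s') \<in> sem A p" | "(s, s') \<in> sem A q" by auto
  then obtain r p' where r: "p' = p \<or> p' = q" "nullable r" "((p', s), (r, s')) \<in> (run A)\<^sup>*"
    using Alt.IH by metis
  from r(3) show ?case
  proof (cases rule: run_cases)
    case 1
    with 1 r show ?thesis by (intro exI[of _ "Alt p q"]) auto
  next
    case (2 q1 s1)
    then have "((Alt p q, s), (q1, s1)) \<in> run A" using r(1) by (auto simp: run_def)
    with 2 r show ?thesis by (meson converse_rtrancl_into_rtrancl)
  qed
next
  case (Star p)
  from Star.prems have "(s, s') \<in> (sem A p)\<^sup>*" by simp
  then show ?case
  proof (induction rule: converse_rtrancl_induct)
    case base
    then show ?case by (intro exI[of _ "Star p"]) auto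
  next
    case (step s s1)
    from step(3) obtain r where r: "nullable r" "((Star p, s1), (r, s')) \<in> (run A)\<^sup>*" by auto
    from Star.IH[OF step(1)] obtain r1 where r1: "nullable r1" "((p, s), (r1, s1)) \<in> (run A)\<^sup>*"
      by auto
    from r1(2) show ?case
    proof (cases rule: run_cases)
      \<comment> \<open>An iteration without any action changes nothing and is dropped.\<close>
      case 1
      with 1 r show ?thesis by auto
    next
      case (2 p2 s2)
      then have "((Star p, s), (Seq p2 (Star p), s2)) \<in> run A" by (force simp: run_def)
      moreover have "((Seq p2 (Star p), s2), (Seq r1 (Star p), s1)) \<in> (run A)\<^sup>*"
        using run_Seq[OF 2(2)] .
      moreover obtain r' where "nullable r'" "((Seq r1 (Star p), s1), (r', s')) \<in> (run A)\<^sup>*"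
        using run_Seq_nullable[OF r(2,1) r1(1)] by auto
      ultimately show ?thesis by (meson converse_rtrancl_into_rtrancl rtrancl_trans)
    qed
  qed
qed auto

section \<open>Compilation to Turing machines\<close>

type_synonym tmact = "isym \<times> nat list \<times> move \<times> (nat \<times> move) list"
type_synonym tmstate = "nat \<times> ((nat \<Rightarrow> nat) \<times> nat) list"

definition tm_act :: "bool list \<Rightarrow> tmact \<Rightarrow> (tmstate \<times> tmstate) set" where
  "tm_act x = (\<lambda>(a, ws, d, ops). {((p, w), (p', w')).
     input_sym x p = a \<and> map (\<lambda>(f, h). f h) w = ws \<and>
     p' = min (shift d p) (Suc (length x)) \<and>
     w' = map2 (\<lambda>(a, e) (f, h). (f(h := a), shift e h)) ops w})"

definition init_state :: "nat \<Rightarrow> tmstate" where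
  "init_state k = (0, replicate k (\<lambda>_. 0, 0))"

text \<open>The last action guarantees that only the residual program \<^term>\<open>Skip\<close> is nullable.\<close>
theorem rprog_to_ntm:
  fixes P :: "tmact rprog"
  assumes acts: "\<And>a ws d ops. (a, ws, d, ops) \<in> set_rprog (Seq P (Act b)) \<Longrightarrow>
    length ws = k \<and> length ops = k"
  obtains M where "ntm M"
    "\<And>x. accepts M x \<longleftrightarrow> (\<exists>s. (init_state k, s) \<in> sem (tm_act x) (Seq P (Act b)))"
    "\<And>x cs c. computation M x cs \<Longrightarrow> c \<in> set cs \<Longrightarrow>
       (init_state k, (ipos c, work c)) \<in> pre (tm_act x) (Seq P (Act b))"
proof -
  define Q where "Q = Seq P (Act b)"
  define S where "S = residuals Q"
  have "finite S" unfolding S_def by (rule finite_residuals)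
  then obtain n and f :: "tmact rprog \<Rightarrow> nat" where fn: "f ` S = {i. i < n}" and inj: "inj_on f S"
    using finite_imp_inj_to_nat_seg by blast
  have SkipS: "Skip \<in> S" by (simp add: S_def Q_def)
  define mk where "mk = (\<lambda>(r :: tmact rprog, (a :: isym, ws :: nat list, d :: move, ops :: (nat \<times> move) list), r').
     ((f r, a, ws), (f r', d, ops)))"
  \<comment> \<open>The residuals are numbered by exactly the numbers below \<open>n\<close>, so
    \<open>n\<close> is free to be a reject state that is never entered.\<close>
  define M where "M = \<lparr>work_tapes = k, start = f Q, accept = f Skip, reject = n,
    rules = mk ` (SIGMA r:S. ders r)\<rparr>"
  have QS: "Q \<in> S" by (simp add: S_def self_in_residuals)
  have "ntm M"
    unfolding ntm_def
  proof (intro conjI)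
    show "finite (rules M)"
      using \<open>finite S\<close> by (simp add: M_def finite_ders finite_SigmaI)
    show "accept M \<noteq> reject M" using fn SkipS by (auto simp: M_def)
    show "\<forall>((q, a, ws), (q', d, ops)) \<in> rules M.
        q \<noteq> accept M \<and> q \<noteq> reject M \<and> length ws = work_tapes M \<and> length ops = work_tapes M"
    proof clarify
      fix q a ws q' d ops
      assume "((q, a, ws), (q', d, ops)) \<in> rules M"
      then obtain r r' where r: "r \<in> S" "((a, ws, d, ops), r') \<in> ders r" "q = f r"
        by (auto simp: M_def mk_def)
      have "r \<noteq> Skip" using r(2) by auto
      then have "q \<noteq> f Skip" using r inj SkipS by (auto dest: inj_onD)
      moreover have "q \<noteq> n" using fn r by auto
      moreover have "(a, ws, d, ops) \<in> set_rprog Q"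
        using ders_acts[OF r(2)] residuals_acts r(1) S_def by blast
      ultimately show "q \<noteq> accept M \<and> q \<noteq> reject M \<and> length ws = work_tapes M \<and> length ops = work_tapes M"
        using acts by (simp add: M_def Q_def)
    qed
  qed
  \<comment> \<open>Injectivity of \<open>f\<close> on \<open>S\<close> recovers the residual from
    the state number, so machine steps and program steps correspond in both directions.\<close>
  have step_iff: "step M x c c' \<longleftrightarrow> (\<exists>r'. state c' = f r' \<and> ((r, ipos c, work c), (r', ipos c', work c')) \<in> run (tm_act x))"
    if "r \<in> S" "state c = f r" for x r c c'
  proof
    assume "step M x c c'"
    then obtain q d ops where s: "((state c, input_sym x (ipos c), map (\<lambda>(f, h). f h) (work c)), (q, d, ops)) \<in> rules M"
      "c' = \<lparr>state = q, ipos = min (shift d (ipos c)) (Suc (length x)),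
           work = map2 (\<lambda>(a, e) (f, h). (f(h := a), shift e h)) ops (work c)\<rparr>"
      unfolding step_def by blast
    then obtain r1 r' where "r1 \<in> S" "f r1 = state c" "q = f r'"
      "((input_sym x (ipos c), map (\<lambda>(f, h). f h) (work c), d, ops), r') \<in> ders r1"
      by (auto simp: M_def mk_def)
    moreover from this have "r1 = r" using inj that by (auto dest: inj_onD)
    ultimately show "\<exists>r'. state c' = f r' \<and> ((r, ipos c, work c), (r', ipos c', work c')) \<in> run (tm_act x)"
      using s by (intro exI[of _ r']) (auto simp: run_def tm_act_def intro!: exI)
  next
    assume "\<exists>r'. state c' = f r' \<and> ((r, ipos c, work c), (r', ipos c', work c')) \<in> run (tm_act x)"
    then obtain r' a ws d ops where r: "state c' = f r'" "((a, ws, d, ops), r') \<in> ders r"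
      "((ipos c, work c), (ipos c', work c')) \<in> tm_act x (a, ws, d, ops)"
      by (auto simp: run_def)
    then have "((f r, a, ws), (f r', d, ops)) \<in> rules M"
      using that by (force simp: M_def mk_def)
    with r that show "step M x c c'"
      by (auto simp: step_def tm_act_def intro!: exI[of _ "f r'"] exI[of _ d] exI[of _ ops] config.equality)
  qed
  have path: "successively (step M x) cs \<Longrightarrow> cs \<noteq> [] \<Longrightarrow> hd cs = init M \<Longrightarrow>
      (\<exists>r\<in>S. state (last cs) = f r \<and>
        ((Q, init_state k), (r, ipos (last cs), work (last cs))) \<in> (run (tm_act x))\<^sup>*)" for x cs
  proof (induction cs rule: rev_induct)
    case (snoc c cs)
    show ?case
    proof (cases "cs = []")
      case True
      with snoc.prems have "c = init M" by simp
      then show ?thesis using QS True by (auto simp: init_def M_def init_state_def)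
    next
      case False
      with snoc have p: "successively (step M x) cs" "step M x (last cs) c" "hd cs = init M"
        by (auto simp: successively_append_iff)
      from snoc.IH[OF p(1) False p(3)] obtain r where r: "r \<in> S" "state (last cs) = f r"
        "((Q, init_state k), (r, ipos (last cs), work (last cs))) \<in> (run (tm_act x))\<^sup>*" by auto
      from p(2) step_iff[OF r(1,2)] obtain r' where r': "state c = f r'"
        "((r, ipos (last cs), work (last cs)), (r', ipos c, work c)) \<in> run (tm_act x)" by auto
      then have "r' \<in> S" using r(1) by (auto simp: run_def S_def intro: residuals_closed)
      then show ?thesis using r(3) r' by (auto intro: rtrancl_into_rtrancl)
    qed
  qed simp
  have path': "((Q, init_state k), (r, s)) \<in> (run (tm_act x))\<^sup>* \<Longrightarrow>
    r \<in> S \<and> (\<exists>cs. computation M x cs \<and> last cs = \<lparr>state = f r, ipos = fst s, work = snd s\<rparr>)" for x r s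
  proof (induction rule: rtrancl_induct2)
    case refl
    have "computation M x [init M]" by (simp add: computation_def)
    then show ?case using QS
      by (auto intro!: exI[of _ "[init M]"] simp: init_def M_def init_state_def)
  next
    case (step r s r1 s1)
    then obtain cs where cs: "computation M x cs" "last cs = \<lparr>state = f r, ipos = fst s, work = snd s\<rparr>"
      and r: "r \<in> S" by auto
    let ?c = "\<lparr>state = f r1, ipos = fst s1, work = snd s1\<rparr>"
    have "step M x (last cs) ?c"
      using step(2) r cs(2) by (subst step_iff[OF r]) auto
    then have "computation M x (cs @ [?c])"
      using cs(1) by (auto simp: computation_def successively_append_iff)
    moreover have "r1 \<in> S" using r step(2) by (auto simp: run_def S_def intro: residuals_closed)
    ultimately show ?case by (auto intro!: exI[of _ "cs @ [?c]"])
  qed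
  have null: "r = Skip" if "r \<in> S" "nullable r" for r
    using that by (auto simp: S_def Q_def)
  show ?thesis
  proof (rule that)
    show "ntm M" by fact
    show "accepts M x \<longleftrightarrow> (\<exists>s. (init_state k, s) \<in> sem (tm_act x) (Seq P (Act b)))" for x
    proof
      assume "accepts M x"
      then obtain cs where "computation M x cs" "state (last cs) = f Skip"
        by (auto simp: accepts_def M_def)
      with path[of x cs] obtain r where r: "r \<in> S" "f Skip = f r"
        "((Q, init_state k), (r, ipos (last cs), work (last cs))) \<in> (run (tm_act x))\<^sup>*"
        by (auto simp: computation_def)
      from r have "r = Skip" using inj SkipS by (auto dest: inj_onD)
      with r(3) run_sound show "\<exists>s. (init_state k, s) \<in> sem (tm_act x) (Seq P (Act b))"
        by (fastforce simp: Q_def)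
    next
      assume "\<exists>s. (init_state k, s) \<in> sem (tm_act x) (Seq P (Act b))"
      then obtain s r where r: "nullable r" "((Q, init_state k), (r, s)) \<in> (run (tm_act x))\<^sup>*"
        using run_complete Q_def by metis
      with path'[OF r(2)] null obtain cs where "r = Skip" "computation M x cs"
        "last cs = \<lparr>state = f r, ipos = fst s, work = snd s\<rparr>" by auto
      then show "accepts M x" by (auto simp: accepts_def M_def)
    qed
    show "(init_state k, (ipos c, work c)) \<in> pre (tm_act x) (Seq P (Act b))"
      if "computation M x cs" "c \<in> set cs" for x cs c
    proof -
      \<comment> \<open>The prefix ending in \<open>c\<close> is itself a computation, so the bound
        reaches every configuration and not only the last.\<close>
      from that(2) obtain ys zs where cs: "cs = (ys @ [c]) @ zs" by (auto dest: split_list)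
      have "successively (step M x) (ys @ [c])" "hd (ys @ [c]) = init M"
        using that(1) unfolding cs computation_def
        by (auto simp: successively_append_iff hd_append split: if_splits)
      from path[OF this(1) _ this(2)] run_pre show ?thesis unfolding Q_def by fastforce
    qed
  qed
qed

section \<open>Simulation of programs\<close>

fun subst :: "('a \<Rightarrow> 'b rprog) \<Rightarrow> 'a rprog \<Rightarrow> 'b rprog" where
  "subst f Fail = Fail"
| "subst f Skip = Skip"
| "subst f (Act a) = f a"
| "subst f (Seq p q) = Seq (subst f p) (subst f q)"
| "subst f (Alt p q) = Alt (subst f p) (subst f q)"
| "subst f (Star p) = Star (subst f p)"

text \<open>The first half carries accepting executions down to the machine. The second half shows
  that the machine accepts nothing else, and it traces partial executions back to the abstract
  program.\<close>

definition simulates ::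
  "('s \<Rightarrow> 't \<Rightarrow> bool) \<Rightarrow> ('s \<times> 's) set \<Rightarrow> ('t \<times> 't) set \<Rightarrow> bool" where
  "simulates R A B \<longleftrightarrow> (\<forall>s t. R s t \<longrightarrow>
     (\<forall>s'. (s, s') \<in> A \<longrightarrow> (\<exists>t'. (t, t') \<in> B \<and> R s' t')) \<and>
     (\<forall>t'. (t, t') \<in> B \<longrightarrow> (\<exists>s'. (s, s') \<in> A \<and> R s' t')))"

lemma simulatesI:
  assumes "\<And>s t s'. R s t \<Longrightarrow> (s, s') \<in> A \<Longrightarrow> \<exists>t'. (t, t') \<in> B \<and> R s' t'"
    and "\<And>s t t'. R s t \<Longrightarrow> (t, t') \<in> B \<Longrightarrow> \<exists>s'. (s, s') \<in> A \<and> R s' t'"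
  shows "simulates R A B"
  using assms unfolding simulates_def by blast

lemma simulatesD1:
  "simulates R A B \<Longrightarrow> R s t \<Longrightarrow> (s, s') \<in> A \<Longrightarrow> \<exists>t'. (t, t') \<in> B \<and> R s' t'"
  unfolding simulates_def by blast

lemma simulatesD2:
  "simulates R A B \<Longrightarrow> R s t \<Longrightarrow> (t, t') \<in> B \<Longrightarrow> \<exists>s'. (s, s') \<in> A \<and> R s' t'"
  unfolding simulates_def by blast

lemma simulates_relcomp:
  assumes "simulates R A B" "simulates R A' B'"
  shows "simulates R (A O A') (B O B')"
proof (rule simulatesI)
  fix s t s' assume "R s t" "(s, s') \<in> A O A'"
  then show "\<exists>t'. (t, t') \<in> B O B' \<and> R s' t'"
    using simulatesD1[OF assms(1)] simulatesD1[OF assms(2)] by (meson relcomp.simps)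
next
  fix s t t' assume "R s t" "(t, t') \<in> B O B'"
  then show "\<exists>s'. (s, s') \<in> A O A' \<and> R s' t'"
    using simulatesD2[OF assms(1)] simulatesD2[OF assms(2)] by (meson relcomp.simps)
qed

lemma simulates_rtrancl:
  assumes "simulates R A B"
  shows "simulates R (A\<^sup>*) (B\<^sup>*)"
proof (rule simulatesI)
  fix s t s' assume "R s t" "(s, s') \<in> A\<^sup>*"
  from this(2,1) show "\<exists>t'. (t, t') \<in> B\<^sup>* \<and> R s' t'"
  proof (induction rule: rtrancl_induct)
    case (step s' s'')
    then show ?case using simulatesD1[OF assms] by (meson rtrancl.rtrancl_into_rtrancl)
  qed auto
next
  fix s t t' assume "R s t" "(t, t') \<in> B\<^sup>*"
  from this(2,1) show "\<exists>s'. (s, s') \<in> A\<^sup>* \<and> R s' t'"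
  proof (induction rule: rtrancl_induct)
    case (step s' s'')
    then show ?case using simulatesD2[OF assms] by (meson rtrancl.rtrancl_into_rtrancl)
  qed auto
qed

lemma simulates_subst:
  assumes "\<And>a. a \<in> set_rprog p \<Longrightarrow> simulates R (A a) (sem B (f a))"
  shows "simulates R (sem A p) (sem B (subst f p))"
  using assms
proof (induction p)
  case (Seq p q)
  then show ?case by (simp add: simulates_relcomp)
next
  case (Alt p q)
  then have "simulates R (sem A p) (sem B (subst f p))" "simulates R (sem A q) (sem B (subst f q))"
    by auto
  then show ?case unfolding simulates_def by simp blast
next
  case (Star p)
  then show ?case by (simp add: simulates_rtrancl)
qed (auto simp: simulates_def)

text \<open>A partial execution of the refined program leaves the relation \<open>R\<close> only
  inside the one action that was interrupted, so space has to be examined only within the code of a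
  single action. The last conjunct says that completing this action is still a partial execution of
  \<open>p\<close>; it serves the case where the code of an action is a single machine step.\<close>

lemma pre_subst:
  assumes "\<forall>a\<in>set_rprog p. simulates R (A a) (sem B (f a))"
    and "R s t" "(t, t') \<in> pre B (subst f p)"
  shows "\<exists>s1 t1. (s, s1) \<in> pre A p \<and> R s1 t1 \<and> (t' = t1 \<or> (\<exists>a\<in>set_rprog p.
    (t1, t') \<in> pre B (f a) \<and> (\<forall>s2. (s1, s2) \<in> A a \<longrightarrow> (s, s2) \<in> pre A p)))"
  using assms
proof (induction p arbitrary: s t)
  case (Seq p q)
  have sim: "simulates R (sem A p) (sem B (subst f p))"
    using Seq.prems(1) by (intro simulates_subst) auto
  from Seq.prems(3) consider "(t, t') \<in> pre B (subst f p)"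
    | u where "(t, u) \<in> sem B (subst f p)" "(u, t') \<in> pre B (subst f q)" by auto
  then show ?case
  proof cases
    case 1
    from Seq.IH(1)[OF _ Seq.prems(2) 1] Seq.prems(1) show ?thesis by (simp add: ball_Un) blast
  next
    case 2
    from simulatesD2[OF sim Seq.prems(2) 2(1)] obtain s1 where s1: "R s1 u" "(s, s1) \<in> sem A p"
      by auto
    from Seq.IH(2)[OF _ s1(1) 2(2)] Seq.prems(1) s1(2) show ?thesis by (simp add: ball_Un) blast
  qed
next
  case (Star p)
  have sim: "simulates R ((sem A p)\<^sup>*) ((sem B (subst f p))\<^sup>*)"
    using Star.prems(1) by (intro simulates_rtrancl simulates_subst) auto
  from Star.prems(3) obtain u where u: "(t, u) \<in> (sem B (subst f p))\<^sup>*"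
    "(u, t') \<in> pre B (subst f p)" by auto
  from simulatesD2[OF sim Star.prems(2) u(1)] obtain s1 where s1: "R s1 u" "(s, s1) \<in> (sem A p)\<^sup>*"
    by auto
  from Star.IH[OF _ s1(1) u(2)] Star.prems(1) s1(2) show ?case by simp blast
next
  case (Alt p q)
  from Alt.prems(3) consider "(t, t') \<in> pre B (subst f p)" | "(t, t') \<in> pre B (subst f q)" by auto
  then show ?case
  proof cases
    case 1
    from Alt.IH(1)[OF _ Alt.prems(2) 1] Alt.prems(1) show ?thesis by (simp add: ball_Un) blast
  next
    case 2
    from Alt.IH(2)[OF _ Alt.prems(2) 2] Alt.prems(1) show ?thesis by (simp add: ball_Un) blast
  qed
qed auto

section \<open>Invariants of programs\<close>

lemma sem_invariant:
  assumes "\<forall>a\<in>set_rprog p. \<forall>s s'. J s \<longrightarrow> (s, s') \<in> A a \<longrightarrow> J s'"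
    and "J s" "(s, s') \<in> sem A p"
  shows "J s'"
  using assms
proof (induction p arbitrary: s s')
  case (Star p)
  from Star.prems(3) have "(s, s') \<in> (sem A p)\<^sup>*" by simp
  then show ?case
  proof (induction rule: rtrancl_induct)
    case base
    then show ?case by fact
  next
    case (step u v)
    show ?case by (rule Star.IH[OF _ step(3,2)]) (use Star.prems(1,2) in \<open>simp_all add: ball_Un\<close>)
  qed
next
  case (Seq p q)
  from Seq.prems(3) obtain u where u: "(s, u) \<in> sem A p" "(u, s') \<in> sem A q" by auto
  have "J u" by (rule Seq.IH(1)[OF _ _ u(1)]) (use Seq.prems(1,2) in \<open>simp_all add: ball_Un\<close>)
  show ?case by (rule Seq.IH(2)[OF _ \<open>J u\<close> u(2)]) (use Seq.prems(1,2) in \<open>simp_all add: ball_Un\<close>)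
next
  case (Alt p q)
  from Alt.prems(3) consider "(s, s') \<in> sem A p" | "(s, s') \<in> sem A q" by auto
  then show ?case
  proof cases
    case 1
    show ?thesis by (rule Alt.IH(1)[OF _ _ 1]) (use Alt.prems(1,2) in \<open>simp_all add: ball_Un\<close>)
  next
    case 2
    show ?thesis by (rule Alt.IH(2)[OF _ _ 2]) (use Alt.prems(1,2) in \<open>simp_all add: ball_Un\<close>)
  qed
qed auto

lemma pre_invariant:
  assumes "\<forall>a\<in>set_rprog p. \<forall>s s'. J s \<longrightarrow> (s, s') \<in> A a \<longrightarrow> J s'"
    and "J s" "(s, s') \<in> pre A p"
  shows "J s'"
  using assms
proof (induction p arbitrary: s s')
  case (Star p)
  from Star.prems(3) obtain u where u: "(s, u) \<in> sem A (Star p)" "(u, s') \<in> pre A p" by auto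
  have "J u" by (rule sem_invariant[OF _ _ u(1)]) (use Star.prems(1,2) in \<open>simp_all add: ball_Un\<close>)
  show ?case by (rule Star.IH[OF _ \<open>J u\<close> u(2)]) (use Star.prems(1,2) in \<open>simp_all add: ball_Un\<close>)
next
  case (Seq p q)
  from Seq.prems(3) consider "(s, s') \<in> pre A p" | u where "(s, u) \<in> sem A p" "(u, s') \<in> pre A q" by auto
  then show ?case
  proof cases
    case 1
    show ?thesis by (rule Seq.IH(1)[OF _ _ 1]) (use Seq.prems(1,2) in \<open>simp_all add: ball_Un\<close>)
  next
    case 2
    have "J u" by (rule sem_invariant[OF _ _ 2(1)]) (use Seq.prems(1,2) in \<open>simp_all add: ball_Un\<close>)
    show ?thesis by (rule Seq.IH(2)[OF _ \<open>J u\<close> 2(2)]) (use Seq.prems(1,2) in \<open>simp_all add: ball_Un\<close>)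
  qed
next
  case (Alt p q)
  from Alt.prems(3) consider "(s, s') \<in> pre A p" | "(s, s') \<in> pre A q" by auto
  then show ?case
  proof cases
    case 1
    show ?thesis by (rule Alt.IH(1)[OF _ _ 1]) (use Alt.prems(1,2) in \<open>simp_all add: ball_Un\<close>)
  next
    case 2
    show ?thesis by (rule Alt.IH(2)[OF _ _ 2]) (use Alt.prems(1,2) in \<open>simp_all add: ball_Un\<close>)
  qed
qed auto

section \<open>Finite choice and unfolding of loops\<close>

definition choice :: "'a list \<Rightarrow> 'a rprog" where
  "choice as = foldr (\<lambda>a. Alt (Act a)) as Fail"

lemma sem_choice: "sem A (choice as) = (\<Union>a\<in>set as. A a)"
  by (induction as) (auto simp: choice_def)

lemma pre_choice: "pre A (choice as) = Id \<union> (\<Union>a\<in>set as. A a)"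
  by (induction as) (auto simp: choice_def)

lemma set_rprog_choice [simp]: "set_rprog (choice as) = set as"
  by (induction as) (auto simp: choice_def)

lemma set_rprog_subst: "set_rprog (subst f p) = (\<Union>a\<in>set_rprog p. set_rprog (f a))"
  by (induction p) auto

text \<open>Evaluates the scanning loops below: \<open>B\<close> is the exit test, disabled wherever
  the loop body is enabled. Unfolding once and inducting on the remaining distance then determines
  the loop completely, although it is written as a nondeterministic iteration.\<close>

lemma star_relcomp_unfold:
  "(s, s') \<in> A\<^sup>* O B \<longleftrightarrow> (s, s') \<in> B \<or> (\<exists>u. (s, u) \<in> A \<and> (u, s') \<in> A\<^sup>* O B)"
proof
  assume "(s, s') \<in> A\<^sup>* O B"
  then obtain u where "(s, u) \<in> A\<^sup>*" "(u, s') \<in> B" by auto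
  then show "(s, s') \<in> B \<or> (\<exists>u. (s, u) \<in> A \<and> (u, s') \<in> A\<^sup>* O B)"
    by (cases rule: converse_rtranclE) auto
qed (auto intro: converse_rtrancl_into_rtrancl)


section \<open>Binary counters\<close>

text \<open>The blank is 0, so both binary digits get nonzero symbols to make the end of a counter
  visible.\<close>

definition digit :: "bool \<Rightarrow> nat" where
  "digit b = (if b then 2 else 1)"

lemma digit_simps [simp]: "digit True = 2" "digit False = Suc 0"
  by (auto simp: digit_def)

text \<open>Least significant digit first, behind a sentinel 3 at position 0. Leading zeros may occur.\<close>
definition tape :: "bool list \<Rightarrow> nat \<Rightarrow> nat" where
  "tape ds p = (if p = 0 then 3 else if p \<le> length ds then digit (ds ! (p - 1)) else 0)"

fun val :: "bool list \<Rightarrow> nat" where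
  "val [] = 0"
| "val (b # ds) = of_bool b + 2 * val ds"

fun inc :: "bool list \<Rightarrow> bool list" where
  "inc [] = [True]"
| "inc (True # ds) = False # inc ds"
| "inc (False # ds) = True # ds"

text \<open>Only meaningful if some digit is \<open>True\<close>; the machine detects underflow
  because its borrow loop finds no such digit. The length is kept, which is why leading zeros
  arise.\<close>

fun dec :: "bool list \<Rightarrow> bool list" where
  "dec [] = []"
| "dec (True # ds) = False # ds"
| "dec (False # ds) = True # dec ds"

lemma val_inc: "val (inc ds) = Suc (val ds)"
  by (induction ds rule: inc.induct) auto

lemma val_eq_0: "val ds = 0 \<longleftrightarrow> True \<notin> set ds"
  by (induction ds) auto

lemma val_dec: "True \<in> set ds \<Longrightarrow> val ds = Suc (val (dec ds))"
  by (induction ds rule: dec.induct) auto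

lemma length_dec [simp]: "length (dec ds) = length ds"
  by (induction ds rule: dec.induct) auto

text \<open>A counter is lengthened only when its new value is an exact power of two. Hence its
  length stays logarithmic in the largest value it ever held, although decrementing never shortens
  it.\<close>

lemma length_inc:
  "length (inc ds) = length ds \<or> length (inc ds) = Suc (length ds) \<and> val (inc ds) = 2 ^ length ds"
  by (induction ds rule: inc.induct) auto

lemma tape_0 [simp]: "tape ds 0 = 3"
  by (simp add: tape_def)

lemma tape_append [simp]: "tape (xs @ d # ds) (Suc (length xs)) = digit d"
  by (simp add: tape_def)

lemma tape_end [simp]: "tape xs (Suc (length xs)) = 0"
  by (simp add: tape_def)

lemma tape_update: "(tape (xs @ d # ds))(Suc (length xs) := digit e) = tape (xs @ e # ds)"
  by (rule ext) (auto simp: tape_def nth_append nth_Cons split: nat.splits)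

lemma tape_update_end: "(tape xs)(Suc (length xs) := digit e) = tape (xs @ [e])"
  by (rule ext) (auto simp: tape_def nth_append nth_Cons split: nat.splits)

lemma tape_update_eq: "tape ds h = c \<Longrightarrow> (tape ds)(h := c) = tape ds"
  by auto

lemma tape_nonzero: "tape ds p \<noteq> 0 \<longleftrightarrow> p \<le> length ds"
  by (auto simp: tape_def digit_def)

type_synonym tapeact = "nat \<times> nat \<times> move"

definition tape_act :: "tapeact \<Rightarrow> (((nat \<Rightarrow> nat) \<times> nat) \<times> ((nat \<Rightarrow> nat) \<times> nat)) set" where
  "tape_act = (\<lambda>(c, w, e). {((f, h), (f', h')). f h = c \<and> f' = f(h := w) \<and> h' = shift e h})"

lemma in_tape_act [simp]:
  "((f, h), s) \<in> tape_act (c, w, e) \<longleftrightarrow> f h = c \<and> s = (f(h := w), shift e h)"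
  by (cases s) (auto simp: tape_act_def)

definition rewind :: "tapeact rprog" where
  "rewind = Seq (Star (choice [(1, 1, MoveL), (2, 2, MoveL)])) (Act (3, 3, Stay))"

definition sweep :: "tapeact rprog \<Rightarrow> tapeact rprog" where
  "sweep p = Seq (Act (3, 3, MoveR)) (Seq p rewind)"

text \<open>The loop propagates the carry. Like the other cores it ends with a left move, so that
  \<open>rewind\<close> starts on a digit or on the sentinel even if the core stopped on the blank
  behind the last digit.\<close>

definition inc_core :: "tapeact rprog" where
  "inc_core = Seq (Star (Act (2, 1, MoveR))) (choice [(1, 2, MoveL), (0, 2, MoveL)])"

definition dec_core :: "tapeact rprog" where
  "dec_core = Seq (Star (Act (1, 2, MoveR))) (Act (2, 1, MoveL))"

definition zero_core :: "tapeact rprog" where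
  "zero_core = Seq (Star (Act (1, 1, MoveR))) (Act (0, 0, MoveL))"

lemma sem_rewind:
  "h \<le> length ds \<Longrightarrow> ((tape ds, h), s) \<in> sem tape_act rewind \<longleftrightarrow> s = (tape ds, 0)"
proof (induction h)
  case 0
  show ?case unfolding rewind_def sem.simps
    by (subst star_relcomp_unfold) (auto simp: sem_choice tape_update_eq)
next
  case (Suc h)
  then have d: "tape ds (Suc h) = digit (ds ! h)" by (simp add: tape_def)
  from Suc have "((tape ds, h), s) \<in> sem tape_act rewind \<longleftrightarrow> s = (tape ds, 0)" by simp
  with d show ?case unfolding rewind_def sem.simps
    by (subst star_relcomp_unfold) (cases "ds ! h"; auto simp: sem_choice tape_update_eq)
qed

text \<open>Generalised over the prefix \<open>xs\<close> already passed, to allow induction on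
  \<open>ds\<close>. The head ends one cell to the left of the place that absorbed the
  carry.\<close>

lemma sem_inc_core:
  "((tape (xs @ ds), Suc (length xs)), s) \<in> sem tape_act inc_core \<longleftrightarrow>
     s = (tape (xs @ inc ds), length xs + length (takeWhile (\<lambda>b. b) ds))"
proof (induction ds arbitrary: xs rule: inc.induct)
  case 1
  show ?case unfolding inc_core_def sem.simps
    by (subst star_relcomp_unfold) (auto simp: sem_choice tape_update_end[of _ True, simplified])
next
  case (2 ds)
  have "((tape (xs @ False # ds), Suc (Suc (length xs))), s) \<in> sem tape_act inc_core \<longleftrightarrow>
     s = (tape (xs @ False # inc ds), length xs + length (takeWhile (\<lambda>b. b) (True # ds)))"
    using 2[of "xs @ [False]"] by simp
  then show ?case unfolding inc_core_def sem.simps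
    by (subst star_relcomp_unfold) (auto simp: sem_choice tape_update[of _ _ _ False, simplified])
next
  case (3 ds)
  show ?case unfolding inc_core_def sem.simps
    by (subst star_relcomp_unfold) (auto simp: sem_choice tape_update[of _ _ _ True, simplified])
qed

lemma sem_dec_core:
  "((tape (xs @ ds), Suc (length xs)), s) \<in> sem tape_act dec_core \<longleftrightarrow>
     True \<in> set ds \<and> s = (tape (xs @ dec ds), length xs + length (takeWhile Not ds))"
proof (induction ds arbitrary: xs rule: dec.induct)
  case 1
  show ?case unfolding dec_core_def sem.simps
    by (subst star_relcomp_unfold) auto
next
  case (2 ds)
  show ?case unfolding dec_core_def sem.simps
    by (subst star_relcomp_unfold) (auto simp: tape_update[of _ _ _ False, simplified])
next
  case (3 ds)
  have "((tape (xs @ True # ds), Suc (Suc (length xs))), s) \<in> sem tape_act dec_core \<longleftrightarrow>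
     True \<in> set ds \<and> s = (tape (xs @ True # dec ds), length xs + length (takeWhile Not (False # ds)))"
    using 3[of "xs @ [True]"] by simp
  then show ?case unfolding dec_core_def sem.simps
    by (subst star_relcomp_unfold) (auto simp: tape_update[of _ _ _ True, simplified])
qed

lemma sem_zero_core:
  "((tape (xs @ ds), Suc (length xs)), s) \<in> sem tape_act zero_core \<longleftrightarrow>
     True \<notin> set ds \<and> s = (tape (xs @ ds), length xs + length ds)"
proof (induction ds arbitrary: xs)
  case Nil
  show ?case unfolding zero_core_def sem.simps
    by (subst star_relcomp_unfold) (auto simp: tape_update_eq)
next
  case (Cons d ds)
  have "((tape (xs @ d # ds), Suc (Suc (length xs))), s) \<in> sem tape_act zero_core \<longleftrightarrow>
     True \<notin> set ds \<and> s = (tape (xs @ d # ds), length xs + length (d # ds))"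
    using Cons[of "xs @ [d]"] by simp
  then show ?case unfolding zero_core_def sem.simps
    by (subst star_relcomp_unfold) (cases d; auto simp: tape_update_eq)
qed

lemma length_inc_le: "length (takeWhile (\<lambda>b. b) ds) \<le> length (inc ds)"
  by (induction ds rule: inc.induct) auto

lemma sem_sweep:
  "((tape ds, 0), s) \<in> sem tape_act (sweep p) \<longleftrightarrow>
    (\<exists>s1. ((tape ds, 1), s1) \<in> sem tape_act p \<and> (s1, s) \<in> sem tape_act rewind)"
  by (auto simp: sweep_def relcomp_unfold tape_update_eq)

lemma sem_inc: "((tape ds, 0), s) \<in> sem tape_act (sweep inc_core) \<longleftrightarrow> s = (tape (inc ds), 0)"
  unfolding sem_sweep using sem_inc_core[of "[]" ds] length_inc_le[of ds]
  by (auto simp: sem_rewind)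

lemma sem_dec:
  "((tape ds, 0), s) \<in> sem tape_act (sweep dec_core) \<longleftrightarrow> True \<in> set ds \<and> s = (tape (dec ds), 0)"
  unfolding sem_sweep using sem_dec_core[of "[]" ds] length_takeWhile_le[of Not ds]
  by (auto simp: sem_rewind)

lemma sem_zero:
  "((tape ds, 0), s) \<in> sem tape_act (sweep zero_core) \<longleftrightarrow> True \<notin> set ds \<and> s = (tape ds, 0)"
  unfolding sem_sweep using sem_zero_core[of "[]" ds]
  by (auto simp: sem_rewind)

text \<open>The shape of a counter of fixed length in the middle of an operation, whatever its
  digits. It is preserved by actions that neither erase a digit nor write on a blank nor move right
  from a blank, which \<open>fits_acts\<close> checks on the program text alone.\<close>

definition fits :: "nat \<Rightarrow> (nat \<Rightarrow> nat) \<times> nat \<Rightarrow> bool" where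
  "fits n = (\<lambda>(f, h). (\<forall>p. f p \<noteq> 0 \<longleftrightarrow> p \<le> n) \<and> h \<le> Suc n)"

lemma fits_tape: "h \<le> Suc (length ds) \<Longrightarrow> fits (length ds) (tape ds, h)"
  using tape_nonzero[of ds] by (simp add: fits_def)

lemma fits_act:
  assumes "fits n s" "(s, s') \<in> tape_act (c, w, e)" "c = 0 \<longleftrightarrow> w = 0" "c = 0 \<longrightarrow> e \<noteq> MoveR"
  shows "fits n s'"
proof -
  obtain f h where s: "s = (f, h)" by force
  have f: "f p \<noteq> 0 \<longleftrightarrow> p \<le> n" for p using assms(1) s by (auto simp: fits_def)
  have c: "f h = c" "s' = (f(h := w), shift e h)" using assms(2) s by auto
  have h: "h \<le> Suc n" "c \<noteq> 0 \<longrightarrow> h \<le> n" using assms(1) s f[of h] c by (auto simp: fits_def)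
  have "(f(h := w)) p \<noteq> 0 \<longleftrightarrow> p \<le> n" for p
    using f[of p] f[of h] c(1) assms(3) by auto
  moreover have "shift e h \<le> Suc n" using h assms(4) by (cases e) auto
  ultimately show ?thesis using c(2) unfolding fits_def by simp
qed

definition fits_acts :: "tapeact set \<Rightarrow> bool" where
  "fits_acts S \<longleftrightarrow> (\<forall>(c, w, e)\<in>S. (c = 0 \<longleftrightarrow> w = 0) \<and> (c = 0 \<longrightarrow> e \<noteq> MoveR))"

lemma fits_act': "fits_acts S \<Longrightarrow> a \<in> S \<Longrightarrow> fits n s \<Longrightarrow> (s, s') \<in> tape_act a \<Longrightarrow> fits n s'"
  unfolding fits_acts_def by (cases a) (use fits_act in fast)

lemma fits_sem:
  "fits_acts (set_rprog p) \<Longrightarrow> fits n s \<Longrightarrow> (s, s') \<in> sem tape_act p \<Longrightarrow> fits n s'"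
  by (rule sem_invariant[of p "fits n" tape_act]) (use fits_act' in blast)+

lemma fits_pre:
  "fits_acts (set_rprog p) \<Longrightarrow> fits n s \<Longrightarrow> (s, s') \<in> pre tape_act p \<Longrightarrow> fits n s'"
  by (rule pre_invariant[of p "fits n" tape_act]) (use fits_act' in blast)+

lemma pre_sweep_cases:
  assumes "((tape ds, 0), s) \<in> pre tape_act (sweep p)"
  obtains "s = (tape ds, 0)" | "((tape ds, 1), s) \<in> pre tape_act p"
  | s1 where "((tape ds, 1), s1) \<in> sem tape_act p" "(s1, s) \<in> pre tape_act rewind"
proof -
  have step: "((tape ds, 0), u) \<in> tape_act (3, 3, MoveR) \<longleftrightarrow> u = (tape ds, 1)" for u
    by (simp add: tape_update_eq)
  from assms have "s = (tape ds, 0) \<or> ((tape ds, 0), s) \<in> tape_act (3, 3, MoveR) \<or>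
    (\<exists>u. ((tape ds, 0), u) \<in> tape_act (3, 3, MoveR) \<and>
      ((u, s) \<in> pre tape_act p \<or> (\<exists>s1. (u, s1) \<in> sem tape_act p \<and> (s1, s) \<in> pre tape_act rewind)))"
    unfolding sweep_def pre.simps sem.simps by blast
  then show thesis unfolding step by (metis that pre_refl)
qed

text \<open>Incrementing may write on the blank, so \<open>fits\<close> holds with two different
  lengths: that of \<open>ds\<close> up to this write, and that of \<open>inc ds\<close> during the
  rewind. The latter is at most one larger, which yields the constant 2.\<close>

lemma pre_inc:
  assumes "((tape ds, 0), s) \<in> pre tape_act (sweep inc_core)"
  shows "snd s \<le> length ds + 2"
  using assms
proof (cases rule: pre_sweep_cases)
  case 2
  then obtain u where u: "((tape ds, 1), u) \<in> sem tape_act (Star (Act (2, 1, MoveR)))"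
    "(u, s) \<in> pre tape_act (Act (2, 1, MoveR)) \<or> (u, s) \<in> pre tape_act (choice [(1, 2, MoveL), (0, 2, MoveL)])"
    unfolding inc_core_def pre.simps sem.simps by blast
  have u': "fits (length ds) u"
    by (rule fits_sem[OF _ _ u(1)]) (auto simp: fits_acts_def intro: fits_tape)
  then have le: "snd u \<le> Suc (length ds)" by (auto simp: fits_def)
  show ?thesis
  proof (cases "(u, s) \<in> pre tape_act (Act (2, 1, MoveR))")
    case True
    have "fits (length ds) s"
      by (rule fits_pre[OF _ u' True]) (simp add: fits_acts_def)
    then show ?thesis by (auto simp: fits_def)
  next
    case False
    with u(2) have "u = s \<or> (u, s) \<in> tape_act (1, 2, MoveL) \<or> (u, s) \<in> tape_act (0, 2, MoveL)"
      by (simp add: pre_choice)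
    then show ?thesis using le by (cases u) auto
  qed
next
  case (3 s1)
  from 3(1) have s1: "s1 = (tape (inc ds), length (takeWhile (\<lambda>b. b) ds))"
    using sem_inc_core[of "[]" ds] by simp
  have "fits (length (inc ds)) s1"
    unfolding s1 using length_inc_le[of ds] by (intro fits_tape) simp
  from fits_pre[OF _ this 3(2)] show ?thesis
    using length_inc[of ds] by (auto simp: fits_def fits_acts_def rewind_def)
qed simp

lemma pre_dec:
  assumes "((tape ds, 0), s) \<in> pre tape_act (sweep dec_core)"
  shows "snd s \<le> length ds + 2"
proof -
  have "fits (length ds) s"
    by (rule fits_pre[OF _ _ assms])
      (auto simp: fits_acts_def sweep_def dec_core_def rewind_def intro: fits_tape)
  then show ?thesis by (auto simp: fits_def)
qed

lemma pre_zero: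
  assumes "((tape ds, 0), s) \<in> pre tape_act (sweep zero_core)"
  shows "snd s \<le> length ds + 2"
proof -
  have "fits (length ds) s"
    by (rule fits_pre[OF _ _ assms])
      (auto simp: fits_acts_def sweep_def zero_core_def rewind_def intro: fits_tape)
  then show ?thesis by (auto simp: fits_def)
qed

section \<open>Multi-head programs in logarithmic space\<close>

text \<open>Every inactive tape shows the sentinel under its head, so a rule leaves it alone by
  reading 3, writing 3 and staying.\<close>

definition resting :: "((nat \<Rightarrow> nat) \<times> nat) list \<Rightarrow> bool" where
  "resting w \<longleftrightarrow> (\<forall>s\<in>set w. snd s = 0 \<and> fst s 0 = 3)"

definition syms :: "isym list" where
  "syms = [LeftEnd, RightEnd, Bit True, Bit False]"

lemma in_syms [simp]: "a \<in> set syms"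
proof (cases a)
  case (Bit b)
  then show ?thesis by (cases b) (auto simp: syms_def)
qed (auto simp: syms_def)

text \<open>A rule must name the scanned input symbol, so an action that ignores the input becomes
  one rule for each symbol.\<close>

fun on_tape :: "nat \<Rightarrow> nat \<Rightarrow> tapeact \<Rightarrow> tmact rprog" where
  "on_tape k i (c, w, e) = choice (map (\<lambda>a.
     (a, (replicate k 3)[i := c], Stay, (replicate k (3, Stay))[i := (w, e)])) syms)"

definition move_act :: "nat \<Rightarrow> isym \<Rightarrow> move \<Rightarrow> tmact" where
  "move_act k a d = (a, replicate k 3, d, replicate k (3, Stay))"

lemma map_resting: "resting w \<Longrightarrow> map (\<lambda>(f, h). f h) w = replicate (length w) 3"
  by (auto simp: resting_def case_prod_beta intro!: nth_equalityI)

lemma map2_resting: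
  "resting w \<Longrightarrow> map2 (\<lambda>(a, e) (f, h). (f(h := a), shift e h)) (replicate (length w) (3, Stay)) w = w"
  by (auto simp: resting_def case_prod_beta intro!: nth_equalityI prod_eqI)

lemma tm_act_move:
  assumes "resting w" "length w = k"
  shows "((p, w), t) \<in> tm_act x (move_act k a d) \<longleftrightarrow>
    input_sym x p = a \<and> t = (min (shift d p) (Suc (length x)), w)"
  using map_resting[OF assms(1)] map2_resting[OF assms(1)] assms(2)
  by (cases t) (auto simp: tm_act_def move_act_def)

lemma sem_on_tape:
  assumes "resting w" "length w = k" "i < k" "p \<le> Suc (length x)"
  shows "((p, w[i := (f, h)]), t) \<in> sem (tm_act x) (on_tape k i (c, u, e)) \<longleftrightarrow>
    f h = c \<and> t = (p, w[i := (f(h := u), shift e h)])"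
proof -
  have 1: "map (\<lambda>(f, h). f h) (w[i := (f, h)]) = (replicate k 3)[i := f h]"
    using map_resting[OF assms(1)] assms(2) by (simp add: map_update)
  have 2: "(replicate k 3)[i := f h] = (replicate k 3)[i := c] \<longleftrightarrow> f h = c"
    using assms(3) by (metis length_replicate nth_list_update_eq)
  have 3: "map2 (\<lambda>(a, e) (f, h). (f(h := a), shift e h)) ((replicate k (3, Stay))[i := (u, e)])
      (w[i := (f, h)]) = w[i := (f(h := u), shift e h)]"
    using map2_resting[OF assms(1)] assms(2) by (simp add: zip_update map_update)
  show ?thesis
    using 1 2 3 assms(4) by (cases t) (auto simp: sem_choice tm_act_def)
qed

lemma sem_subst_on_tape:
  assumes "resting w" "length w = k" "i < k" "p \<le> Suc (length x)"
  shows "((p, w[i := s]), t) \<in> sem (tm_act x) (subst (on_tape k i) q) \<longleftrightarrow>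
    (\<exists>s'. (s, s') \<in> sem tape_act q \<and> t = (p, w[i := s']))"
    and "((p, w[i := s]), t) \<in> pre (tm_act x) (subst (on_tape k i) q) \<Longrightarrow>
    (\<exists>s'. (s, s') \<in> pre tape_act q \<and> t = (p, w[i := s']))"
proof -
  define R where "R = (\<lambda>s t. t = (p, w[i := s]))"
  have sim: "simulates R (tape_act a) (sem (tm_act x) (on_tape k i a))" for a
  proof -
    obtain c u e where a: "a = (c, u, e)" by (cases a)
    show ?thesis
      by (rule simulatesI) (auto simp: R_def a sem_on_tape[OF assms] simp del: on_tape.simps)
  qed
  have sim': "simulates R (sem tape_act q) (sem (tm_act x) (subst (on_tape k i) q))"
    by (rule simulates_subst) (rule sim)
  show "((p, w[i := s]), t) \<in> sem (tm_act x) (subst (on_tape k i) q) \<longleftrightarrow>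
    (\<exists>s'. (s, s') \<in> sem tape_act q \<and> t = (p, w[i := s']))"
    using simulatesD1[OF sim'] simulatesD2[OF sim'] unfolding R_def by blast
  assume t: "((p, w[i := s]), t) \<in> pre (tm_act x) (subst (on_tape k i) q)"
  have "\<exists>s1 t1. (s, s1) \<in> pre tape_act q \<and> R s1 t1 \<and> (t = t1 \<or> (\<exists>a\<in>set_rprog q.
    (t1, t) \<in> pre (tm_act x) (on_tape k i a) \<and> (\<forall>s2. (s1, s2) \<in> tape_act a \<longrightarrow> (s, s2) \<in> pre tape_act q)))"
    by (rule pre_subst[OF _ _ t], rule ballI, rule sim, simp add: R_def)
  then obtain s1 where s1: "(s, s1) \<in> pre tape_act q"
    and "t = (p, w[i := s1]) \<or> (\<exists>a\<in>set_rprog q. ((p, w[i := s1]), t) \<in> pre (tm_act x) (on_tape k i a)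
      \<and> (\<forall>s2. (s1, s2) \<in> tape_act a \<longrightarrow> (s, s2) \<in> pre tape_act q))"
    unfolding R_def by blast
  then consider "t = (p, w[i := s1])" | a where "((p, w[i := s1]), t) \<in> pre (tm_act x) (on_tape k i a)"
      "\<forall>s2. (s1, s2) \<in> tape_act a \<longrightarrow> (s, s2) \<in> pre tape_act q"
    by blast
  then show "\<exists>s'. (s, s') \<in> pre tape_act q \<and> t = (p, w[i := s'])"
  proof cases
    case 1
    with s1 show ?thesis by blast
  next
    case 2
    obtain c u e where a: "a = (c, u, e)" by (cases a)
    \<comment> \<open>The code of a tape action is a choice between single steps, so interrupting it
      means that it has not begun or is already complete.\<close>
    have "pre (tm_act x) (on_tape k i a) = Id \<union> sem (tm_act x) (on_tape k i a)"
      by (simp add: a pre_choice sem_choice)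
    with 2(1) have "t = (p, w[i := s1]) \<or> ((p, w[i := s1]), t) \<in> sem (tm_act x) (on_tape k i a)"
      by auto
    then show ?thesis
      using s1 2(2) simulatesD2[OF sim, of s1 "(p, w[i := s1])" t a] unfolding R_def by blast
  qed
qed

text \<open>Actions on the input head position and the counter of one head: the position is moved
  between the two, so that their sum is preserved and the counter stays bounded.\<close>
datatype lact = Fetch | Store | Test isym move | AtLeft

definition loc_act :: "bool list \<Rightarrow> lact \<Rightarrow> ((nat \<times> nat) \<times> (nat \<times> nat)) set" where
  "loc_act x a = {((p, v), (p', v')). case a of
      Fetch \<Rightarrow> v = Suc v' \<and> p' = Suc p
    | Store \<Rightarrow> p = Suc p' \<and> v' = Suc v
    | Test b d \<Rightarrow> v = 0 \<and> v' = 0 \<and> input_sym x p = b \<and> p' = min (shift d p) (Suc (length x))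
    | AtLeft \<Rightarrow> p = 0 \<and> p' = 0 \<and> v' = v}"

text \<open>Both loops may stop anywhere, but \<open>Test\<close> requires an empty counter and
  \<open>AtLeft\<close> the left end. So the input is inspected exactly at the stored position, and
  the new position is completely stored back.\<close>

definition loc_head :: "isym \<Rightarrow> move \<Rightarrow> lact rprog" where
  "loc_head a d = Seq (Star (Act Fetch)) (Seq (Act (Test a d)) (Seq (Star (Act Store)) (Act AtLeft)))"

lemma sem_loc_head_aux1:
  "((p, v), s) \<in> (loc_act x Store)\<^sup>* O loc_act x AtLeft \<longleftrightarrow> s = (0, p + v)"
proof (induction p arbitrary: v)
  case 0
  show ?case by (subst star_relcomp_unfold) (cases s, auto simp: loc_act_def)
next
  case (Suc p)
  have "((Suc p, v), u) \<in> loc_act x Store \<longleftrightarrow> u = (p, Suc v)" for u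
    by (cases u) (auto simp: loc_act_def)
  moreover have "((Suc p, v), s) \<notin> loc_act x AtLeft" by (cases s) (auto simp: loc_act_def)
  ultimately show ?case using Suc[of "Suc v"] by (subst star_relcomp_unfold) simp
qed

lemma sem_loc_head_aux2:
  "((p, v), s) \<in> (loc_act x Fetch)\<^sup>* O (loc_act x (Test a d) O B) \<longleftrightarrow>
    input_sym x (p + v) = a \<and> ((min (shift d (p + v)) (Suc (length x)), 0), s) \<in> B"
proof (induction v arbitrary: p)
  case 0
  have 1: "((p, 0), u) \<notin> loc_act x Fetch" for u
    by (cases u) (auto simp: loc_act_def)
  have 2: "((p, 0), u) \<in> loc_act x (Test a d) \<longleftrightarrow>
      input_sym x p = a \<and> u = (min (shift d p) (Suc (length x)), 0)" for u
    by (cases u) (auto simp: loc_act_def)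
  show ?case by (subst star_relcomp_unfold) (auto simp: 1 2 relcomp_unfold)
next
  case (Suc v)
  have 1: "((p, Suc v), u) \<in> loc_act x Fetch \<longleftrightarrow> u = (Suc p, v)" for u
    by (cases u) (auto simp: loc_act_def)
  have 2: "((p, Suc v), u) \<notin> loc_act x (Test a d)" for u
    by (cases u) (auto simp: loc_act_def)
  show ?case using Suc[of "Suc p"] by (subst star_relcomp_unfold) (simp add: 1 2 relcomp_unfold[of "loc_act x (Test a d)"])
qed

lemma sem_loc_head:
  "((0, v), s) \<in> sem (loc_act x) (loc_head a d) \<longleftrightarrow>
    input_sym x v = a \<and> s = (0, min (shift d v) (Suc (length x)))"
  unfolding loc_head_def sem.simps sem_loc_head_aux2 sem_loc_head_aux1 by simp

text \<open>\<open>Store\<close> excludes \<open>LeftEnd\<close>, where a left move would leave the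
  head in place and the counter would be raised without compensation.\<close>

fun loc_prog :: "nat \<Rightarrow> nat \<Rightarrow> lact \<Rightarrow> tmact rprog" where
  "loc_prog k i Fetch = Seq (subst (on_tape k i) (sweep dec_core)) (choice (map (\<lambda>a. move_act k a MoveR) syms))"
| "loc_prog k i Store = Seq (choice (map (\<lambda>a. move_act k a MoveL) [RightEnd, Bit True, Bit False]))
     (subst (on_tape k i) (sweep inc_core))"
| "loc_prog k i (Test a d) = Seq (subst (on_tape k i) (sweep zero_core)) (Act (move_act k a d))"
| "loc_prog k i AtLeft = Act (move_act k LeftEnd Stay)"

text \<open>The bound on \<open>p + v\<close> keeps the clamping of the input head from taking
  effect during \<open>Fetch\<close>. The length is bounded by its own inequality because the value
  does not control leading zeros. By \<open>length_inc\<close>, growth makes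
  \<open>2 ^ length ds\<close> twice the new value, hence the factor 2.\<close>

definition loc_rel :: "bool list \<Rightarrow> nat \<Rightarrow> ((nat \<Rightarrow> nat) \<times> nat) list \<Rightarrow> nat \<times> nat \<Rightarrow> tmstate \<Rightarrow> bool" where
  "loc_rel x i w = (\<lambda>(p, v) t. \<exists>ds. t = (p, w[i := (tape ds, 0)]) \<and> val ds = v \<and>
     p + v \<le> Suc (length x) \<and> 2 ^ length ds \<le> 2 * Suc (length x))"

text \<open>\<open>m\<close> stands for the length of the counter on the tape at the beginning of
  the current operation, and the 2 is the excess allowed by \<open>pre_inc\<close>. The relation
  between tape contents and counters is deliberately forgotten.\<close>

definition bounded_heads :: "bool list \<Rightarrow> tmstate \<Rightarrow> bool" where
  "bounded_heads x = (\<lambda>(p, w). \<forall>(f, h)\<in>set w. \<exists>m. 2 ^ m \<le> 2 * Suc (length x) \<and> h \<le> m + 2)"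

lemma input_sym_LeftEnd: "input_sym x p = LeftEnd \<longleftrightarrow> p = 0"
  by (auto simp: input_sym_def)

lemma resting_update: "resting w \<Longrightarrow> resting (w[i := (tape ds, 0)])"
  by (auto simp: resting_def dest!: set_update_subset_insert[THEN subsetD])

lemma sem_loc_prog:
  assumes "resting w" "length w = k" "i < k" "p \<le> Suc (length x)"
  shows "((p, w[i := (tape ds, 0)]), t) \<in> sem (tm_act x) (loc_prog k i a) \<longleftrightarrow> (case a of
      Fetch \<Rightarrow> True \<in> set ds \<and> t = (min (Suc p) (Suc (length x)), w[i := (tape (dec ds), 0)])
    | Store \<Rightarrow> p \<noteq> 0 \<and> t = (p - 1, w[i := (tape (inc ds), 0)])
    | Test b d \<Rightarrow> True \<notin> set ds \<and> input_sym x p = b \<and> t = (min (shift d p) (Suc (length x)), w[i := (tape ds, 0)])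
    | AtLeft \<Rightarrow> p = 0 \<and> t = (p, w[i := (tape ds, 0)]))"
proof -
  note tape = sem_subst_on_tape(1)[OF assms(1,2,3)]
  have move: "((q, w[i := (tape es, 0)]), t) \<in> tm_act x (move_act k b d) \<longleftrightarrow>
    input_sym x q = b \<and> t = (min (shift d q) (Suc (length x)), w[i := (tape es, 0)])" for q es t b d
    by (rule tm_act_move) (auto simp: assms resting_update)
  show ?thesis
  proof (cases a)
    case Fetch
    have "((q, w[i := (tape es, 0)]), t) \<in> sem (tm_act x) (choice (map (\<lambda>a. move_act k a MoveR) syms)) \<longleftrightarrow>
       t = (min (Suc q) (Suc (length x)), w[i := (tape es, 0)])" for q es
      by (simp add: sem_choice move)
    then show ?thesis using assms(4) by (auto simp: Fetch tape sem_dec relcomp_unfold)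
  next
    case Store
    have "input_sym x p \<in> set [RightEnd, Bit True, Bit False] \<longleftrightarrow> p \<noteq> 0"
      by (auto simp: input_sym_def)
    then have "((p, w[i := (tape ds, 0)]), u) \<in> sem (tm_act x) (choice (map (\<lambda>a. move_act k a MoveL) [RightEnd, Bit True, Bit False])) \<longleftrightarrow>
       p \<noteq> 0 \<and> u = (p - 1, w[i := (tape ds, 0)])" for u
      using assms(4) unfolding sem_choice by (auto simp: move)
    then show ?thesis using assms(4) by (auto simp: Store tape sem_inc relcomp_unfold)
  next
    case (Test b d)
    then show ?thesis using assms(4) by (auto simp: tape sem_zero relcomp_unfold move)
  next
    case AtLeft
    then show ?thesis by (auto simp: move input_sym_LeftEnd)
  qed
qed

lemma simulates_loc_prog:
  assumes "resting w" "length w = k" "i < k"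
  shows "simulates (loc_rel x i w) (loc_act x a) (sem (tm_act x) (loc_prog k i a))"
proof -
  have bound: "2 ^ length (inc ds) \<le> 2 * Suc (length x)"
    if "Suc (val ds) \<le> Suc (length x)" "2 ^ length ds \<le> 2 * Suc (length x)" for ds
    using length_inc[of ds] val_inc[of ds] that by auto
  show ?thesis
  proof (rule simulatesI)
    fix s t s' assume "loc_rel x i w s t" "(s, s') \<in> loc_act x a"
    then obtain p v ds p' v' where *: "s = (p, v)" "t = (p, w[i := (tape ds, 0)])" "val ds = v"
      "p + v \<le> Suc (length x)" "2 ^ length ds \<le> 2 * Suc (length x)" "s' = (p', v')"
      by (cases s; cases s') (auto simp: loc_rel_def)
    then have p: "p \<le> Suc (length x)" by simp
    define es where "es = (case a of Fetch \<Rightarrow> dec ds | Store \<Rightarrow> inc ds | _ \<Rightarrow> ds)"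
    show "\<exists>t'. (t, t') \<in> sem (tm_act x) (loc_prog k i a) \<and> loc_rel x i w s' t'"
      unfolding *(2) sem_loc_prog[OF assms p] loc_rel_def *(6)
      using * \<open>(s, s') \<in> loc_act x a\<close> val_dec[of ds] val_eq_0[of ds] val_inc[of ds] bound[of ds]
      by (intro exI[of _ "(p', w[i := (tape es, 0)])"] conjI case_prodI exI[of _ es]; cases a)
        (auto simp: loc_act_def es_def)
  next
    fix s t t' assume "loc_rel x i w s t" and t: "(t, t') \<in> sem (tm_act x) (loc_prog k i a)"
    then obtain p v ds where *: "s = (p, v)" "t = (p, w[i := (tape ds, 0)])" "val ds = v"
      "p + v \<le> Suc (length x)" "2 ^ length ds \<le> 2 * Suc (length x)"
      by (cases s) (auto simp: loc_rel_def)
    then have p: "p \<le> Suc (length x)" by simp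
    define es where "es = (case a of Fetch \<Rightarrow> dec ds | Store \<Rightarrow> inc ds | _ \<Rightarrow> ds)"
    show "\<exists>s'. (s, s') \<in> loc_act x a \<and> loc_rel x i w s' t'"
      using t[unfolded *(2) sem_loc_prog[OF assms p]] unfolding loc_rel_def
      using * val_dec[of ds] val_eq_0[of ds] val_inc[of ds] bound[of ds]
      by (intro exI[of _ "(fst t', val es)"] conjI case_prodI exI[of _ es]; cases a)
        (auto simp: loc_act_def es_def)
  qed
qed

lemma bounded_heads_update:
  assumes "resting w" "2 ^ length ds \<le> 2 * Suc (length x)" "snd s \<le> length ds + 2"
  shows "bounded_heads x (p, w[i := s])"
proof -
  have "\<exists>m. 2 ^ m \<le> 2 * Suc (length x) \<and> snd u \<le> m + 2" if "u \<in> set (w[i := s])" for u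
  proof (cases "u = s")
    case True
    then show ?thesis using assms(2,3) by blast
  next
    case False
    then have "u \<in> set w" using that set_update_subset_insert[of w i s] by auto
    then show ?thesis using assms(1) by (intro exI[of _ 0]) (auto simp: resting_def)
  qed
  then show ?thesis by (auto simp: bounded_heads_def case_prod_beta)
qed

lemma pre_loc_prog:
  assumes "resting w" "length w = k" "i < k" "loc_rel x i w s t"
    and "(t, t') \<in> pre (tm_act x) (loc_prog k i a)"
  shows "bounded_heads x t' \<and> length (snd t') = k"
proof -
  obtain p v ds where *: "s = (p, v)" "t = (p, w[i := (tape ds, 0)])" "val ds = v"
    "p + v \<le> Suc (length x)" "2 ^ length ds \<le> 2 * Suc (length x)"
    using assms(4) by (cases s) (auto simp: loc_rel_def)
  then have p: "p \<le> Suc (length x)" by simp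
  have move: "((q, w[i := (tape es, 0)]), u) \<in> tm_act x (move_act k b d) \<longleftrightarrow>
    input_sym x q = b \<and> u = (min (shift d q) (Suc (length x)), w[i := (tape es, 0)])" for q es u b d
    by (rule tm_act_move) (auto simp: assms resting_update)
  note tape = sem_subst_on_tape(1)[OF assms(1,2,3)]
  note pre_tape = sem_subst_on_tape(2)[OF assms(1,2,3)]
  have fin: "bounded_heads x (q, w[i := r]) \<and> length (snd (q, w[i := r])) = k" if "snd r \<le> length ds + 2" for q r
    using bounded_heads_update[OF assms(1) *(5) that] assms(2) by simp
  have fin0: "bounded_heads x (q, w[i := (tape es, 0)]) \<and> length (snd (q, w[i := (tape es, 0)])) = k" for q es
    by (rule fin) simp
  have moves: "bounded_heads x u \<and> length (snd u) = k"
    if "((q, w[i := (tape es, 0)]), u) \<in> pre (tm_act x) (choice (map (\<lambda>a. move_act k a d) bs))" for q es u d bs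
  proof -
    from that have "\<exists>q'. u = (q', w[i := (tape es, 0)])" by (auto simp: pre_choice move)
    then show ?thesis using fin0 by blast
  qed
  show ?thesis
  proof (cases a)
    case Fetch
    with assms(5) consider "(t, t') \<in> pre (tm_act x) (subst (on_tape k i) (sweep dec_core))"
      | u where "(t, u) \<in> sem (tm_act x) (subst (on_tape k i) (sweep dec_core))"
        "(u, t') \<in> pre (tm_act x) (choice (map (\<lambda>a. move_act k a MoveR) syms))" by auto
    then show ?thesis
    proof cases
      case 1
      then show ?thesis using pre_tape[OF p] pre_dec[of ds] fin unfolding *(2) by blast
    next
      case 2
      then have "u = (p, w[i := (tape (dec ds), 0)])" unfolding *(2) by (simp add: tape[OF p] sem_dec)
      then show ?thesis using moves 2(2) by blast
    qed
  next
    case Store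
    with assms(5) consider
        "(t, t') \<in> pre (tm_act x) (choice (map (\<lambda>a. move_act k a MoveL) [RightEnd, Bit True, Bit False]))"
      | u where "(t, u) \<in> sem (tm_act x) (choice (map (\<lambda>a. move_act k a MoveL) [RightEnd, Bit True, Bit False]))"
        "(u, t') \<in> pre (tm_act x) (subst (on_tape k i) (sweep inc_core))" by auto
    then show ?thesis
    proof cases
      case 1
      then show ?thesis using moves unfolding *(2) by blast
    next
      case 2
      then have u: "u = (min (p - 1) (Suc (length x)), w[i := (tape ds, 0)])"
        unfolding *(2) by (auto simp: sem_choice move)
      show ?thesis using pre_tape[OF _ 2(2)[unfolded u]] pre_inc[of ds] fin by fastforce
    qed
  next
    case (Test b d)
    with assms(5) consider "(t, t') \<in> pre (tm_act x) (subst (on_tape k i) (sweep zero_core))"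
      | u where "(t, u) \<in> sem (tm_act x) (subst (on_tape k i) (sweep zero_core))"
        "u = t' \<or> (u, t') \<in> tm_act x (move_act k b d)"
      unfolding Test loc_prog.simps pre.simps by blast
    then show ?thesis
    proof cases
      case 1
      then show ?thesis using pre_tape[OF p] pre_zero[of ds] fin unfolding *(2) by blast
    next
      case 2
      then have "u = (p, w[i := (tape ds, 0)])" unfolding *(2) by (simp add: tape[OF p] sem_zero)
      then show ?thesis using move[of p ds] 2(2) fin0 by auto
    qed
  next
    case AtLeft
    then show ?thesis using assms(5) fin0 unfolding *(2) by (auto simp: move)
  qed
qed

section \<open>Several virtual heads on one input tape\<close>

type_synonym hact = "nat \<times> isym \<times> move"

definition head_act :: "bool list \<Rightarrow> hact \<Rightarrow> (nat list \<times> nat list) set" where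
  "head_act x = (\<lambda>(i, a, d). {(ps, ps'). input_sym x (ps ! i) = a \<and>
     ps' = ps[i := min (shift d (ps ! i)) (Suc (length x))]})"

fun head_prog :: "nat \<Rightarrow> hact \<Rightarrow> tmact rprog" where
  "head_prog k (i, a, d) = subst (loc_prog k i) (loc_head a d)"

text \<open>Between two actions the real input head is parked at 0 and all information about virtual
  heads is in the counters.\<close>

definition head_rel :: "bool list \<Rightarrow> nat \<Rightarrow> nat list \<Rightarrow> tmstate \<Rightarrow> bool" where
  "head_rel x k ps = (\<lambda>(p, w). p = 0 \<and> length w = k \<and> length ps = k \<and>
     (\<forall>i<k. \<exists>ds. w ! i = (tape ds, 0) \<and> val ds = ps ! i \<and> ps ! i \<le> Suc (length x) \<and>
        2 ^ length ds \<le> 2 * Suc (length x)))"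

lemma head_rel_resting: "head_rel x k ps (p, w) \<Longrightarrow> resting w"
  unfolding head_rel_def resting_def by (force simp: in_set_conv_nth)

lemma head_rel_loc_rel: "head_rel x k ps (p, w) \<Longrightarrow> i < k \<Longrightarrow> loc_rel x i w (0, ps ! i) (p, w)"
  unfolding head_rel_def loc_rel_def by (auto, metis list_update_id)

lemma loc_rel_head_rel:
  "head_rel x k ps (p, w) \<Longrightarrow> i < k \<Longrightarrow> loc_rel x i w (0, v) t \<Longrightarrow> head_rel x k (ps[i := v]) t"
  unfolding head_rel_def loc_rel_def by (auto simp: nth_list_update)

lemma simulates_loc_head:
  assumes "head_rel x k ps (p, w)" "i < k"
  shows "simulates (loc_rel x i w) (sem (loc_act x) (loc_head a d)) (sem (tm_act x) (head_prog k (i, a, d)))"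
  using assms head_rel_resting[OF assms(1)]
  by (auto intro!: simulates_subst simulates_loc_prog simp: head_rel_def)

lemma simulates_head_prog:
  assumes "fst a < k"
  shows "simulates (head_rel x k) (head_act x a) (sem (tm_act x) (head_prog k a))"
proof -
  obtain i b d where a: "a = (i, b, d)" by (cases a)
  with assms have i: "i < k" by simp
  show ?thesis
  proof (rule simulatesI)
    fix ps t ps' assume *: "head_rel x k ps t" "(ps, ps') \<in> head_act x a"
    obtain p w where t: "t = (p, w)" by force
    from * have "((0, ps ! i), (0, min (shift d (ps ! i)) (Suc (length x)))) \<in> sem (loc_act x) (loc_head b d)"
      "ps' = ps[i := min (shift d (ps ! i)) (Suc (length x))]"
      by (auto simp: head_act_def a sem_loc_head)
    with simulatesD1[OF simulates_loc_head[OF *(1)[unfolded t] i] head_rel_loc_rel[OF *(1)[unfolded t] i]]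
    show "\<exists>t'. (t, t') \<in> sem (tm_act x) (head_prog k a) \<and> head_rel x k ps' t'"
      using loc_rel_head_rel[OF *(1)[unfolded t] i] unfolding a t by blast
  next
    fix ps t t' assume *: "head_rel x k ps t" "(t, t') \<in> sem (tm_act x) (head_prog k a)"
    obtain p w where t: "t = (p, w)" by force
    from simulatesD2[OF simulates_loc_head[OF *(1)[unfolded t] i] head_rel_loc_rel[OF *(1)[unfolded t] i] *(2)[unfolded t a]]
    obtain s' where s': "((0, ps ! i), s') \<in> sem (loc_act x) (loc_head b d)" "loc_rel x i w s' t'"
      by blast
    then have "s' = (0, min (shift d (ps ! i)) (Suc (length x)))" "input_sym x (ps ! i) = b"
      by (auto simp: sem_loc_head)
    with s' loc_rel_head_rel[OF *(1)[unfolded t] i]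
    show "\<exists>ps'. (ps, ps') \<in> head_act x a \<and> head_rel x k ps' t'"
      by (auto simp: head_act_def a)
  qed
qed

lemma head_rel_bounded: "head_rel x k ps t \<Longrightarrow> bounded_heads x t \<and> length (snd t) = k"
  unfolding head_rel_def bounded_heads_def by (cases t) (force simp: in_set_conv_nth intro: exI[of _ 0])

lemma pre_head_prog:
  assumes "fst a < k" "head_rel x k ps t" "(t, t') \<in> pre (tm_act x) (head_prog k a)"
  shows "bounded_heads x t' \<and> length (snd t') = k"
proof -
  obtain i b d where a: "a = (i, b, d)" by (cases a)
  with assms have i: "i < k" by simp
  obtain p w where t: "t = (p, w)" by force
  have w: "resting w" "length w = k"
    using head_rel_resting assms(2) by (auto simp: t head_rel_def)
  have "\<exists>s1 t1. ((0, ps ! i), s1) \<in> pre (loc_act x) (loc_head b d) \<and> loc_rel x i w s1 t1 \<and>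
    (t' = t1 \<or> (\<exists>a\<in>set_rprog (loc_head b d). (t1, t') \<in> pre (tm_act x) (loc_prog k i a) \<and>
      (\<forall>s2. (s1, s2) \<in> loc_act x a \<longrightarrow> ((0, ps ! i), s2) \<in> pre (loc_act x) (loc_head b d))))"
    using assms(3) unfolding a t head_prog.simps
    by (rule pre_subst[rotated 2]) (auto intro: simulates_loc_prog[OF w i] head_rel_loc_rel[OF assms(2)[unfolded t] i])
  then obtain s1 t1 where s1: "loc_rel x i w s1 t1"
    "t' = t1 \<or> (\<exists>a. (t1, t') \<in> pre (tm_act x) (loc_prog k i a))" by blast
  \<comment> \<open>The case \<open>t' = t1\<close> is subsumed by reflexivity of
    \<open>pre\<close>, with an arbitrary action.\<close>
  then have "\<exists>a. (t1, t') \<in> pre (tm_act x) (loc_prog k i a)" using pre_refl by metis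
  with pre_loc_prog[OF w i s1(1)] show ?thesis by blast
qed

text \<open>The initial tapes are entirely blank and thus not yet resting; this action installs the
  sentinels, and the result represents all heads at position 0.\<close>

definition start_act :: "nat \<Rightarrow> tmact" where
  "start_act k = (LeftEnd, replicate k 0, Stay, replicate k (3, Stay))"

lemma tm_act_start:
  "(init_state k, t) \<in> tm_act x (start_act k) \<longleftrightarrow> t = (0, replicate k (tape [], 0))"
proof -
  have "(\<lambda>_. 0)(0 := 3) = tape []" by (rule ext) (simp add: tape_def)
  then show ?thesis
    by (cases t) (auto simp: tm_act_def start_act_def init_state_def input_sym_def zip_replicate)
qed

lemma on_tape_acts:
  "(b, ws, d, ops) \<in> set_rprog (on_tape k i a) \<Longrightarrow> length ws = k \<and> length ops = k"
  by (cases a) auto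

lemma loc_prog_acts:
  "(b, ws, d, ops) \<in> set_rprog (loc_prog k i a) \<Longrightarrow> length ws = k \<and> length ops = k"
  by (cases a) (auto simp: set_rprog_subst move_act_def simp del: on_tape.simps dest: on_tape_acts)

lemma head_prog_acts:
  "(b, ws, d, ops) \<in> set_rprog (head_prog k a) \<Longrightarrow> length ws = k \<and> length ops = k"
  by (cases a) (auto simp: set_rprog_subst simp del: loc_prog.simps dest: loc_prog_acts)

lemma head_rel_init: "head_rel x k (replicate k 0) (0, replicate k (tape [], 0))"
  unfolding head_rel_def by (auto intro!: exI[of _ "[]"])

text \<open>All exponents \<open>m\<close> are at most the integer \<open>L\<close>, so the scanned
  cells of a tape lie among 0 to \<open>L + 2\<close>, which are \<open>L + 3\<close> cells.\<close>

lemma bounded_heads_space: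
  assumes "cs \<noteq> []" "\<And>c. c \<in> set cs \<Longrightarrow> bounded_heads x (ipos c, work c) \<and> length (work c) = k"
  shows "real (space cs) \<le> real k * (log 2 (2 * (real (length x) + 1)) + 3)"
proof -
  define L where "L = nat \<lfloor>log 2 (2 * (real (length x) + 1))\<rfloor>"
  have pos: "log 2 (2 * (real (length x) + 1)) \<ge> 0" by simp
  have m: "m \<le> L" if "2 ^ m \<le> 2 * Suc (length x)" for m
  proof -
    have "real (2 ^ m) \<le> real (2 * Suc (length x))" using that of_nat_le_iff by blast
    then have "2 powr real m \<le> 2 * (real (length x) + 1)" by (simp add: powr_realpow)
    then have "real m \<le> log 2 (2 * (real (length x) + 1))"
      by (subst le_log_iff) (auto)
    then show ?thesis unfolding L_def by (simp add: le_nat_floor)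
  qed
  have "(\<Union>c\<in>set cs. {(i, snd (work c ! i)) | i. i < length (work c)}) \<subseteq> {..<k} \<times> {..L + 2}"
  proof clarsimp
    fix c i assume c: "c \<in> set cs" "i < length (work c)"
    obtain f h where fh: "work c ! i = (f, h)" by force
    with c have "(f, h) \<in> set (work c)" by (metis nth_mem)
    with assms(2)[OF c(1)] obtain n where "2 ^ n \<le> 2 * Suc (length x)" "h \<le> n + 2"
      unfolding bounded_heads_def by fastforce
    with m[of n] assms(2)[OF c(1)] c(2) fh
    show "i < k \<and> snd (work c ! i) \<le> Suc (Suc L)" by simp
  qed
  then have "space cs \<le> card ({..<k} \<times> {..L + 2})"
    unfolding space_def by (rule card_mono[rotated]) simp
  then have "space cs \<le> k * (L + 3)" by (simp add: card_cartesian_product algebra_simps)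
  then have "real (space cs) \<le> real k * (real L + 3)"
    by (metis of_nat_add of_nat_le_iff of_nat_mult of_nat_numeral)
  also have "\<dots> \<le> real k * (log 2 (2 * (real (length x) + 1)) + 3)"
    using pos by (intro mult_left_mono) (auto simp: L_def)
  finally show ?thesis .
qed

theorem head_prog_to_ntm:
  fixes Q :: "hact rprog"
  assumes "\<And>a. a \<in> set_rprog Q \<Longrightarrow> fst a < k"
  obtains M where "ntm M"
    "\<And>x. accepts M x \<longleftrightarrow> (\<exists>ps. (replicate k 0, ps) \<in> sem (head_act x) Q)"
    "\<And>x. in_space M x (real k * (log 2 (2 * (real (length x) + 1)) + 3))"
proof -
  define P where "P = Seq (Act (start_act k)) (subst (head_prog k) Q)"
  \<comment> \<open>The closing action demanded by \<open>rprog_to_ntm\<close>. A finished program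
    has the input head at 0 and all tapes resting, so this action always applies and changes
    nothing.\<close>
  let ?b = "move_act k LeftEnd Stay"
  have acts: "length ws = k \<and> length ops = k" if "(a, ws, d, ops) \<in> set_rprog (Seq P (Act ?b))" for a ws d ops
    using that unfolding P_def
    by (auto simp: move_act_def start_act_def set_rprog_subst simp del: head_prog.simps dest: head_prog_acts)
  have sim: "simulates (head_rel x k) (sem (head_act x) Q) (sem (tm_act x) (subst (head_prog k) Q))" for x
    by (rule simulates_subst, rule simulates_head_prog) (rule assms)
  have P: "(init_state k, t) \<in> sem (tm_act x) P \<longleftrightarrow>
      ((0, replicate k (tape [], 0)), t) \<in> sem (tm_act x) (subst (head_prog k) Q)" for x t
    unfolding P_def sem.simps relcomp_unfold by (auto simp: tm_act_start)
  have last: "(t, t') \<in> tm_act x ?b \<longleftrightarrow> t' = t" if rel: "head_rel x k ps t" for x ps t t'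
  proof -
    obtain w where w: "t = (0, w)" "length w = k" using rel unfolding head_rel_def by blast
    show ?thesis
      using tm_act_move[OF head_rel_resting[OF rel[unfolded w(1)]] w(2), of 0 t' x] w(1)
      by (auto simp: input_sym_def)
  qed
  obtain M where M: "ntm M"
    "\<And>x. accepts M x \<longleftrightarrow> (\<exists>s. (init_state k, s) \<in> sem (tm_act x) (Seq P (Act ?b)))"
    "\<And>x cs c. computation M x cs \<Longrightarrow> c \<in> set cs \<Longrightarrow>
       (init_state k, (ipos c, work c)) \<in> pre (tm_act x) (Seq P (Act ?b))"
    by (rule rprog_to_ntm[of P ?b k], erule acts, blast)
  show ?thesis
  proof (rule that)
    show "ntm M" by fact
    show "accepts M x \<longleftrightarrow> (\<exists>ps. (replicate k 0, ps) \<in> sem (head_act x) Q)" for x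
    proof
      assume "accepts M x"
      then obtain t where "(init_state k, t) \<in> sem (tm_act x) P" using M(2) by auto
      then show "\<exists>ps. (replicate k 0, ps) \<in> sem (head_act x) Q"
        using simulatesD2[OF sim head_rel_init] unfolding P by blast
    next
      assume "\<exists>ps. (replicate k 0, ps) \<in> sem (head_act x) Q"
      then obtain ps t where "(init_state k, t) \<in> sem (tm_act x) P" "head_rel x k ps t"
        using simulatesD1[OF sim head_rel_init] unfolding P by blast
      then have "(init_state k, t) \<in> sem (tm_act x) (Seq P (Act ?b))"
        using last[THEN iffD2, OF _ refl] unfolding sem.simps by blast
      then show "accepts M x" using M(2) by blast
    qed
    show "in_space M x (real k * (log 2 (2 * (real (length x) + 1)) + 3))" for x
      unfolding in_space_def
    proof (intro allI impI)
      fix cs assume cs: "computation M x cs"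
      show "real (space cs) \<le> real k * (log 2 (2 * (real (length x) + 1)) + 3)"
      proof (rule bounded_heads_space)
        show "cs \<noteq> []" using cs by (simp add: computation_def)
        fix c assume "c \<in> set cs"
        define t where "t = (ipos c, work c)"
        have "(init_state k, t) \<in> pre (tm_act x) (Seq P (Act ?b))"
          using M(3)[OF cs \<open>c \<in> set cs\<close>] by (simp add: t_def)
        then consider "t = init_state k" | "t = (0, replicate k (tape [], 0))"
          | "((0, replicate k (tape [], 0)), t) \<in> pre (tm_act x) (subst (head_prog k) Q)"
          | u where "((0, replicate k (tape [], 0)), u) \<in> sem (tm_act x) (subst (head_prog k) Q)"
            "u = t \<or> (u, t) \<in> tm_act x ?b"
          unfolding pre.simps sem.simps P_def Un_iff relcomp_unfold mem_Collect_eq tm_act_start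
          by (auto simp: tm_act_start)
        then have "bounded_heads x t \<and> length (snd t) = k"
        proof cases
          case 1
          then show ?thesis by (auto simp: init_state_def bounded_heads_def intro: exI[of _ 0])
        next
          case 2
          then show ?thesis using head_rel_bounded head_rel_init by blast
        next
          case 3
          have "\<exists>s1 t1. (replicate k 0, s1) \<in> pre (head_act x) Q \<and> head_rel x k s1 t1 \<and>
             (t = t1 \<or> (\<exists>a\<in>set_rprog Q. (t1, t) \<in> pre (tm_act x) (head_prog k a) \<and>
               (\<forall>s2. (s1, s2) \<in> head_act x a \<longrightarrow> (replicate k 0, s2) \<in> pre (head_act x) Q)))"
            using 3 by (rule pre_subst[rotated 2]) (use simulates_head_prog assms head_rel_init in blast)+
          then show ?thesis using head_rel_bounded pre_head_prog assms by metis
        next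
          case 4
          then obtain ps where "head_rel x k ps u" using simulatesD2[OF sim head_rel_init] by blast
          with 4(2) last[of x ps u t] have "head_rel x k ps t" by auto
          then show ?thesis using head_rel_bounded by blast
        qed
        then show "bounded_heads x (ipos c, work c) \<and> length (work c) = k" by (simp add: t_def)
      qed
    qed
  qed
qed

section \<open>Programs on the tokens of an encoded formula\<close>

type_synonym tok = "bool \<times> bool"

definition flat :: "tok list \<Rightarrow> bool list" where
  "flat ts = concat (map (\<lambda>(a, b). [a, b]) ts)"

lemma flat_simps [simp]: "flat [] = []" "flat ((a, b) # ts) = a # b # flat ts"
  "flat (ts @ us) = flat ts @ flat us"
  by (auto simp: flat_def)

lemma length_flat [simp]: "length (flat ts) = 2 * length ts"
  by (induction ts) auto

lemma nth_flat: "t < length ts \<Longrightarrow> flat ts ! (2 * t) = fst (ts ! t) \<and> flat ts ! Suc (2 * t) = snd (ts ! t)"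
proof (induction ts arbitrary: t)
  case (Cons a ts)
  then show ?case by (cases a; cases t) auto
qed simp

definition tok_at :: "tok list \<Rightarrow> nat \<Rightarrow> tok option" where
  "tok_at ts t = (if t < length ts then Some (ts ! t) else None)"

text \<open>Token \<open>t\<close> occupies the cells \<open>2 * t + 1\<close> and \<open>2 * t + 2\<close>; \<^term>\<open>None\<close> is the right end marker.\<close>
type_synonym tokact = "nat \<times> tok option \<times> move"

definition pos_act :: "tok list \<Rightarrow> tok option \<times> move \<Rightarrow> (nat \<times> nat) set" where
  "pos_act ts = (\<lambda>(a, d). {(t, t'). tok_at ts t = a \<and> (d = MoveL \<longrightarrow> t \<noteq> 0) \<and>
     (d = MoveR \<longrightarrow> a \<noteq> None) \<and> t' = shift d t})"

definition tok_act :: "tok list \<Rightarrow> tokact \<Rightarrow> (nat list \<times> nat list) set" where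
  "tok_act ts = (\<lambda>(i, a). {(\<tau>, \<tau>'). \<exists>t. (\<tau> ! i, t) \<in> pos_act ts a \<and> \<tau>' = \<tau>[i := t]})"

lemma in_pos_act: "(t, t') \<in> pos_act ts (a, d) \<longleftrightarrow> tok_at ts t = a \<and> (d = MoveL \<longrightarrow> t \<noteq> 0) \<and>
     (d = MoveR \<longrightarrow> a \<noteq> None) \<and> t' = shift d t"
  by (simp add: pos_act_def)

text \<open>Between actions a head stands on the first cell of its token, so recognising a token
  takes a step to the second cell. A left move ends by reading some bit, which fails on the left end
  marker and so forbids leaving token 0 to the left.\<close>

fun tok_prog :: "tokact \<Rightarrow> hact rprog" where
  "tok_prog (i, Some (a, b), MoveR) = Seq (Act (i, Bit a, MoveR)) (Act (i, Bit b, MoveR))"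
| "tok_prog (i, Some (a, b), Stay) = Seq (Act (i, Bit a, MoveR)) (Act (i, Bit b, MoveL))"
| "tok_prog (i, Some (a, b), MoveL) = Seq (Act (i, Bit a, MoveR)) (Seq (Act (i, Bit b, MoveL))
     (Seq (Act (i, Bit a, MoveL)) (choice [(i, Bit True, MoveL), (i, Bit False, MoveL)])))"
| "tok_prog (i, None, MoveR) = Fail"
| "tok_prog (i, None, Stay) = Act (i, RightEnd, Stay)"
| "tok_prog (i, None, MoveL) = Seq (Act (i, RightEnd, MoveL)) (choice [(i, Bit True, MoveL), (i, Bit False, MoveL)])"

definition tok_rel :: "tok list \<Rightarrow> nat \<Rightarrow> nat list \<Rightarrow> nat list \<Rightarrow> bool" where
  "tok_rel ts k \<tau> ps \<longleftrightarrow> length \<tau> = k \<and> (\<forall>t\<in>set \<tau>. t \<le> length ts) \<and> ps = map (\<lambda>t. Suc (2 * t)) \<tau>"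

lemma in_head_act: "(ps, ps') \<in> head_act x (i, a, d) \<longleftrightarrow>
  input_sym x (ps ! i) = a \<and> ps' = ps[i := min (shift d (ps ! i)) (Suc (length x))]"
  by (simp add: head_act_def)

lemma input_sym_flat1:
  "input_sym (flat ts) (Suc (2 * t)) = (case tok_at ts t of Some (a, b) \<Rightarrow> Bit a | None \<Rightarrow> RightEnd)"
  using nth_flat[of t ts] by (auto simp: input_sym_def tok_at_def split: prod.splits)

lemma input_sym_flat2:
  "t < length ts \<Longrightarrow> input_sym (flat ts) (Suc (Suc (2 * t))) = Bit (snd (ts ! t))"
  using nth_flat[of t ts] by (auto simp: input_sym_def)

lemma sem_tok_prog:
  assumes "i < k" "tok_rel ts k \<tau> ps"
  shows "(ps, ps') \<in> sem (head_act (flat ts)) (tok_prog (i, a, d)) \<longleftrightarrow>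
    (\<exists>t. (\<tau> ! i, t) \<in> pos_act ts (a, d) \<and> ps' = ps[i := Suc (2 * t)])"
proof -
  define t where "t = \<tau> ! i"
  have p: "ps ! i = Suc (2 * t)" "i < length ps" and t: "t \<le> length ts"
    using assms by (auto simp: tok_rel_def t_def)
  have id: "ps[i := Suc (2 * t)] = ps" using p(1) by (metis list_update_id)
  have bit: "input_sym (flat ts) (Suc (Suc (2 * r))) = Bit True \<or> input_sym (flat ts) (Suc (Suc (2 * r))) = Bit False"
    if "t = Suc r" for r
    using input_sym_flat2[of r ts] that t by (cases "snd (ts ! r)") auto
  have left: "input_sym (flat ts) 0 = LeftEnd" by (simp add: input_sym_def)
  have None_iff: "input_sym (flat ts) (Suc (2 * t)) = RightEnd \<longleftrightarrow> tok_at ts t = None"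
    using input_sym_flat1[of ts t] by (auto split: option.splits)
  show ?thesis
  proof (cases a)
    case None
    note [simp] = in_head_act in_pos_act relcomp_unfold sem_choice p None None_iff t_def[symmetric]
    show ?thesis
    proof (cases d)
      case MoveL
      show ?thesis
      proof (cases t)
        case 0
        then show ?thesis using p(2) left by (auto simp: MoveL)
      next
        case (Suc r)
        then show ?thesis using p(2) t None_iff bit[OF Suc] by (auto simp: MoveL min_def)
      qed
    next
      case Stay
      then show ?thesis using t id by (auto simp: min_def)
    qed simp
  next
    case (Some ab)
    obtain b c where ab: "a = Some (b, c)" using Some by (cases ab) auto
    show ?thesis
    proof (cases "t < length ts")
      case False
      then have "tok_at ts t = None" by (simp add: tok_at_def)
      then have "input_sym (flat ts) (Suc (2 * t)) = RightEnd" using None_iff by simp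
      then show ?thesis using \<open>tok_at ts t = None\<close> p
        by (cases d) (auto simp: ab in_head_act in_pos_act relcomp_unfold t_def[symmetric])
    next
      case True
      have eq: "tok_at ts t = Some (b, c) \<longleftrightarrow>
         input_sym (flat ts) (Suc (2 * t)) = Bit b \<and> input_sym (flat ts) (Suc (Suc (2 * t))) = Bit c"
        using input_sym_flat1[of ts t] input_sym_flat2[of t ts] True
        by (auto simp: tok_at_def prod_eq_iff split: prod.splits)
      note [simp] = in_head_act in_pos_act relcomp_unfold sem_choice p ab t_def[symmetric]
      show ?thesis
      proof (cases d)
        case MoveL
        show ?thesis
        proof (cases t)
          case 0
          then show ?thesis using p(2) left True by (auto simp: MoveL min_def)
        next
          case (Suc r)
          have "min (Suc (Suc (2 * t))) (Suc (2 * length ts)) = Suc (Suc (2 * t))" using True by simp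
          then show ?thesis using p(2) bit[OF Suc] True eq Suc by (auto simp: MoveL)
        qed
      next
        case Stay
        then show ?thesis using id p(2) True eq by auto
      next
        case MoveR
        then show ?thesis using p(2) True eq by auto
      qed
    qed
  qed
qed

lemma pos_act_le: "(t, t') \<in> pos_act ts a \<Longrightarrow> t \<le> length ts \<Longrightarrow> t' \<le> length ts"
  by (cases a; cases "snd a") (auto simp: in_pos_act tok_at_def split: if_splits)

lemma simulates_tok_prog:
  assumes "fst a < k"
  shows "simulates (tok_rel ts k) (tok_act ts a) (sem (head_act (flat ts)) (tok_prog a))"
proof -
  obtain i b d where a: "a = (i, b, d)" by (cases a)
  with assms have i: "i < k" by simp
  have rel: "tok_rel ts k (\<tau>[i := t]) (ps[i := Suc (2 * t)])"
    if "tok_rel ts k \<tau> ps" "(\<tau> ! i, t) \<in> pos_act ts (b, d)" for \<tau> ps t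
  proof -
    have "t \<le> length ts" using pos_act_le[OF that(2)] that(1) i by (auto simp: tok_rel_def)
    then show ?thesis using that(1) set_update_subset_insert[of \<tau> i t]
      by (auto simp: tok_rel_def map_update)
  qed
  show ?thesis
  proof (rule simulatesI)
    fix \<tau> ps \<tau>' assume *: "tok_rel ts k \<tau> ps" "(\<tau>, \<tau>') \<in> tok_act ts a"
    then obtain t where "(\<tau> ! i, t) \<in> pos_act ts (b, d)" "\<tau>' = \<tau>[i := t]" by (auto simp: tok_act_def a)
    with *(1) rel[OF *(1)] show "\<exists>ps'. (ps, ps') \<in> sem (head_act (flat ts)) (tok_prog a) \<and> tok_rel ts k \<tau>' ps'"
      unfolding a sem_tok_prog[OF i *(1)] by blast
  next
    fix \<tau> ps ps' assume *: "tok_rel ts k \<tau> ps" "(ps, ps') \<in> sem (head_act (flat ts)) (tok_prog a)"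
    then obtain t where "(\<tau> ! i, t) \<in> pos_act ts (b, d)" "ps' = ps[i := Suc (2 * t)]"
      unfolding a sem_tok_prog[OF i *(1)] by blast
    with rel[OF *(1)] show "\<exists>\<tau>'. (\<tau>, \<tau>') \<in> tok_act ts a \<and> tok_rel ts k \<tau>' ps'"
      unfolding tok_act_def a by blast
  qed
qed

definition on_head :: "nat \<Rightarrow> (tok option \<times> move) rprog \<Rightarrow> tokact rprog" where
  "on_head i = subst (\<lambda>a. Act (i, a))"

lemma sem_on_head:
  assumes "i < length \<tau>"
  shows "(\<tau>, \<tau>') \<in> sem (tok_act ts) (on_head i q) \<longleftrightarrow>
    (\<exists>t. (\<tau> ! i, t) \<in> sem (pos_act ts) q \<and> \<tau>' = \<tau>[i := t])"
proof -
  define R where "R = (\<lambda>t \<tau>'. \<tau>' = \<tau>[i := t])"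
  have "simulates R (pos_act ts a) (sem (tok_act ts) (Act (i, a)))" for a
    using assms by (intro simulatesI) (auto simp: R_def tok_act_def)
  then have sim: "simulates R (sem (pos_act ts) q) (sem (tok_act ts) (on_head i q))"
    unfolding on_head_def by (intro simulates_subst)
  have "R (\<tau> ! i) \<tau>" by (simp add: R_def)
  from simulatesD1[OF sim this] simulatesD2[OF sim this] show ?thesis unfolding R_def by blast
qed

definition digits :: "bool list \<Rightarrow> tok list" where
  "digits ds = map (Pair True) ds"

text \<open>True at the two markers and also at the right end of the input, that is, wherever a
  digit string can stop.\<close>

definition no_digit :: "tok list \<Rightarrow> nat \<Rightarrow> bool" where
  "no_digit ts t \<longleftrightarrow> (\<forall>b. tok_at ts t \<noteq> Some (True, b))"

definition skip_digit :: "move \<Rightarrow> (tok option \<times> move) rprog" where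
  "skip_digit d = choice [(Some (True, True), d), (Some (True, False), d)]"

lemma sem_skip_digit:
  "(t, t') \<in> sem (pos_act ts) (skip_digit d) \<longleftrightarrow>
    \<not> no_digit ts t \<and> (d = MoveL \<longrightarrow> t \<noteq> 0) \<and> t' = shift d t"
proof -
  have "\<not> no_digit ts t \<longleftrightarrow> tok_at ts t = Some (True, True) \<or> tok_at ts t = Some (True, False)"
    unfolding no_digit_def by (metis (full_types))
  then show ?thesis by (auto simp: skip_digit_def sem_choice in_pos_act)
qed

lemma tok_at_append: "tok_at (xs @ ys) (length xs + t) = tok_at ys t"
  by (simp add: tok_at_def)

lemma digits_not_no_digit:
  assumes "ts = xs @ digits ds @ ys" "j < length ds"
  shows "\<not> no_digit ts (length xs + j)" "tok_at ts (length xs + j) = Some (True, ds ! j)"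
  using assms by (auto simp: no_digit_def tok_at_append digits_def tok_at_def nth_append)

text \<open>\<open>skip_digit\<close> works only on digits and \<open>B\<close> only off them, so
  the loop has exactly one successful exit, behind the last digit.\<close>

lemma scan_right:
  assumes "ts = xs @ digits ds @ ys" "no_digit ts (length xs + length ds)"
    and "\<And>t t'. (t, t') \<in> B \<Longrightarrow> no_digit ts t"
  shows "(length xs, s) \<in> (sem (pos_act ts) (skip_digit MoveR))\<^sup>* O B \<longleftrightarrow> (length xs + length ds, s) \<in> B"
proof -
  \<comment> \<open>\<open>j\<close> counts the digits still ahead; the induction runs backwards
    from the end of the string.\<close>
  have "j \<le> length ds \<Longrightarrow> (length xs + (length ds - j), s) \<in> (sem (pos_act ts) (skip_digit MoveR))\<^sup>* O B \<longleftrightarrow>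
    (length xs + length ds, s) \<in> B" for j
  proof (induction j)
    case 0
    show ?case using assms(2) by (subst star_relcomp_unfold) (simp add: sem_skip_digit)
  next
    case (Suc j)
    define p where "p = length xs + (length ds - Suc j)"
    have 1: "\<not> no_digit ts p"
      unfolding p_def by (rule digits_not_no_digit(1)[OF assms(1)]) (use Suc.prems in simp)
    then have 2: "(p, s) \<notin> B" using assms(3) by blast
    have 3: "length xs + (length ds - j) = Suc p" using Suc.prems by (simp add: p_def)
    show ?case using Suc.IH Suc.prems unfolding 3 p_def[symmetric]
      by (subst star_relcomp_unfold) (simp add: sem_skip_digit 1 2)
  qed
  from this[of "length ds"] show ?thesis by simp
qed

lemma scan_left:
  assumes "ts = xs @ (False, m) # digits ds @ ys" "j \<le> length ds"
    and "\<And>t t'. (t, t') \<in> B \<Longrightarrow> no_digit ts t"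
  shows "(length xs + j, s) \<in> (sem (pos_act ts) (skip_digit MoveL))\<^sup>* O B \<longleftrightarrow> (length xs, s) \<in> B"
  using assms(2)
proof (induction j)
  case 0
  have "no_digit ts (length xs)" using assms(1) by (simp add: no_digit_def tok_at_def)
  then show ?case by (subst star_relcomp_unfold) (simp add: sem_skip_digit)
next
  case (Suc j)
  have 1: "\<not> no_digit ts (Suc (length xs + j))"
    using digits_not_no_digit(1)[of ts "xs @ [(False, m)]" ds ys j] assms(1) Suc.prems by simp
  then have 2: "(Suc (length xs + j), s) \<notin> B" using assms(3) by blast
  show ?case using Suc by (subst star_relcomp_unfold) (simp add: sem_skip_digit 1 2)
qed

text \<open>No copy of the position where a literal starts is kept. It is recovered from the token
  behind the literal by scanning back to the marker.\<close>

definition to_start :: "(tok option \<times> move) rprog" where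
  "to_start = Seq (choice [(None, MoveL), (Some (False, False), MoveL), (Some (False, True), MoveL)])
     (Seq (Star (skip_digit MoveL)) (Act (Some (False, True), Stay)))"

lemma no_digit_cases:
  "no_digit ts t \<longleftrightarrow> tok_at ts t = None \<or> tok_at ts t = Some (False, False) \<or> tok_at ts t = Some (False, True)"
  unfolding no_digit_def by (cases "tok_at ts t") auto

lemma sem_to_start:
  "(t, s) \<in> sem (pos_act ts) to_start \<longleftrightarrow> no_digit ts t \<and> t \<noteq> 0 \<and>
    (t - 1, s) \<in> (sem (pos_act ts) (skip_digit MoveL))\<^sup>* O pos_act ts (Some (False, True), Stay)"
  by (auto simp: to_start_def sem_choice no_digit_cases relcomp_unfold in_pos_act)

lemma sem_to_start_literal:
  assumes "ts = xs @ (False, True) # digits ds @ ys" "no_digit ts (Suc (length xs + length ds))"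
  shows "(Suc (length xs + length ds), s) \<in> sem (pos_act ts) to_start \<longleftrightarrow> s = length xs"
proof -
  have "(length xs + length ds, s) \<in> (sem (pos_act ts) (skip_digit MoveL))\<^sup>* O pos_act ts (Some (False, True), Stay)
    \<longleftrightarrow> (length xs, s) \<in> pos_act ts (Some (False, True), Stay)"
    by (rule scan_left[OF assms(1)]) (auto simp: in_pos_act no_digit_def)
  moreover have "tok_at ts (length xs) = Some (False, True)" using assms(1) by (simp add: tok_at_def)
  ultimately show ?thesis using assms(2) by (auto simp: sem_to_start in_pos_act)
qed

section \<open>Guessing and comparing literals\<close>

text \<open>Going left by any amount and then right by any amount reaches every position, wherever
  the head was before. Thus a guess forgets the old position.\<close>

definition guess :: "(tok option \<times> move) rprog" where
  "guess = Seq (Star (choice [(None, MoveL), (Some (False, False), MoveL), (Some (False, True), MoveL),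
       (Some (True, False), MoveL), (Some (True, True), MoveL)]))
     (Seq (Star (choice [(Some (False, False), MoveR), (Some (False, True), MoveR),
       (Some (True, False), MoveR), (Some (True, True), MoveR)])) (Act (Some (False, True), Stay)))"

lemma sem_guess:
  assumes "t \<le> length ts"
  shows "(t, s) \<in> sem (pos_act ts) guess \<longleftrightarrow> tok_at ts s = Some (False, True)"
proof -
  define L where "L = sem (pos_act ts) (choice [(None, MoveL), (Some (False, False), MoveL), (Some (False, True), MoveL),
       (Some (True, False), MoveL), (Some (True, True), MoveL)])"
  define R where "R = sem (pos_act ts) (choice [(Some (False, False), MoveR), (Some (False, True), MoveR),
       (Some (True, False), MoveR), (Some (True, True), MoveR)])"
  have L: "(Suc u, u) \<in> L" for u
    unfolding L_def by (cases "tok_at ts (Suc u)") (auto simp: sem_choice in_pos_act)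
  have R: "(u, Suc u) \<in> R" if "u < length ts" for u
    using that unfolding R_def by (cases "ts ! u") (auto simp: sem_choice in_pos_act tok_at_def)
  have "(t, 0) \<in> L\<^sup>*"
    by (induction t) (auto intro: L converse_rtrancl_into_rtrancl)
  moreover have "(0, u) \<in> R\<^sup>*" if "u \<le> length ts" for u
    using that by (induction u) (auto intro: rtrancl_into_rtrancl[OF _ R])
  ultimately have "(t, u) \<in> L\<^sup>* O R\<^sup>*" if "u \<le> length ts" for u using that by blast
  moreover have "s \<le> length ts" if "tok_at ts s = Some (False, True)"
    using that by (auto simp: tok_at_def split: if_splits)
  moreover have "sem (pos_act ts) guess = (L\<^sup>* O R\<^sup>*) O pos_act ts (Some (False, True), Stay)"
    by (simp add: guess_def L_def R_def O_assoc)
  ultimately show ?thesis by (auto simp: in_pos_act relcomp_unfold)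
qed

definition both :: "nat \<Rightarrow> nat \<Rightarrow> (bool \<Rightarrow> bool) \<Rightarrow> tokact rprog" where
  "both i j f = Alt (Seq (Act (i, Some (True, True), MoveR)) (Act (j, Some (True, f True), MoveR)))
     (Seq (Act (i, Some (True, False), MoveR)) (Act (j, Some (True, f False), MoveR)))"

text \<open>The first \<open>both\<close> treats the sign: \<open>b\<close> being
  \<open>True\<close> asks for equal literals, \<open>False\<close> for complementary ones.
  \<open>to_start\<close> begins only on a non-digit, so both names must end at the same time and a
  proper prefix is not taken for equal. Afterwards both heads are back where they started.\<close>

definition compare :: "nat \<Rightarrow> nat \<Rightarrow> bool \<Rightarrow> tokact rprog" where
  "compare i j b = Seq (Act (i, Some (False, True), MoveR)) (Seq (Act (j, Some (False, True), MoveR))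
     (Seq (both i j (\<lambda>c. c = b)) (Seq (Star (both i j (\<lambda>c. c))) (Seq (on_head i to_start) (on_head j to_start)))))"

lemma in_tok_act: "(\<tau>, \<tau>') \<in> tok_act ts (i, a, d) \<longleftrightarrow> tok_at ts (\<tau> ! i) = a \<and> (d = MoveL \<longrightarrow> \<tau> ! i \<noteq> 0) \<and>
     (d = MoveR \<longrightarrow> a \<noteq> None) \<and> \<tau>' = \<tau>[i := shift d (\<tau> ! i)]"
  by (auto simp: tok_act_def in_pos_act)

lemma sem_both:
  assumes "i \<noteq> j" "i < length \<tau>" "j < length \<tau>"
  shows "(\<tau>, \<tau>') \<in> sem (tok_act ts) (both i j f) \<longleftrightarrow> (\<exists>c. tok_at ts (\<tau> ! i) = Some (True, c) \<and>
    tok_at ts (\<tau> ! j) = Some (True, f c) \<and> \<tau>' = \<tau>[i := Suc (\<tau> ! i), j := Suc (\<tau> ! j)])"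
  using assms by (auto simp: both_def relcomp_unfold in_tok_act ex_bool_eq)

lemma list_update_twice:
  "i \<noteq> j \<Longrightarrow> xs[i := a, j := b, i := c, j := d] = xs[i := c, j := d]"
  by (metis list_update_overwrite list_update_swap)

lemma both_loop:
  assumes "i \<noteq> j" "ts = xs @ digits ds @ ys" "ts = xs' @ digits es @ ys'"
    and "no_digit ts (length xs + length ds)" "no_digit ts (length xs' + length es)"
    and B: "\<And>\<tau> \<tau>'. (\<tau>, \<tau>') \<in> B \<Longrightarrow> i < length \<tau> \<Longrightarrow> j < length \<tau> \<Longrightarrow> no_digit ts (\<tau> ! i) \<and> no_digit ts (\<tau> ! j)"
    and "i < length \<tau>" "j < length \<tau>" "\<tau> ! i = length xs" "\<tau> ! j = length xs'"
  shows "(\<tau>, s) \<in> (sem (tok_act ts) (both i j (\<lambda>c. c)))\<^sup>* O B \<longleftrightarrow>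
    ds = es \<and> (\<tau>[i := length xs + length ds, j := length xs' + length es], s) \<in> B"
  using assms(2-5,7-10)
proof (induction ds arbitrary: es xs xs' \<tau>)
  case Nil
  have "no_digit ts (\<tau> ! i)" using Nil.prems by simp
  then have 1: "(\<tau>, u) \<notin> sem (tok_act ts) (both i j (\<lambda>c. c))" for u
    using Nil.prems assms(1) by (auto simp: sem_both no_digit_def)
  have 2: "(\<tau>, s) \<in> B \<Longrightarrow> es = []"
  proof (rule ccontr)
    assume "(\<tau>, s) \<in> B" "es \<noteq> []"
    moreover from this have "\<not> no_digit ts (length xs')"
      using digits_not_no_digit(1)[OF Nil.prems(2), of 0] by simp
    ultimately show False using B[of \<tau> s] Nil.prems by simp
  qed
  have 3: "\<tau>[i := length xs, j := length xs'] = \<tau>" using Nil.prems by (metis list_update_id)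
  show ?case using 1 2 3 by (subst star_relcomp_unfold) auto
next
  case (Cons d ds)
  have d: "tok_at ts (length xs) = Some (True, d)"
    using digits_not_no_digit(2)[OF Cons.prems(1), of 0] by simp
  then have "\<not> no_digit ts (\<tau> ! i)" using Cons.prems by (simp add: no_digit_def)
  then have 1: "(\<tau>, s) \<notin> B" using B[of \<tau> s] Cons.prems by blast
  show ?case
  proof (cases es)
    case Nil
    then have "no_digit ts (\<tau> ! j)" using Cons.prems by simp
    then have 2: "(\<tau>, u) \<notin> sem (tok_act ts) (both i j (\<lambda>c. c))" for u
      using Cons.prems assms(1) by (auto simp: sem_both no_digit_def)
    show ?thesis using 1 2 Nil by (subst star_relcomp_unfold) simp
  next
    case [simp]: (Cons e es')
    have e: "tok_at ts (length xs') = Some (True, e)"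
      using digits_not_no_digit(2)[OF Cons.prems(2), of 0] by simp
    let ?\<tau> = "\<tau>[i := Suc (length xs), j := Suc (length xs')]"
    have 2: "(\<tau>, u) \<in> sem (tok_act ts) (both i j (\<lambda>c. c)) \<longleftrightarrow> d = e \<and> u = ?\<tau>" for u
      using Cons.prems assms(1) d e by (auto simp: sem_both)
    have 3: "(?\<tau>, s) \<in> (sem (tok_act ts) (both i j (\<lambda>c. c)))\<^sup>* O B \<longleftrightarrow>
      ds = es' \<and> (?\<tau>[i := length (xs @ [(True, d)]) + length ds, j := length (xs' @ [(True, e)]) + length es'], s) \<in> B"
    proof (rule Cons.IH)
      show "ts = (xs @ [(True, d)]) @ digits ds @ ys" "ts = (xs' @ [(True, e)]) @ digits es' @ ys'"
        using Cons.prems(1,2) by (simp_all add: digits_def)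
      show "no_digit ts (length (xs @ [(True, d)]) + length ds)"
        "no_digit ts (length (xs' @ [(True, e)]) + length es')" using Cons.prems(3,4) by simp_all
    qed (use Cons.prems(5,6) assms(1) in simp_all)
    have len: "length (xs @ [(True, d)]) + length ds = length xs + length (d # ds)"
      "length (xs' @ [(True, e)]) + length es' = length xs' + length es" by simp_all
    have 4: "?\<tau>[i := length (xs @ [(True, d)]) + length ds, j := length (xs' @ [(True, e)]) + length es'] =
      \<tau>[i := length xs + length (d # ds), j := length xs' + length es]"
      unfolding list_update_twice[OF assms(1)] len ..
    have 5: "(\<tau>, s) \<in> (sem (tok_act ts) (both i j (\<lambda>c. c)))\<^sup>* O B \<longleftrightarrow>
      d = e \<and> (?\<tau>, s) \<in> (sem (tok_act ts) (both i j (\<lambda>c. c)))\<^sup>* O B"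
      by (subst star_relcomp_unfold) (metis 1 2)
    show ?thesis unfolding 5 3 4 by simp
  qed
qed

text \<open>The last conjunct makes \<open>ds\<close> the complete name and not a prefix of it; the
  2 counts the marker and the sign.\<close>

definition literal_at :: "tok list \<Rightarrow> nat \<Rightarrow> bool \<Rightarrow> bool list \<Rightarrow> bool" where
  "literal_at ts t b ds \<longleftrightarrow> (\<exists>xs ys. ts = xs @ (False, True) # digits (b # ds) @ ys \<and>
     t = length xs \<and> no_digit ts (t + length ds + 2))"

lemma literal_at_toks:
  assumes "literal_at ts t b ds"
  shows "tok_at ts t = Some (False, True)" "tok_at ts (Suc t) = Some (True, b)"
proof -
  obtain xs ys where x: "ts = xs @ (False, True) # digits (b # ds) @ ys" "t = length xs"
    using assms unfolding literal_at_def by (elim exE conjE) (simp only:)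
  then show "tok_at ts t = Some (False, True)" by (simp add: tok_at_def)
  show "tok_at ts (Suc t) = Some (True, b)"
    using digits_not_no_digit(2)[of ts "xs @ [(False, True)]" "b # ds" ys 0] x by simp
qed

lemma sem_compare:
  assumes "i \<noteq> j" "i < length \<tau>" "j < length \<tau>" "literal_at ts (\<tau> ! i) b ds" "literal_at ts (\<tau> ! j) c es"
  shows "(\<tau>, s) \<in> sem (tok_act ts) (compare i j r) \<longleftrightarrow> s = \<tau> \<and> ds = es \<and> c = (b = r)"
proof -
  obtain xs ys where x: "ts = xs @ (False, True) # digits (b # ds) @ ys" "\<tau> ! i = length xs"
    "no_digit ts (length xs + length ds + 2)"
    using assms(4) unfolding literal_at_def by (elim exE conjE) (simp only:)
  obtain xs' ys' where x': "ts = xs' @ (False, True) # digits (c # es) @ ys'" "\<tau> ! j = length xs'"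
    "no_digit ts (length xs' + length es + 2)"
    using assms(5) unfolding literal_at_def by (elim exE conjE) (simp only:)
  define B where "B = sem (tok_act ts) (on_head i to_start) O sem (tok_act ts) (on_head j to_start)"
  note at = literal_at_toks(1)[OF assms(4)] literal_at_toks(1)[OF assms(5)]
  have at1: "tok_at ts (Suc (length xs)) = Some (True, b)" "tok_at ts (Suc (length xs')) = Some (True, c)"
    using literal_at_toks(2)[OF assms(4)] literal_at_toks(2)[OF assms(5)] x(2) x'(2) by simp_all
  let ?\<tau>1 = "\<tau>[i := Suc (length xs), j := Suc (length xs')]"
  let ?\<tau>2 = "\<tau>[i := length xs + 2, j := length xs' + 2]"
  have sem: "(\<tau>, s) \<in> sem (tok_act ts) (compare i j r) \<longleftrightarrow>
    (?\<tau>1, s) \<in> sem (tok_act ts) (both i j (\<lambda>c. c = r)) O ((sem (tok_act ts) (both i j (\<lambda>c. c)))\<^sup>* O B)"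
  proof -
    have "(\<tau>, u) \<in> tok_act ts (i, Some (False, True), MoveR) \<longleftrightarrow> u = \<tau>[i := Suc (length xs)]" for u
      using at(1) x(2) by (simp add: in_tok_act)
    moreover have "(\<tau>[i := Suc (length xs)], u) \<in> tok_act ts (j, Some (False, True), MoveR) \<longleftrightarrow> u = ?\<tau>1" for u
      using at(2) x'(2) assms(1) by (simp add: in_tok_act)
    ultimately show ?thesis unfolding compare_def sem.simps B_def by (simp add: relcomp_unfold)
  qed
  also have "\<dots> \<longleftrightarrow> c = (b = r) \<and> (?\<tau>2, s) \<in> (sem (tok_act ts) (both i j (\<lambda>c. c)))\<^sup>* O B"
  proof -
    have "(?\<tau>1, u) \<in> sem (tok_act ts) (both i j (\<lambda>c. c = r)) \<longleftrightarrow> c = (b = r) \<and> u = ?\<tau>2" for u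
      using assms(1-3) at1 by (auto simp: sem_both list_update_twice)
    then show ?thesis by auto
  qed
  also have "(?\<tau>2, s) \<in> (sem (tok_act ts) (both i j (\<lambda>c. c)))\<^sup>* O B \<longleftrightarrow>
     ds = es \<and> (?\<tau>2[i := length (xs @ [(False, True), (True, b)]) + length ds,
       j := length (xs' @ [(False, True), (True, c)]) + length es], s) \<in> B"
  proof (rule both_loop[OF assms(1)])
    show "no_digit ts (\<sigma> ! i) \<and> no_digit ts (\<sigma> ! j)" if "(\<sigma>, \<sigma>') \<in> B" "i < length \<sigma>" "j < length \<sigma>" for \<sigma> \<sigma>'
      using that assms(1) by (auto simp: B_def sem_on_head sem_to_start)
    show "ts = (xs @ [(False, True), (True, b)]) @ digits ds @ ys" using x(1) by (simp add: digits_def)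
    show "ts = (xs' @ [(False, True), (True, c)]) @ digits es @ ys'" using x'(1) by (simp add: digits_def)
    show "no_digit ts (length (xs @ [(False, True), (True, b)]) + length ds)" using x(3) by (simp add: add_ac)
    show "no_digit ts (length (xs' @ [(False, True), (True, c)]) + length es)" using x'(3) by (simp add: add_ac)
  qed (use assms(1-3) in simp_all)
  also have "?\<tau>2[i := length (xs @ [(False, True), (True, b)]) + length ds,
       j := length (xs' @ [(False, True), (True, c)]) + length es] =
    \<tau>[i := Suc (length xs + length (b # ds)), j := Suc (length xs' + length (c # es))]" (is "_ = ?\<tau>3")
    unfolding list_update_twice[OF assms(1)] by simp
  also have "(?\<tau>3, s) \<in> B \<longleftrightarrow> s = \<tau>"
  proof -
    have "no_digit ts (Suc (length xs + length (b # ds)))" "no_digit ts (Suc (length xs' + length (c # es)))"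
      using x(3) x'(3) by simp_all
    note bk = sem_to_start_literal[OF x(1) this(1)] sem_to_start_literal[OF x'(1) this(2)]
    have "?\<tau>3[i := length xs, j := length xs'] = \<tau>"
      unfolding list_update_twice[OF assms(1)] x(2)[symmetric] x'(2)[symmetric] by simp
    then show ?thesis using bk assms(1-3) by (auto simp: B_def relcomp_unfold sem_on_head simp del: list.size)
  qed
  finally show ?thesis by blast
qed

section \<open>Encoded formulas\<close>

definition lit_toks :: "literal \<Rightarrow> tok list" where
  "lit_toks l = (False, True) # digits (is_Pos l # bits (var l))"

definition lits_toks :: "literal list \<Rightarrow> tok list" where
  "lits_toks C = concat (map lit_toks C)"

definition toks :: "formula \<Rightarrow> tok list" where
  "toks \<phi> = concat (map (\<lambda>C. (False, False) # lits_toks C) \<phi>)"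

lemma lits_toks_simps [simp]: "lits_toks [] = []" "lits_toks (l # C) = lit_toks l @ lits_toks C"
  "lits_toks (C @ D) = lits_toks C @ lits_toks D"
  by (auto simp: lits_toks_def)

lemma toks_simps [simp]: "toks [] = []" "toks (C # \<phi>) = (False, False) # lits_toks C @ toks \<phi>"
  "toks (\<phi> @ \<psi>) = toks \<phi> @ toks \<psi>"
  by (auto simp: toks_def)

lemma flat_digits: "flat (digits ds) = concat (map (\<lambda>b. [True, b]) ds)"
  by (induction ds) (auto simp: digits_def)

lemma flat_toks: "flat (toks \<phi>) = encode \<phi>"
proof -
  have l: "flat (lit_toks l) = enc_literal l" for l
    by (simp add: lit_toks_def enc_literal_def flat_digits)
  have "flat (lits_toks C) = concat (map enc_literal C)" for C
    by (induction C) (auto simp: l)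
  then show ?thesis
    by (induction \<phi>) (auto simp: encode_def enc_clause_def)
qed

lemma val_bits: "val (bits n) = n"
proof (induction n rule: bits.induct)
  case (1 n)
  show ?case
  proof (cases "n = 0")
    case False
    with 1 have "val (bits n) = of_bool (odd n) + 2 * (n div 2)" by (subst bits.simps) simp
    then show ?thesis by (simp add: mod_2_eq_odd[symmetric])
  qed (simp add: bits.simps)
qed

lemma bits_inject: "bits m = bits n \<longleftrightarrow> m = n"
  by (metis val_bits)

text \<open>\<open>t\<close> is the position of the marker opening this occurrence of
  \<open>l\<close>. The \<open>Suc\<close> accounts for the marker of its clause.\<close>

definition occurs :: "formula \<Rightarrow> nat \<Rightarrow> literal \<Rightarrow> bool" where
  "occurs \<phi> t l \<longleftrightarrow> (\<exists>\<phi>1 \<phi>2 c1 c2. \<phi> = \<phi>1 @ (c1 @ l # c2) # \<phi>2 \<and>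
     t = Suc (length (toks \<phi>1) + length (lits_toks c1)))"

lemma occursI:
  "\<phi> = \<phi>1 @ (c1 @ l # c2) # \<phi>2 \<Longrightarrow> t = Suc (length (toks \<phi>1) + length (lits_toks c1)) \<Longrightarrow> occurs \<phi> t l"
  unfolding occurs_def by blast

lemma no_digit_toks: "no_digit (toks \<phi>) 0"
  by (cases \<phi>) (auto simp: no_digit_def tok_at_def)

lemma no_digit_lits_toks: "no_digit (lits_toks C @ toks \<phi>) 0"
  using no_digit_toks by (cases C) (auto simp: no_digit_def tok_at_def lit_toks_def)

lemma no_digit_append: "no_digit (xs @ ys) (length xs + t) \<longleftrightarrow> no_digit ys t"
  by (simp add: no_digit_def tok_at_append)

lemma occurs_literal_at:
  assumes "occurs \<phi> t l"
  shows "literal_at (toks \<phi>) t (is_Pos l) (bits (var l))"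
proof -
  obtain \<phi>1 \<phi>2 c1 c2 where \<phi>: "\<phi> = \<phi>1 @ (c1 @ l # c2) # \<phi>2"
    and t: "t = Suc (length (toks \<phi>1) + length (lits_toks c1))"
    using assms unfolding occurs_def by blast
  let ?xs = "toks \<phi>1 @ (False, False) # lits_toks c1"
  let ?ys = "lits_toks c2 @ toks \<phi>2"
  have 1: "toks \<phi> = ?xs @ (False, True) # digits (is_Pos l # bits (var l)) @ ?ys"
    by (simp add: \<phi> lit_toks_def)
  have 2: "t = length ?xs" by (simp add: t)
  have "no_digit (toks \<phi>) (t + length (bits (var l)) + 2)"
    using no_digit_append[of "?xs @ (False, True) # digits (is_Pos l # bits (var l))" ?ys 0]
      no_digit_lits_toks[of c2 \<phi>2] unfolding 1 2 by (simp add: digits_def add_ac)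
  with 1 2 show ?thesis unfolding literal_at_def by blast
qed

lemma occurs_exists: "l \<in> set (concat \<phi>) \<Longrightarrow> \<exists>t. occurs \<phi> t l"
  unfolding occurs_def by (simp, metis in_set_conv_decomp)

lemma occurs_in: "occurs \<phi> t l \<Longrightarrow> l \<in> set (concat \<phi>)"
  unfolding occurs_def by auto

lemma nth_concat_map:
  "t < length (concat (map f xs)) \<Longrightarrow> \<exists>ys x zs r. xs = ys @ x # zs \<and> r < length (f x) \<and>
     t = length (concat (map f ys)) + r"
proof (induction xs arbitrary: t)
  case (Cons x xs)
  show ?case
  proof (cases "t < length (f x)")
    case True
    then show ?thesis by (intro exI[of _ "[]"] exI[of _ x] exI[of _ xs] exI[of _ t]) simp
  next
    case False
    with Cons.prems have "t - length (f x) < length (concat (map f xs))" by simp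
    from Cons.IH[OF this] obtain ys y zs r where
      "xs = ys @ y # zs" "r < length (f y)" "t - length (f x) = length (concat (map f ys)) + r" by blast
    with False show ?thesis
      by (intro exI[of _ "x # ys"] exI[of _ y] exI[of _ zs] exI[of _ r]) simp
  qed
qed simp

lemma tok_at_occurs: "tok_at (toks \<phi>) t = Some (False, True) \<longleftrightarrow> (\<exists>l. occurs \<phi> t l)"
proof
  assume *: "tok_at (toks \<phi>) t = Some (False, True)"
  then have "t < length (toks \<phi>)" by (auto simp: tok_at_def split: if_splits)
  from nth_concat_map[OF this[unfolded toks_def]] obtain \<phi>1 C \<phi>2 r where
    \<phi>: "\<phi> = \<phi>1 @ C # \<phi>2" "r < Suc (length (lits_toks C))" "t = length (toks \<phi>1) + r"
    unfolding toks_def[symmetric] by auto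
  have "tok_at ((False, False) # lits_toks C @ toks \<phi>2) r = Some (False, True)"
    using * by (simp add: \<phi> tok_at_append)
  with \<phi>(2) obtain s where s: "r = Suc s" "s < length (lits_toks C)" "lits_toks C ! s = (False, True)"
    by (cases r) (auto simp: tok_at_def nth_append)
  from nth_concat_map[OF s(2)[unfolded lits_toks_def]] obtain c1 l c2 u where
    C: "C = c1 @ l # c2" "u < length (lit_toks l)" "s = length (lits_toks c1) + u"
    unfolding lits_toks_def[symmetric] by auto
  \<comment> \<open>All tokens of a literal other than its first are digits.\<close>
  have "u = 0"
    using s(3) C(2) by (cases u) (auto simp: C(1,3) nth_append lit_toks_def digits_def simp del: list.map)
  then have "t = Suc (length (toks \<phi>1) + length (lits_toks c1))" using \<phi>(3) s(1) C(3) by simp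
  then show "\<exists>l. occurs \<phi> t l" unfolding occurs_def using \<phi>(1) C(1) by blast
next
  assume "\<exists>l. occurs \<phi> t l"
  then show "tok_at (toks \<phi>) t = Some (False, True)"
    using occurs_literal_at literal_at_toks(1) by blast
qed

fun neg :: "literal \<Rightarrow> literal" where
  "neg (Pos v) = Neg v"
| "neg (Neg v) = Pos v"

lemma neg_neg [simp]: "neg (neg l) = l"
  by (cases l) auto

lemma compare_occurs:
  assumes "i \<noteq> j" "i < length \<tau>" "j < length \<tau>" "occurs \<phi> (\<tau> ! i) l" "occurs \<phi> (\<tau> ! j) m"
  shows "(\<tau>, s) \<in> sem (tok_act (toks \<phi>)) (compare i j True) \<longleftrightarrow> s = \<tau> \<and> m = l"
    and "(\<tau>, s) \<in> sem (tok_act (toks \<phi>)) (compare i j False) \<longleftrightarrow> s = \<tau> \<and> m = neg l"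
  unfolding sem_compare[OF assms(1-3) occurs_literal_at[OF assms(4)] occurs_literal_at[OF assms(5)]] bits_inject
  by (cases l; cases m; auto)+

section \<open>The other literal of a clause\<close>

text \<open>The three alternatives look for a literal on the right, for one on the left, or check
  that the clause is a unit clause; in the last case the literal is its own sibling, since a unit
  clause is read as the disjunction of its literal with itself.\<close>

definition sibling :: "(tok option \<times> move) rprog" where
  "sibling = Alt (Seq (Act (Some (False, True), MoveR))
        (Seq (Star (skip_digit MoveR)) (Act (Some (False, True), Stay))))
     (Alt (Seq (Act (Some (False, True), MoveL))
        (Seq (Star (skip_digit MoveL)) (Act (Some (False, True), Stay))))
     (Seq (Act (Some (False, True), MoveL)) (Seq (Act (Some (False, False), MoveR))
        (Seq (Act (Some (False, True), MoveR)) (Seq (Star (skip_digit MoveR))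
          (Seq (choice [(None, Stay), (Some (False, False), Stay)]) to_start))))))"

lemma pos_act_relcomp:
  "(t, s) \<in> pos_act ts (a, d) O B \<longleftrightarrow> tok_at ts t = a \<and> (d = MoveL \<longrightarrow> t \<noteq> 0) \<and>
     (d = MoveR \<longrightarrow> a \<noteq> None) \<and> (shift d t, s) \<in> B"
  by (auto simp: relcomp_unfold in_pos_act)

lemma scan_literal:
  assumes "literal_at ts t b ds" "\<And>t t'. (t, t') \<in> B \<Longrightarrow> no_digit ts t"
  shows "(Suc t, s) \<in> (sem (pos_act ts) (skip_digit MoveR))\<^sup>* O B \<longleftrightarrow> (t + length ds + 2, s) \<in> B"
proof -
  obtain xs ys where x: "ts = xs @ (False, True) # digits (b # ds) @ ys" "t = length xs"
    "no_digit ts (t + length ds + 2)"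
    using assms(1) unfolding literal_at_def by (elim exE conjE) (simp only:)
  have "(length (xs @ [(False, True)]), s) \<in> (sem (pos_act ts) (skip_digit MoveR))\<^sup>* O B \<longleftrightarrow>
     (length (xs @ [(False, True)]) + length (b # ds), s) \<in> B"
  proof (rule scan_right)
    show "ts = (xs @ [(False, True)]) @ digits (b # ds) @ ys" using x(1) by simp
    show "no_digit ts (length (xs @ [(False, True)]) + length (b # ds))" using x(2,3) by simp
  qed (rule assms(2))
  then show ?thesis by (simp add: x(2))
qed

lemma scan_back_literal:
  assumes "literal_at ts t b ds" "\<And>t t'. (t, t') \<in> B \<Longrightarrow> no_digit ts t"
  shows "(t + length ds + 1, s) \<in> (sem (pos_act ts) (skip_digit MoveL))\<^sup>* O B \<longleftrightarrow> (t, s) \<in> B"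
proof -
  obtain xs ys where x: "ts = xs @ (False, True) # digits (b # ds) @ ys" "t = length xs"
    using assms(1) unfolding literal_at_def by (elim exE conjE) (simp only:)
  from scan_left[OF x(1), of "length (b # ds)" B s] assms(2) show ?thesis by (simp add: x(2))
qed

lemma sem_to_start_occurs:
  assumes "literal_at ts t b ds"
  shows "(t + length ds + 2, s) \<in> sem (pos_act ts) to_start \<longleftrightarrow> s = t"
proof -
  obtain xs ys where x: "ts = xs @ (False, True) # digits (b # ds) @ ys" "t = length xs"
    "no_digit ts (t + length ds + 2)"
    using assms(1) unfolding literal_at_def by (elim exE conjE) (simp only:)
  from sem_to_start_literal[OF x(1), of s] x(2,3) show ?thesis by simp
qed

text \<open>The second disjunct remains unevaluated because \<open>literal_at\<close> says nothing
  about what precedes the literal. It is resolved once the whole clause is known.\<close>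

lemma sem_sibling:
  assumes "literal_at ts t b ds"
  shows "(t, s) \<in> sem (pos_act ts) sibling \<longleftrightarrow>
    s = t + length ds + 2 \<and> tok_at ts s = Some (False, True) \<or>
    t \<noteq> 0 \<and> (t - 1, s) \<in> (sem (pos_act ts) (skip_digit MoveL))\<^sup>* O pos_act ts (Some (False, True), Stay) \<or>
    t \<noteq> 0 \<and> tok_at ts (t - 1) = Some (False, False) \<and>
      tok_at ts (t + length ds + 2) \<in> {None, Some (False, False)} \<and> s = t"
proof -
  note at = literal_at_toks(1)[OF assms]
  have 1: "(Suc t, s) \<in> (sem (pos_act ts) (skip_digit MoveR))\<^sup>* O pos_act ts (Some (False, True), Stay) \<longleftrightarrow>
    s = t + length ds + 2 \<and> tok_at ts s = Some (False, True)"
    by (subst scan_literal[OF assms]) (auto simp: in_pos_act no_digit_def)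
  have "sem (pos_act ts) (choice [(None, Stay), (Some (False, False), Stay)]) O sem (pos_act ts) to_start =
    {(u, s). tok_at ts u \<in> {None, Some (False, False)} \<and> (u, s) \<in> sem (pos_act ts) to_start}"
    by (auto simp: sem_choice in_pos_act relcomp_unfold)
  then have 2: "(Suc t, s) \<in> (sem (pos_act ts) (skip_digit MoveR))\<^sup>* O
      (sem (pos_act ts) (choice [(None, Stay), (Some (False, False), Stay)]) O sem (pos_act ts) to_start) \<longleftrightarrow>
    tok_at ts (t + length ds + 2) \<in> {None, Some (False, False)} \<and> s = t"
    using sem_to_start_occurs[OF assms] by (subst scan_literal[OF assms]) (auto simp: no_digit_def)
  show ?thesis
    unfolding sibling_def sem.simps Un_iff pos_act_relcomp at 1[symmetric]
    using 2 at by (cases t) auto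
qed

definition imp :: "formula \<Rightarrow> (literal \<times> literal) set" where
  "imp \<phi> = {(neg a, b) | a b. [a, b] \<in> set \<phi> \<or> [b, a] \<in> set \<phi> \<or> [a] \<in> set \<phi> \<and> b = a}"

lemma occurs_before:
  assumes "\<phi> = \<phi>1 @ C # \<phi>2"
  shows "tok_at (toks \<phi>) (length (toks \<phi>1)) = Some (False, False)"
  using tok_at_append[of "toks \<phi>1" "(False, False) # lits_toks C @ toks \<phi>2" 0]
  by (simp add: assms tok_at_def)

lemma occurs_after:
  assumes "\<phi> = \<phi>1 @ C # \<phi>2"
  shows "tok_at (toks \<phi>) (Suc (length (toks \<phi>1) + length (lits_toks C))) \<in> {None, Some (False, False)}"
proof -
  have "tok_at (toks \<phi>2) 0 \<in> {None, Some (False, False)}"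
    by (cases \<phi>2) (auto simp: tok_at_def)
  then show ?thesis
    using tok_at_append[of "toks \<phi>1 @ (False, False) # lits_toks C" "toks \<phi>2" 0]
    by (simp add: assms)
qed

lemma length_lit_toks: "length (lit_toks l) = length (bits (var l)) + 2"
  by (simp add: lit_toks_def digits_def)

lemma sibling_unit:
  assumes "\<phi> = \<phi>1 @ [l] # \<phi>2" "t = Suc (length (toks \<phi>1))"
  shows "(t, s) \<in> sem (pos_act (toks \<phi>)) sibling \<longleftrightarrow> s = t"
proof -
  have occ: "occurs \<phi> t l" using assms by (intro occursI[of _ \<phi>1 "[]" l "[]" \<phi>2]) simp_all
  have b: "tok_at (toks \<phi>) (t - 1) = Some (False, False)" using occurs_before[OF assms(1)] assms(2) by simp
  have a: "tok_at (toks \<phi>) (t + length (bits (var l)) + 2) \<in> {None, Some (False, False)}"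
    using occurs_after[OF assms(1)] assms(2) by (simp add: length_lit_toks add_ac)
  have "no_digit (toks \<phi>) (t - 1)" using b by (simp add: no_digit_def)
  then have l: "(t - 1, s) \<notin> (sem (pos_act (toks \<phi>)) (skip_digit MoveL))\<^sup>* O pos_act (toks \<phi>) (Some (False, True), Stay)"
    using b by (subst star_relcomp_unfold) (simp add: sem_skip_digit in_pos_act)
  show ?thesis
    unfolding sem_sibling[OF occurs_literal_at[OF occ]] using a b l assms(2) by auto
qed

lemma sibling_pair:
  assumes "\<phi> = \<phi>1 @ [l, m] # \<phi>2" "t = Suc (length (toks \<phi>1))" "t' = t + length (lit_toks l)"
  shows "occurs \<phi> t l" "occurs \<phi> t' m"
    "(t, s) \<in> sem (pos_act (toks \<phi>)) sibling \<longleftrightarrow> s = t'"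
    "(t', s) \<in> sem (pos_act (toks \<phi>)) sibling \<longleftrightarrow> s = t"
proof -
  show 1: "occurs \<phi> t l" using assms by (intro occursI[of _ \<phi>1 "[]" l "[m]" \<phi>2]) simp_all
  show 2: "occurs \<phi> t' m" using assms by (intro occursI[of _ \<phi>1 "[l]" m "[]" \<phi>2]) simp_all
  note lit = occurs_literal_at[OF 1] occurs_literal_at[OF 2]
  have t': "t' = t + length (bits (var l)) + 2" using assms(3) by (simp add: length_lit_toks)
  have at: "tok_at (toks \<phi>) t = Some (False, True)" "tok_at (toks \<phi>) t' = Some (False, True)"
    using 1 2 tok_at_occurs by blast+
  have b: "tok_at (toks \<phi>) (t - 1) = Some (False, False)" using occurs_before[OF assms(1)] assms(2) by simp
  have a: "tok_at (toks \<phi>) (t' + length (bits (var m)) + 2) \<in> {None, Some (False, False)}"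
    using occurs_after[OF assms(1)] assms(2,3) by (simp add: length_lit_toks add_ac)
  have "no_digit (toks \<phi>) (t - 1)" using b by (simp add: no_digit_def)
  then have l: "(t - 1, s) \<notin> (sem (pos_act (toks \<phi>)) (skip_digit MoveL))\<^sup>* O pos_act (toks \<phi>) (Some (False, True), Stay)"
    using b by (subst star_relcomp_unfold) (simp add: sem_skip_digit in_pos_act)
  show "(t, s) \<in> sem (pos_act (toks \<phi>)) sibling \<longleftrightarrow> s = t'"
    unfolding sem_sibling[OF lit(1)] t'[symmetric] using at l by auto
  have l': "(t' - 1, s) \<in> (sem (pos_act (toks \<phi>)) (skip_digit MoveL))\<^sup>* O pos_act (toks \<phi>) (Some (False, True), Stay)
    \<longleftrightarrow> s = t"
    using scan_back_literal[OF lit(1), of "pos_act (toks \<phi>) (Some (False, True), Stay)" s] at(1)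
    by (auto simp: in_pos_act no_digit_def t')
  \<comment> \<open>The token before the second literal is the last digit of the first, at least its
    sign. Hence the alternative for unit clauses fails there.\<close>
  have b': "\<not> no_digit (toks \<phi>) (t' - 1)"
  proof -
    obtain xs ys where x: "toks \<phi> = xs @ (False, True) # digits (is_Pos l # bits (var l)) @ ys" "t = length xs"
      using lit(1) unfolding literal_at_def by (elim exE conjE) (simp only:)
    have "\<not> no_digit (toks \<phi>) (length (xs @ [(False, True)]) + length (bits (var l)))"
      by (rule digits_not_no_digit(1)[of _ _ "is_Pos l # bits (var l)" ys]) (simp_all add: x(1))
    then show ?thesis by (simp add: t' x(2))
  qed
  show "(t', s) \<in> sem (pos_act (toks \<phi>)) sibling \<longleftrightarrow> s = t"
    unfolding sem_sibling[OF lit(2)] l' using a b' t' by (auto simp: no_digit_def)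
qed

lemma sibling_sound:
  assumes "is_2cnf \<phi>" "occurs \<phi> t l" "(t, s) \<in> sem (pos_act (toks \<phi>)) sibling"
  shows "\<exists>m. occurs \<phi> s m \<and> (neg l, m) \<in> imp \<phi>"
proof -
  obtain \<phi>1 \<phi>2 c1 c2 where \<phi>: "\<phi> = \<phi>1 @ (c1 @ l # c2) # \<phi>2"
    and t: "t = Suc (length (toks \<phi>1) + length (lits_toks c1))"
    using assms(2) unfolding occurs_def by blast
  have "length (c1 @ l # c2) \<in> {1, 2}" using assms(1) unfolding is_2cnf_def \<phi> by simp
  then consider "c1 = []" "c2 = []" | m where "c1 = []" "c2 = [m]" | m where "c1 = [m]" "c2 = []"
    by (cases c1; cases c2) auto
  then show ?thesis
  proof cases
    case 1
    then have "s = t" using sibling_unit[of \<phi> \<phi>1 l \<phi>2 t s] \<phi> t assms(3) by simp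
    with assms(2) show ?thesis using 1 \<phi> by (auto simp: imp_def)
  next
    case (2 m)
    then have *: "\<phi> = \<phi>1 @ [l, m] # \<phi>2" "t = Suc (length (toks \<phi>1))" using \<phi> t by auto
    from sibling_pair(2)[OF * refl] sibling_pair(3)[OF * refl, of s] assms(3) have "occurs \<phi> s m" by auto
    then show ?thesis using * by (auto simp: imp_def)
  next
    case (3 m)
    then have *: "\<phi> = \<phi>1 @ [m, l] # \<phi>2" "t = Suc (length (toks \<phi>1)) + length (lit_toks m)" using \<phi> t by auto
    from sibling_pair(1)[OF *(1) refl *(2)] sibling_pair(4)[OF *(1) refl *(2), of s] assms(3) have "occurs \<phi> s m" by auto
    then show ?thesis using * by (auto simp: imp_def)
  qed
qed

lemma sibling_complete:
  assumes "(neg l, m) \<in> imp \<phi>"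
  shows "\<exists>t s. occurs \<phi> t l \<and> occurs \<phi> s m \<and> (t, s) \<in> sem (pos_act (toks \<phi>)) sibling"
proof -
  have "neg a = neg l \<Longrightarrow> a = l" for a by (metis neg_neg)
  with assms consider "[l, m] \<in> set \<phi>" | "[m, l] \<in> set \<phi>" | "[l] \<in> set \<phi>" "m = l"
    unfolding imp_def by auto
  then show ?thesis
  proof cases
    case 1
    then obtain \<phi>1 \<phi>2 where "\<phi> = \<phi>1 @ [l, m] # \<phi>2" by (meson split_list)
    from sibling_pair(1-3)[OF this refl refl] show ?thesis by blast
  next
    case 2
    then obtain \<phi>1 \<phi>2 where "\<phi> = \<phi>1 @ [m, l] # \<phi>2" by (meson split_list)
    from sibling_pair(1,2,4)[OF this refl refl] show ?thesis by blast
  next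
    case 3
    then obtain \<phi>1 \<phi>2 where *: "\<phi> = \<phi>1 @ [l] # \<phi>2" by (meson split_list)
    then have "occurs \<phi> (Suc (length (toks \<phi>1))) l"
      by (intro occursI[of _ \<phi>1 "[]" l "[]" \<phi>2]) simp_all
    with sibling_unit[OF * refl] 3(2) show ?thesis by blast
  qed
qed

section \<open>The implication graph\<close>

lemma imp_contrapositive: "(a, b) \<in> imp \<phi> \<Longrightarrow> (neg b, neg a) \<in> imp \<phi>"
  unfolding imp_def by force

lemma imp_star_contrapositive: "(a, b) \<in> (imp \<phi>)\<^sup>* \<Longrightarrow> (neg b, neg a) \<in> (imp \<phi>)\<^sup>*"
proof (induction rule: rtrancl_induct)
  case (step b c)
  then show ?case using imp_contrapositive by (meson converse_rtrancl_into_rtrancl)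
qed simp

lemma imp_in: "(a, b) \<in> imp \<phi> \<Longrightarrow> b \<in> set (concat \<phi>)"
  unfolding imp_def by auto (metis list.set_intros)+

lemma lit_true_neg [simp]: "lit_true \<sigma> (neg l) \<longleftrightarrow> \<not> lit_true \<sigma> l"
  by (cases l) auto

lemma imp_star_true:
  assumes "\<forall>C\<in>set \<phi>. \<exists>l\<in>set C. lit_true \<sigma> l" "(a, b) \<in> (imp \<phi>)\<^sup>*" "lit_true \<sigma> a"
  shows "lit_true \<sigma> b"
  using assms(2,3)
proof (induction rule: rtrancl_induct)
  case (step b c)
  then obtain a where a: "b = neg a" "[a, c] \<in> set \<phi> \<or> [c, a] \<in> set \<phi> \<or> [a] \<in> set \<phi> \<and> c = a"
    by (auto simp: imp_def)
  then have "lit_true \<sigma> a \<or> lit_true \<sigma> c" using assms(1) by fastforce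
  then show ?case using step a(1) by auto
qed

text \<open>A maximal set of literals that is closed under implication and contains no complementary
  pair decides every variable.\<close>
lemma satisfiable_if_no_cycle:
  assumes "is_2cnf \<phi>"
    and no_cycle: "\<And>l. l \<in> set (concat \<phi>) \<Longrightarrow> (l, neg l) \<notin> (imp \<phi>)\<^sup>* \<or> (neg l, l) \<notin> (imp \<phi>)\<^sup>*"
  shows "satisfiable \<phi>"
proof -
  define L where "L = set (concat \<phi>) \<union> neg ` set (concat \<phi>)"
  have finL: "finite L" by (simp add: L_def)
  have L_neg: "l \<in> L \<Longrightarrow> neg l \<in> L" for l by (auto simp: L_def)
  have L_imp: "b \<in> L" if "(a, b) \<in> (imp \<phi>)\<^sup>*" "a \<in> L" for a b
    using that by (induction rule: rtrancl_induct) (use imp_in L_def in blast)+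
  have L_no_cycle: "(l, neg l) \<notin> (imp \<phi>)\<^sup>* \<or> (neg l, l) \<notin> (imp \<phi>)\<^sup>*" if "l \<in> L" for l
    using that no_cycle unfolding L_def by (metis Un_iff imageE neg_neg)
  define good where "good = (\<lambda>S. S \<subseteq> L \<and> (\<forall>a\<in>S. \<forall>b. (a, b) \<in> (imp \<phi>)\<^sup>* \<longrightarrow> b \<in> S) \<and> (\<forall>a\<in>S. neg a \<notin> S))"
  have "finite {S. good S}"
    by (rule finite_subset[of _ "Pow L"]) (auto simp: good_def finL)
  moreover have "good {}" by (simp add: good_def)
  ultimately obtain S where S: "good S" and max: "\<And>T. good T \<Longrightarrow> S \<subseteq> T \<Longrightarrow> T = S"
    using finite_has_maximal[of "{S. good S}"] by (metis empty_Collect_eq mem_Collect_eq)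
  have decided: "l \<in> S \<or> neg l \<in> S" if lL: "l \<in> L" for l
  proof (rule ccontr)
    assume und: "\<not> (l \<in> S \<or> neg l \<in> S)"
    obtain k where k: "k = l \<or> k = neg l" "(k, neg k) \<notin> (imp \<phi>)\<^sup>*"
      using L_no_cycle[OF lL] by (metis neg_neg)
    then have kL: "k \<in> L" and kS: "k \<notin> S" "neg k \<notin> S" using lL L_neg und by auto
    define T where "T = S \<union> {b. (k, b) \<in> (imp \<phi>)\<^sup>*}"
    have "good T"
      unfolding good_def
    proof (intro conjI ballI allI impI)
      show "T \<subseteq> L" using S L_imp[OF _ kL] by (auto simp: T_def good_def)
      show "b \<in> T" if "a \<in> T" "(a, b) \<in> (imp \<phi>)\<^sup>*" for a b
        using that S by (auto simp: T_def good_def intro: rtrancl_trans)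
      show "neg a \<notin> T" if "a \<in> T" for a
      proof
        assume "neg a \<in> T"
        \<comment> \<open>Contraposition gives a path from \<open>b\<close> to \<open>neg k\<close>,
          and closure of \<open>S\<close> would put \<open>neg k\<close> into
          \<open>S\<close>.\<close>
        have 1: False if "b \<in> S" "(k, neg b) \<in> (imp \<phi>)\<^sup>*" for b
          using imp_star_contrapositive[OF that(2)] that(1) S kS by (auto simp: good_def)
        \<comment> \<open>Contraposition gives a path from \<open>b\<close> to \<open>neg k\<close>,
          hence one from \<open>k\<close> to \<open>neg k\<close>, against the choice of
          \<open>k\<close>.\<close>
        have 2: False if "(k, b) \<in> (imp \<phi>)\<^sup>*" "(k, neg b) \<in> (imp \<phi>)\<^sup>*" for b
          using imp_star_contrapositive[OF that(2)] that(1) k(2) by (auto intro: rtrancl_trans)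
        from \<open>a \<in> T\<close> \<open>neg a \<in> T\<close> show False
          using S 1[of a] 1[of "neg a"] 2[of a] by (auto simp: T_def good_def)
      qed
    qed
    moreover have "S \<subseteq> T" "k \<in> T" by (auto simp: T_def)
    ultimately show False using max kS(1) by blast
  qed
  define \<sigma> where "\<sigma> = (\<lambda>v. Pos v \<in> S)"
  have true: "lit_true \<sigma> l \<longleftrightarrow> l \<in> S" if "l \<in> L" for l
  proof (cases l)
    case (Neg v)
    with decided[OF that] S show ?thesis by (auto simp: \<sigma>_def good_def)
  qed (simp add: \<sigma>_def)
  have "\<exists>l\<in>set C. lit_true \<sigma> l" if C: "C \<in> set \<phi>" for C
  proof -
    obtain a b where ab: "C = [a, b] \<or> C = [a] \<and> b = a"
      using assms(1) C unfolding is_2cnf_def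
      by (cases C; cases "tl C") force+
    moreover have "set C \<subseteq> L" using C by (auto simp: L_def)
    ultimately have L: "a \<in> L" "b \<in> L" by auto
    show ?thesis
    proof (cases "a \<in> S")
      case True
      then show ?thesis using true[OF L(1)] ab by auto
    next
      case False
      then have "neg a \<in> S" using decided L by blast
      moreover have "(neg a, b) \<in> imp \<phi>" using ab C by (auto simp: imp_def)
      ultimately have "b \<in> S" using S by (auto simp: good_def)
      then show ?thesis using true[OF L(2)] ab by auto
    qed
  qed
  then show ?thesis unfolding satisfiable_def by blast
qed

lemma satisfiable_iff:
  assumes "is_2cnf \<phi>"
  shows "\<not> satisfiable \<phi> \<longleftrightarrow>
    (\<exists>l\<in>set (concat \<phi>). (l, neg l) \<in> (imp \<phi>)\<^sup>* \<and> (neg l, l) \<in> (imp \<phi>)\<^sup>*)"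
proof
  assume "\<not> satisfiable \<phi>"
  then show "\<exists>l\<in>set (concat \<phi>). (l, neg l) \<in> (imp \<phi>)\<^sup>* \<and> (neg l, l) \<in> (imp \<phi>)\<^sup>*"
    using satisfiable_if_no_cycle[OF assms] by blast
next
  assume "\<exists>l\<in>set (concat \<phi>). (l, neg l) \<in> (imp \<phi>)\<^sup>* \<and> (neg l, l) \<in> (imp \<phi>)\<^sup>*"
  then obtain l where l: "(l, neg l) \<in> (imp \<phi>)\<^sup>*" "(neg l, l) \<in> (imp \<phi>)\<^sup>*" by blast
  show "\<not> satisfiable \<phi>"
  proof
    assume "satisfiable \<phi>"
    then obtain \<sigma> where "\<forall>C\<in>set \<phi>. \<exists>l\<in>set C. lit_true \<sigma> l" unfolding satisfiable_def by blast
    from imp_star_true[OF this l(1)] imp_star_true[OF this l(2)] show False by auto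
  qed
qed

section \<open>The machine for unsatisfiability\<close>

text \<open>Head 1 marks the current literal and head 2 is auxiliary. An edge from \<open>l\<close>
  to \<open>m\<close> is found by guessing an occurrence of \<open>neg l\<close> and going to its
  sibling \<open>m\<close>. One head cannot be copied to another, so head 1 guesses its new position
  and is compared with head 2.\<close>

definition walk_step :: "tokact rprog" where
  "walk_step = Seq (on_head 2 guess) (Seq (compare 1 2 False) (Seq (on_head 2 sibling)
     (Seq (on_head 1 guess) (compare 1 2 True))))"

text \<open>Head 0 stays on an occurrence of some \<open>l\<close>, while head 1 walks from
  \<open>l\<close> to \<open>neg l\<close> and back to \<open>l\<close>.\<close>

definition refuter :: "tokact rprog" where
  "refuter = Seq (on_head 0 guess) (Seq (on_head 1 guess) (Seq (compare 0 1 True)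
     (Seq (Star walk_step) (Seq (compare 0 1 False) (Seq (Star walk_step) (compare 0 1 True))))))"

lemma occurs_le: "occurs \<phi> t l \<Longrightarrow> t \<le> length (toks \<phi>)"
  using tok_at_occurs[of \<phi> t] by (auto simp: tok_at_def split: if_splits)

lemma sem_guess_occurs:
  assumes "i < length \<tau>" "\<tau> ! i \<le> length (toks \<phi>)"
  shows "(\<tau>, s) \<in> sem (tok_act (toks \<phi>)) (on_head i guess) \<longleftrightarrow> (\<exists>t l. occurs \<phi> t l \<and> s = \<tau>[i := t])"
  unfolding sem_on_head[OF assms(1)] sem_guess[OF assms(2)] tok_at_occurs by blast

text \<open>The old position \<open>c\<close> of head 2 carries no information. Its bound is passed
  along only because \<open>sem_guess\<close> requires a position within the input.\<close>

lemma walk_step_sound: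
  assumes "is_2cnf \<phi>" "c \<le> length (toks \<phi>)" "occurs \<phi> b l"
    and "([a, b, c], s) \<in> sem (tok_act (toks \<phi>)) walk_step"
  shows "\<exists>b' c' l'. s = [a, b', c'] \<and> c' \<le> length (toks \<phi>) \<and> occurs \<phi> b' l' \<and> (l, l') \<in> imp \<phi>"
proof -
  let ?A = "tok_act (toks \<phi>)"
  from assms(4) obtain s1 s2 s3 s4 where
    s: "([a, b, c], s1) \<in> sem ?A (on_head 2 guess)" "(s1, s2) \<in> sem ?A (compare 1 2 False)"
    "(s2, s3) \<in> sem ?A (on_head 2 sibling)" "(s3, s4) \<in> sem ?A (on_head 1 guess)"
    "(s4, s) \<in> sem ?A (compare 1 2 True)"
    unfolding walk_step_def sem.simps by blast
  obtain t m where t: "occurs \<phi> t m" "s1 = [a, b, t]"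
    using s(1) sem_guess_occurs[of 2 "[a, b, c]" \<phi> s1] assms(2) by (auto simp: numeral_2_eq_2)
  have m: "s2 = [a, b, t]" "m = neg l"
    using s(2) compare_occurs(2)[of 1 2 "[a, b, t]" \<phi> l m s2] t assms(3) by (auto simp: numeral_2_eq_2)
  obtain u where u: "(t, u) \<in> sem (pos_act (toks \<phi>)) sibling" "s3 = [a, b, u]"
    using s(3) sem_on_head[of 2 "[a, b, t]" s3] unfolding m(1) by (auto simp: numeral_2_eq_2)
  from sibling_sound[OF assms(1) t(1) u(1)] obtain m' where m': "occurs \<phi> u m'" "(l, m') \<in> imp \<phi>"
    unfolding m(2) by auto
  obtain v l' where v: "occurs \<phi> v l'" "s4 = [a, v, u]"
    using s(4) sem_guess_occurs[of 1 "[a, b, u]" \<phi> s4] occurs_le[OF assms(3)] unfolding u(2) by auto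
  have "s = [a, v, u]" "m' = l'"
    using s(5) compare_occurs(1)[of 1 2 "[a, v, u]" \<phi> l' m' s] v m' by (auto simp: numeral_2_eq_2)
  then show ?thesis using m' v(1) occurs_le by blast
qed

text \<open>Head 1 may be guessed onto the very occurrence that head 2 has reached, hence the result
  \<open>[a, t, t]\<close>.\<close>

lemma walk_step_complete:
  assumes "c \<le> length (toks \<phi>)" "occurs \<phi> b l" "(l, l') \<in> imp \<phi>"
  shows "\<exists>t. occurs \<phi> t l' \<and> ([a, b, c], [a, t, t]) \<in> sem (tok_act (toks \<phi>)) walk_step"
proof -
  let ?A = "tok_act (toks \<phi>)"
  obtain u t where u: "occurs \<phi> u (neg l)" "occurs \<phi> t l'" "(u, t) \<in> sem (pos_act (toks \<phi>)) sibling"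
    using sibling_complete[of "neg l" l' \<phi>] assms(3) by auto
  have "([a, b, c], [a, b, u]) \<in> sem ?A (on_head 2 guess)"
    using sem_guess_occurs[of 2 "[a, b, c]" \<phi> "[a, b, u]"] assms(1) u(1) by (auto simp: numeral_2_eq_2)
  moreover have "([a, b, u], [a, b, u]) \<in> sem ?A (compare 1 2 False)"
    using compare_occurs(2)[of 1 2 "[a, b, u]" \<phi> l "neg l"] u(1) assms(2) by (auto simp: numeral_2_eq_2)
  moreover have "([a, b, u], [a, b, t]) \<in> sem ?A (on_head 2 sibling)"
    using sem_on_head[of 2 "[a, b, u]"] u(3) by (auto simp: numeral_2_eq_2)
  moreover have "([a, b, t], [a, t, t]) \<in> sem ?A (on_head 1 guess)"
    using sem_guess_occurs[of 1 "[a, b, t]" \<phi> "[a, t, t]"] occurs_le[OF assms(2)] u(2) by auto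
  moreover have "([a, t, t], [a, t, t]) \<in> sem ?A (compare 1 2 True)"
    using compare_occurs(1)[of 1 2 "[a, t, t]" \<phi> l' l'] u(2) by (auto simp: numeral_2_eq_2)
  ultimately show ?thesis using u(2) unfolding walk_step_def sem.simps by blast
qed

lemma walk_sound:
  assumes "is_2cnf \<phi>" "c \<le> length (toks \<phi>)" "occurs \<phi> b l"
    and "([a, b, c], s) \<in> sem (tok_act (toks \<phi>)) (Star walk_step)"
  shows "\<exists>b' c' l'. s = [a, b', c'] \<and> c' \<le> length (toks \<phi>) \<and> occurs \<phi> b' l' \<and> (l, l') \<in> (imp \<phi>)\<^sup>*"
  using assms(4) unfolding sem.simps
proof (induction rule: rtrancl_induct)
  case base
  then show ?case using assms(2,3) by blast
next
  case (step s s')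
  then obtain b' c' l' where *: "s = [a, b', c']" "c' \<le> length (toks \<phi>)" "occurs \<phi> b' l'" "(l, l') \<in> (imp \<phi>)\<^sup>*"
    by blast
  from walk_step_sound[OF assms(1) *(2,3) step(2)[unfolded *(1)]] obtain b'' c'' l'' where
    "s' = [a, b'', c'']" "c'' \<le> length (toks \<phi>)" "occurs \<phi> b'' l''" "(l', l'') \<in> imp \<phi>"
    by blast
  moreover from this(4) have "(l, l'') \<in> (imp \<phi>)\<^sup>*" using *(4) by simp
  ultimately show ?case by blast
qed

lemma walk_complete:
  assumes "(l, l') \<in> (imp \<phi>)\<^sup>*" "c \<le> length (toks \<phi>)" "occurs \<phi> b l"
  shows "\<exists>b' c'. c' \<le> length (toks \<phi>) \<and> occurs \<phi> b' l' \<and>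
    ([a, b, c], [a, b', c']) \<in> sem (tok_act (toks \<phi>)) (Star walk_step)"
  using assms(1) unfolding sem.simps
proof (induction rule: rtrancl_induct)
  case base
  then show ?case using assms(2,3) by blast
next
  case (step m m')
  then obtain b' c' where *: "c' \<le> length (toks \<phi>)" "occurs \<phi> b' m"
    "([a, b, c], [a, b', c']) \<in> (sem (tok_act (toks \<phi>)) walk_step)\<^sup>*" by blast
  from walk_step_complete[OF *(1,2) step(2)] obtain t where t: "occurs \<phi> t m'"
    "([a, b', c'], [a, t, t]) \<in> sem (tok_act (toks \<phi>)) walk_step" by blast
  then have "([a, b, c], [a, t, t]) \<in> (sem (tok_act (toks \<phi>)) walk_step)\<^sup>*" using *(3) by simp
  with t(1) occurs_le[OF t(1)] show ?case by blast
qed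

lemma sem_refuter:
  assumes "is_2cnf \<phi>"
  shows "(\<exists>s. ([0, 0, 0], s) \<in> sem (tok_act (toks \<phi>)) refuter) \<longleftrightarrow> \<not> satisfiable \<phi>"
proof -
  let ?A = "tok_act (toks \<phi>)"
  have guess0: "([0, 0, 0], s) \<in> sem ?A (on_head 0 guess) \<longleftrightarrow> (\<exists>t l. occurs \<phi> t l \<and> s = [t, 0, 0])" for s
    using sem_guess_occurs[of 0 "[0, 0, 0]" \<phi> s] by simp
  have guess1: "([t, 0, 0], s) \<in> sem ?A (on_head 1 guess) \<longleftrightarrow> (\<exists>u l. occurs \<phi> u l \<and> s = [t, u, 0])" for t s
    using sem_guess_occurs[of 1 "[t, 0, 0]" \<phi> s] by simp
  have comp: "([t, u, v], s) \<in> sem ?A (compare 0 1 True) \<longleftrightarrow> s = [t, u, v] \<and> m = l"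
    "([t, u, v], s) \<in> sem ?A (compare 0 1 False) \<longleftrightarrow> s = [t, u, v] \<and> m = neg l"
    if "occurs \<phi> t l" "occurs \<phi> u m" for t u v s l m
    using compare_occurs[of 0 1 "[t, u, v]" \<phi> l m s] that by simp_all
  show ?thesis
  proof
    assume "\<exists>s. ([0, 0, 0], s) \<in> sem ?A refuter"
    then obtain s s1 s2 s3 s4 s5 s6 where
      s: "([0, 0, 0], s1) \<in> sem ?A (on_head 0 guess)" "(s1, s2) \<in> sem ?A (on_head 1 guess)"
      "(s2, s3) \<in> sem ?A (compare 0 1 True)" "(s3, s4) \<in> sem ?A (Star walk_step)"
      "(s4, s5) \<in> sem ?A (compare 0 1 False)" "(s5, s6) \<in> sem ?A (Star walk_step)"
      "(s6, s) \<in> sem ?A (compare 0 1 True)"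
      unfolding refuter_def sem.simps(4) by blast
    from s(1) obtain t l where t: "occurs \<phi> t l" "s1 = [t, 0, 0]" unfolding guess0 by blast
    from s(2) obtain u m where u: "occurs \<phi> u m" "s2 = [t, u, 0]" unfolding t guess1 by blast
    from s(3) have s3: "s3 = [t, u, 0]" "m = l" unfolding u comp[OF t(1) u(1)] by auto
    from walk_sound[OF assms _ u(1) s(4)[unfolded s3(1)]] obtain u1 v1 m1 where
      w1: "s4 = [t, u1, v1]" "v1 \<le> length (toks \<phi>)" "occurs \<phi> u1 m1" "(m, m1) \<in> (imp \<phi>)\<^sup>*" by blast
    from s(5) have s5: "s5 = [t, u1, v1]" "m1 = neg l" unfolding w1 comp[OF t(1) w1(3)] by auto
    from walk_sound[OF assms w1(2,3) s(6)[unfolded s5(1)]] obtain u2 v2 m2 where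
      w2: "s6 = [t, u2, v2]" "v2 \<le> length (toks \<phi>)" "occurs \<phi> u2 m2" "(m1, m2) \<in> (imp \<phi>)\<^sup>*" by blast
    from s(7) have "m2 = l" unfolding w2 comp[OF t(1) w2(3)] by auto
    then show "\<not> satisfiable \<phi>"
      unfolding satisfiable_iff[OF assms] using w1(4) w2(4) s3 s5 occurs_in[OF t(1)] by blast
  next
    assume "\<not> satisfiable \<phi>"
    then obtain l where l: "l \<in> set (concat \<phi>)" "(l, neg l) \<in> (imp \<phi>)\<^sup>*" "(neg l, l) \<in> (imp \<phi>)\<^sup>*"
      unfolding satisfiable_iff[OF assms] by blast
    obtain t where t: "occurs \<phi> t l" using occurs_exists[OF l(1)] by blast
    obtain u1 v1 where w1: "v1 \<le> length (toks \<phi>)" "occurs \<phi> u1 (neg l)"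
      "([t, t, 0], [t, u1, v1]) \<in> sem ?A (Star walk_step)"
      using walk_complete[OF l(2) _ t] by blast
    obtain u2 v2 where w2: "occurs \<phi> u2 l" "([t, u1, v1], [t, u2, v2]) \<in> sem ?A (Star walk_step)"
      using walk_complete[OF l(3) w1(1,2)] by blast
    have "([0, 0, 0], [t, 0, 0]) \<in> sem ?A (on_head 0 guess)" unfolding guess0 using t by blast
    moreover have "([t, 0, 0], [t, t, 0]) \<in> sem ?A (on_head 1 guess)" unfolding guess1 using t by blast
    moreover have "([t, t, 0], [t, t, 0]) \<in> sem ?A (compare 0 1 True)" unfolding comp[OF t t] by simp
    moreover have "([t, u1, v1], [t, u1, v1]) \<in> sem ?A (compare 0 1 False)" unfolding comp[OF t w1(2)] by simp
    moreover have "([t, u2, v2], [t, u2, v2]) \<in> sem ?A (compare 0 1 True)" unfolding comp[OF t w2(1)] by simp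
    ultimately have "([0, 0, 0], [t, u2, v2]) \<in> sem ?A refuter"
      using w1(3) w2(2) unfolding refuter_def sem.simps(4) by (meson relcomp.relcompI)
    then show "\<exists>s. ([0, 0, 0], s) \<in> sem ?A refuter" by blast
  qed
qed

text \<open>Token 0 begins at cell 1, so each head first steps off the left end marker.\<close>

definition refuter_heads :: "hact rprog" where
  "refuter_heads = Seq (Act (0, LeftEnd, MoveR)) (Seq (Act (1, LeftEnd, MoveR)) (Seq (Act (2, LeftEnd, MoveR))
     (subst tok_prog refuter)))"

lemma refuter_acts: "a \<in> set_rprog refuter \<Longrightarrow> fst a < 3"
  unfolding refuter_def walk_step_def compare_def both_def on_head_def by (auto simp: set_rprog_subst)

lemma tok_prog_acts: "b \<in> set_rprog (tok_prog a) \<Longrightarrow> fst b = fst a"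
  by (induction a rule: tok_prog.induct) auto

lemma sem_refuter_heads:
  assumes "is_2cnf \<phi>"
  shows "(\<exists>ps. (replicate 3 0, ps) \<in> sem (head_act (encode \<phi>)) refuter_heads) \<longleftrightarrow> \<not> satisfiable \<phi>"
proof -
  let ?H = "head_act (encode \<phi>)"
  have 0: "input_sym (encode \<phi>) 0 = LeftEnd" by (simp add: input_sym_def)
  have r: "replicate 3 (0::nat) = [0, 0, 0]" by (simp add: numeral_3_eq_3)
  have "([0, 0, 0], s) \<in> ?H (0, LeftEnd, MoveR) \<longleftrightarrow> s = [1, 0, 0]" for s
    using 0 by (simp add: in_head_act)
  moreover have "([1, 0, 0], s) \<in> ?H (1, LeftEnd, MoveR) \<longleftrightarrow> s = [1, 1, 0]" for s
    using 0 by (simp add: in_head_act)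
  moreover have "([1, 1, 0], s) \<in> ?H (2, LeftEnd, MoveR) \<longleftrightarrow> s = [1, 1, 1]" for s
    using 0 by (simp add: in_head_act numeral_2_eq_2)
  ultimately have "([0, 0, 0], s) \<in> sem ?H refuter_heads \<longleftrightarrow> ([1, 1, 1], s) \<in> sem ?H (subst tok_prog refuter)" for s
    unfolding refuter_heads_def sem.simps by (simp add: relcomp_unfold)
  then have 1: "(\<exists>ps. (replicate 3 0, ps) \<in> sem ?H refuter_heads) \<longleftrightarrow>
    (\<exists>ps. ([1, 1, 1], ps) \<in> sem ?H (subst tok_prog refuter))" unfolding r by simp
  have sim: "simulates (tok_rel (toks \<phi>) 3) (sem (tok_act (toks \<phi>)) refuter) (sem ?H (subst tok_prog refuter))"
    unfolding flat_toks[symmetric] by (rule simulates_subst, rule simulates_tok_prog, rule refuter_acts)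
  have "tok_rel (toks \<phi>) 3 [0, 0, 0] [1, 1, 1]" by (simp add: tok_rel_def)
  from simulatesD1[OF sim this] simulatesD2[OF sim this] have
    "(\<exists>ps. ([1, 1, 1], ps) \<in> sem ?H (subst tok_prog refuter)) \<longleftrightarrow> (\<exists>s. ([0, 0, 0], s) \<in> sem (tok_act (toks \<phi>)) refuter)"
    by blast
  with 1 sem_refuter[OF assms] show ?thesis by simp
qed

text \<open>Acceptance is specified only on encodings of 2CNF formulas, whereas the space bound
  covers all words, as membership in \<open>class_NL\<close> requires.\<close>

lemma log_space_refuter:
  obtains M where "ntm M" "\<And>x. in_space M x (3 * (log 2 (2 * (real (length x) + 1)) + 3))"
    "\<And>\<phi>. is_2cnf \<phi> \<Longrightarrow> accepts M (encode \<phi>) \<longleftrightarrow> \<not> satisfiable \<phi>"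
proof -
  have "fst a < 3" if "a \<in> set_rprog refuter_heads" for a
  proof -
    from that consider "fst a < 3" | b where "b \<in> set_rprog refuter" "a \<in> set_rprog (tok_prog b)"
      unfolding refuter_heads_def by (auto simp: set_rprog_subst)
    then show ?thesis using tok_prog_acts refuter_acts by cases metis+
  qed
  from head_prog_to_ntm[of refuter_heads 3, OF this] obtain M where M: "ntm M"
    "\<And>x. accepts M x \<longleftrightarrow> (\<exists>ps. (replicate 3 0, ps) \<in> sem (head_act x) refuter_heads)"
    "\<And>x. in_space M x (real 3 * (log 2 (2 * (real (length x) + 1)) + 3))"
    by blast
  show ?thesis by (rule that[OF M(1)]) (use M(2,3) sem_refuter_heads in auto)
qed

section \<open>Deterministic logarithmic space is polynomial time\<close>

lemma step_deterministic:
  assumes "dtm M" "step M x c c1" "step M x c c2"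
  shows "c1 = c2"
proof -
  let ?lhs = "(state c, input_sym x (ipos c), map (\<lambda>(f, h). f h) (work c))"
  let ?c = "\<lambda>(q, d, ops). \<lparr>state = q, ipos = min (shift d (ipos c)) (Suc (length x)),
    work = map2 (\<lambda>(a, e) (f, h). (f(h := a), shift e h)) ops (work c)\<rparr>"
  from assms(2) obtain r1 where 1: "(?lhs, r1) \<in> rules M" "c1 = ?c r1" unfolding step_def by auto
  from assms(3) obtain r2 where 2: "(?lhs, r2) \<in> rules M" "c2 = ?c r2" unfolding step_def by auto
  have "r1 = r2" using assms(1) single_valuedD[OF _ 1(1) 2(1)] unfolding dtm_def by blast
  with 1(2) 2(2) show ?thesis by simp
qed

lemma no_step_halted:
  "ntm M \<Longrightarrow> state c = accept M \<or> state c = reject M \<Longrightarrow> \<not> step M x c c'"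
  unfolding ntm_def step_def by fastforce

lemma computation_nth_step: "computation M x cs \<Longrightarrow> Suc i < length cs \<Longrightarrow> step M x (cs ! i) (cs ! Suc i)"
  unfolding computation_def by (simp add: successively_conv_nth)

lemma computation_nth_0: "computation M x cs \<Longrightarrow> cs ! 0 = init M"
  unfolding computation_def by (metis hd_conv_nth)

text \<open>By determinism every computation follows \<open>hs\<close>, and the halting state at the
  end of \<open>hs\<close> has no successor.\<close>

lemma length_le_halting:
  assumes "dtm M" "computation M x cs" "computation M x hs"
    and "state (last hs) = accept M \<or> state (last hs) = reject M"
  shows "length cs \<le> length hs"
proof (rule ccontr)
  assume "\<not> length cs \<le> length hs"
  have ne: "hs \<noteq> []" using assms(3) by (simp add: computation_def)
  have "cs ! i = hs ! i" if "i < length hs" for i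
    using that
  proof (induction i)
    case 0
    then show ?case using assms computation_nth_0 by metis
  next
    case (Suc i)
    then show ?case
      using computation_nth_step[OF assms(2), of i] computation_nth_step[OF assms(3), of i]
        \<open>\<not> length cs \<le> length hs\<close> step_deterministic[OF assms(1)] by fastforce
  qed
  then have "cs ! (length hs - 1) = last hs" using ne by (simp add: last_conv_nth)
  then have "step M x (last hs) (cs ! Suc (length hs - 1))"
    using computation_nth_step[OF assms(2), of "length hs - 1"] \<open>\<not> length cs \<le> length hs\<close> ne by simp
  then show False using no_step_halted assms(1,4) unfolding dtm_def by blast
qed

text \<open>After a repetition the computation is periodic, so its halting configuration would
  already have occurred earlier, with a step following it.\<close>

lemma distinct_halting:
  assumes "dtm M" "computation M x hs" "state (last hs) = accept M \<or> state (last hs) = reject M"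
  shows "distinct hs"
proof -
  have ne: "hs \<noteq> []" using assms(2) by (simp add: computation_def)
  have False if ij: "i < j" "j < length hs" "hs ! i = hs ! j" for i j
  proof -
    have shift: "j + k < length hs \<Longrightarrow> hs ! (i + k) = hs ! (j + k)" for k
    proof (induction k)
      case (Suc k)
      then show ?case
        using computation_nth_step[OF assms(2), of "i + k"] computation_nth_step[OF assms(2), of "j + k"]
          ij(1) step_deterministic[OF assms(1)] by fastforce
    qed (simp add: ij(3))
    \<comment> \<open>Advancing by \<open>k\<close> takes the later of the two equal configurations
      to the last one, and the earlier to the same halting configuration before the end.\<close>
    define k where "k = length hs - 1 - j"
    have "j + k = length hs - 1" using ij by (simp add: k_def)
    then have "hs ! (i + k) = last hs" using shift[of k] ij ne by (simp add: last_conv_nth)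
    moreover have "Suc (i + k) < length hs" using ij by (simp add: k_def)
    ultimately have "step M x (last hs) (hs ! Suc (i + k))"
      using computation_nth_step[OF assms(2), of "i + k"] by simp
    then show False using no_step_halted assms(1,3) unfolding dtm_def by blast
  qed
  then show ?thesis unfolding distinct_conv_nth by (metis linorder_neqE_nat)
qed

section \<open>Counting configurations\<close>

definition visited :: "config list \<Rightarrow> (nat \<times> nat) set" where
  "visited cs = (\<Union>c\<in>set cs. {(i, snd (work c ! i)) | i. i < length (work c)})"

text \<open>The 0 accounts for cells that are still blank; it also makes the set nonempty.\<close>

definition written :: "tm \<Rightarrow> nat set" where
  "written M = insert 0 (\<Union>r\<in>rules M. fst ` set (snd (snd (snd r))))"

definition entered :: "tm \<Rightarrow> nat set" where
  "entered M = insert (start M) ((\<lambda>r. fst (snd r)) ` rules M)"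

definition tape_space :: "nat set \<Rightarrow> nat \<Rightarrow> ((nat \<Rightarrow> nat) \<times> nat) set" where
  "tape_space G B = {(f, h). h < B \<and> range f \<subseteq> G \<and> (\<forall>j\<ge>B. f j = 0)}"

lemma finite_visited: "finite (visited cs)"
  unfolding visited_def by auto

lemma space_visited: "space cs = card (visited cs)"
  unfolding space_def visited_def ..

text \<open>Space counts scanned cells, not positions. Heads start at 0 and move by at most one
  cell, so the scanned cells of a tape form an initial segment, and only scanned cells are ever
  written. Hence all head positions and all nonblank cells lie below
  \<open>space cs\<close>.\<close>

lemma computation_configs:
  assumes M: "ntm M" and cs: "computation M x cs" and "c \<in> set cs"
  shows "state c \<in> entered M" "ipos c \<le> Suc (length x)" "length (work c) = work_tapes M"
    "set (work c) \<subseteq> tape_space (written M) (space cs)"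
proof -
  define V where "V = visited cs"
  \<comment> \<open>\<open>V\<close> collects the cells of the whole computation, so the invariant
    refers to a fixed set although each configuration adds at most one cell per tape.\<close>
  define I where "I = (\<lambda>c :: config. state c \<in> entered M \<and> ipos c \<le> Suc (length x) \<and> length (work c) = work_tapes M \<and>
    (\<forall>i<work_tapes M. (\<forall>j\<le>snd (work c ! i). (i, j) \<in> V) \<and>
      (\<forall>j. fst (work c ! i) j \<noteq> 0 \<longrightarrow> (\<forall>j'\<le>j. (i, j') \<in> V)) \<and> range (fst (work c ! i)) \<subseteq> written M))"
  have vis: "(i, snd (work (cs ! m) ! i)) \<in> V" if "m < length cs" "i < length (work (cs ! m))" for m i
    using that unfolding V_def visited_def by fastforce
  have ne: "cs \<noteq> []" using cs by (simp add: computation_def)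
  have "I (cs ! m)" if "m < length cs" for m
    using that
  proof (induction m)
    case 0
    have "cs ! 0 = init M" by (rule computation_nth_0[OF cs])
    then show ?case using vis[OF 0] by (auto simp: I_def init_def entered_def written_def)
  next
    case (Suc m)
    let ?c = "cs ! m" and ?c' = "cs ! Suc m"
    have I: "I ?c" using Suc by simp
    have "step M x ?c ?c'" by (rule computation_nth_step[OF cs Suc.prems])
    then obtain q d ops where r:
      "((state ?c, input_sym x (ipos ?c), map (\<lambda>(f, h). f h) (work ?c)), (q, d, ops)) \<in> rules M"
      and c': "?c' = \<lparr>state = q, ipos = min (shift d (ipos ?c)) (Suc (length x)),
           work = map2 (\<lambda>(a, e) (f, h). (f(h := a), shift e h)) ops (work ?c)\<rparr>"
      unfolding step_def by blast
    have len: "length ops = work_tapes M" using M r unfolding ntm_def by fastforce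
    have lenw: "length (work ?c) = work_tapes M" using I by (simp add: I_def)
    have q: "state ?c' \<in> entered M" using r unfolding c' entered_def by force
    have tapes: "(\<forall>j\<le>snd (work ?c' ! i). (i, j) \<in> V) \<and>
      (\<forall>j. fst (work ?c' ! i) j \<noteq> 0 \<longrightarrow> (\<forall>j'\<le>j. (i, j') \<in> V)) \<and> range (fst (work ?c' ! i)) \<subseteq> written M"
      if i: "i < work_tapes M" for i
    proof -
      obtain f h where fh: "work ?c ! i = (f, h)" by force
      obtain a e where ae: "ops ! i = (a, e)" by force
      have w: "work ?c' ! i = (f(h := a), shift e h)"
        using i len lenw by (simp add: c' fh ae)
      have "(a, e) \<in> set ops" using ae i len by (metis nth_mem)
      then have "a \<in> written M" unfolding written_def using r by force
      have old: "\<forall>j\<le>h. (i, j) \<in> V" "\<forall>j. f j \<noteq> 0 \<longrightarrow> (\<forall>j'\<le>j. (i, j') \<in> V)" "range f \<subseteq> written M"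
        using I[unfolded I_def, THEN conjunct2, THEN conjunct2, THEN conjunct2, rule_format, OF i] unfolding fh by simp_all
      have "(i, shift e h) \<in> V" using vis[of "Suc m" i] Suc.prems w i len lenw by (simp add: c')
      then have "\<forall>j\<le>shift e h. (i, j) \<in> V" using old(1) by (cases e) (auto simp: le_Suc_eq)
      then show ?thesis using old \<open>a \<in> written M\<close> by (auto simp: w)
    qed
    show ?case using q tapes len lenw unfolding I_def by (simp add: c')
  qed
  then have I: "I c" using assms(3) by (metis in_set_conv_nth)
  then show "state c \<in> entered M" "ipos c \<le> Suc (length x)" and len: "length (work c) = work_tapes M"
    by (auto simp: I_def)
  have bound: "j < space cs" if "\<forall>j'\<le>j. (i, j') \<in> V" for i j
  proof -
    have "Pair i ` {..j} \<subseteq> V" using that by auto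
    then have "card (Pair i ` {..j}) \<le> space cs"
      unfolding space_visited V_def by (rule card_mono[OF finite_visited])
    then show ?thesis by (simp add: card_image inj_on_def)
  qed
  show "set (work c) \<subseteq> tape_space (written M) (space cs)"
  proof
    fix t assume "t \<in> set (work c)"
    then obtain i where i: "i < work_tapes M" "t = work c ! i" using len by (metis in_set_conv_nth)
    with I have t: "\<forall>j\<le>snd t. (i, j) \<in> V" "\<forall>j. fst t j \<noteq> 0 \<longrightarrow> (\<forall>j'\<le>j. (i, j') \<in> V)" "range (fst t) \<subseteq> written M"
      by (auto simp: I_def)
    have "snd t < space cs" using bound t(1) by blast
    moreover have "\<forall>j\<ge>space cs. fst t j = 0" using bound t(2) leD by blast
    ultimately show "t \<in> tape_space (written M) (space cs)"
      using t(3) by (simp add: tape_space_def case_prod_beta)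
  qed
qed

lemma card_tape_space:
  assumes "finite G"
  shows "finite (tape_space G B)" "card (tape_space G B) \<le> B * card G ^ B"
proof -
  define F where "F = (\<lambda>(xs, h :: nat). (\<lambda>j. if j < B then xs ! j else 0 :: nat, h))"
  let ?D = "{xs. set xs \<subseteq> G \<and> length xs = B} \<times> {..<B}"
  have fin: "finite ?D" using finite_lists_length_eq[OF assms] by blast
  have sub: "tape_space G B \<subseteq> F ` ?D"
  proof
    fix t assume t: "t \<in> tape_space G B"
    obtain f h where fh: "t = (f, h)" by force
    have "t = F (map f [0..<B], h)" using t by (auto simp: fh F_def tape_space_def)
    moreover have "(map f [0..<B], h) \<in> ?D" using t by (auto simp: fh tape_space_def)
    ultimately show "t \<in> F ` ?D" by blast
  qed
  show "finite (tape_space G B)" using sub fin by (meson finite_imageI finite_subset)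
  have "card (tape_space G B) \<le> card ?D"
    using sub fin by (meson card_image_le card_mono finite_imageI le_trans)
  also have "\<dots> = B * card G ^ B"
    by (simp add: card_cartesian_product card_lists_length_eq[OF assms] del: mem_Collect_eq)
  finally show "card (tape_space G B) \<le> B * card G ^ B" .
qed

text \<open>Distinct configurations are counted: \<open>length x + 2\<close> input positions
  including both end markers, and for each tape contents and head position within the total
  space.\<close>

lemma card_le_configs:
  assumes "ntm M" "computation M x hs" "distinct hs"
  shows "length hs \<le> card (entered M) * ((length x + 2) *
    (space hs * card (written M) ^ space hs) ^ work_tapes M)"
proof -
  have finG: "finite (written M)" and finQ: "finite (entered M)"
    using assms(1) by (auto simp: ntm_def written_def entered_def)
  define W where "W = {w. set w \<subseteq> tape_space (written M) (space hs) \<and> length w = work_tapes M}"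
  note tsp = card_tape_space[OF finG, of "space hs"]
  have finW: "finite W" unfolding W_def by (rule finite_lists_length_eq[OF tsp(1)])
  have cardW: "card W = card (tape_space (written M) (space hs)) ^ work_tapes M"
    unfolding W_def by (rule card_lists_length_eq[OF tsp(1)])
  let ?g = "\<lambda>c. (state c, ipos c, work c)"
  have "inj_on ?g (set hs)" by (rule inj_onI) (auto intro: config.equality)
  moreover have "?g ` set hs \<subseteq> entered M \<times> {..Suc (length x)} \<times> W"
    using computation_configs[OF assms(1,2)] unfolding W_def by (simp add: image_subset_iff)
  ultimately have "card (set hs) \<le> card (entered M \<times> {..Suc (length x)} \<times> W)"
    using finQ finW by (intro card_inj_on_le[of ?g]) auto
  also have "\<dots> = card (entered M) * ((length x + 2) * card W)"
    by (simp add: card_cartesian_product)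
  also have "\<dots> \<le> card (entered M) * ((length x + 2) * (space hs * card (written M) ^ space hs) ^ work_tapes M)"
    unfolding cardW using tsp(2) by (intro mult_le_mono power_mono) auto
  finally show ?thesis using distinct_card[OF assms(3)] by simp
qed

text \<open>The asymptotic bound leaves finitely many \<open>n\<close> open and \<open>ln 1\<close>
  is 0. The summand 1 and an enlarged constant give a bound for all \<open>n\<close> from 1 on,
  which LSH requires since it speaks of every instance.\<close>

lemma bigo_ln_bound:
  fixes s :: "nat \<Rightarrow> real"
  assumes "s \<in> O(\<lambda>n. ln (real n))"
  obtains C where "C \<ge> 0" "\<And>n. n \<ge> 1 \<Longrightarrow> s n \<le> C * (1 + log 2 (real n))"
proof -
  obtain c where c: "c > 0" "\<forall>\<^sub>F n in sequentially. norm (s n) \<le> c * norm (ln (real n))"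
    using assms by (elim landau_o.bigE)
  then obtain N where N: "\<And>n. n \<ge> N \<Longrightarrow> norm (s n) \<le> c * norm (ln (real n))"
    unfolding eventually_sequentially by blast
  define C where "C = c + (\<Sum>i<N. \<bar>s i\<bar>)"
  have C0: "c \<le> C" "C \<ge> 0" using c(1) by (auto simp: C_def sum_nonneg)
  have "s n \<le> C * (1 + log 2 (real n))" if n: "n \<ge> 1" for n
  proof (cases "n < N")
    case True
    have "s n \<le> \<bar>s n\<bar>" by simp
    also have "\<dots> \<le> (\<Sum>i<N. \<bar>s i\<bar>)" using True by (intro member_le_sum) auto
    also have "\<dots> \<le> C * 1" using c(1) by (simp add: C_def)
    also have "\<dots> \<le> C * (1 + log 2 (real n))" using C0(2) n by (intro mult_left_mono) auto
    finally show ?thesis .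
  next
    case False
    have "s n \<le> norm (s n)" by simp
    also have "\<dots> \<le> c * norm (ln (real n))" using N False by simp
    also have "\<dots> = c * ln (real n)" using n by simp
    also have "\<dots> \<le> C * ln (real n)" using C0(1) n by (intro mult_right_mono) auto
    also have "\<dots> \<le> C * (1 + log 2 (real n))"
    proof (intro mult_left_mono[OF _ C0(2)])
      have "ln (real n) = log 2 (real n) * ln 2" by (simp add: log_def)
      also have "\<dots> \<le> log 2 (real n) * 1" using n ln_le_minus_one[of 2] by (intro mult_left_mono) auto
      finally show "ln (real n) \<le> 1 + log 2 (real n)" by simp
    qed
    finally show ?thesis .
  qed
  with C0(2) that show thesis by blast
qed

lemma log_space_poly_time:
  assumes "dtm M" "\<And>x. accepts M x \<or> rejects M x" "C \<ge> 0"
    and space: "\<And>x. length x \<ge> 1 \<Longrightarrow> in_space M x (C * (1 + log 2 (real (length x))))"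
  obtains p :: "nat poly" where "\<And>x. length x \<ge> 1 \<Longrightarrow> in_time M x (poly p (length x))"
proof -
  have ntm: "ntm M" using assms(1) by (simp add: dtm_def)
  define k where "k = work_tapes M"
  define q where "q = card (entered M)"
  \<comment> \<open>The 2 absorbs the number of head positions, by
    \<open>B \<le> 2 ^ B\<close>.\<close>
  define D where "D = 2 * real (card (written M))"
  have "finite (written M)" using ntm by (auto simp: ntm_def written_def)
  then have "card (written M) \<ge> 1" by (metis One_nat_def Suc_leI card_gt_0_iff empty_iff insertI1 written_def)
  then have D: "D \<ge> 2" by (simp add: D_def)
  \<comment> \<open>With \<open>B\<close> at most \<open>C * (1 + log 2 n)\<close>, the count
    \<open>D ^ (B * k)\<close> is at most \<open>D powr (k * C)\<close> times
    \<open>n powr (k * C * log 2 D)\<close>; \<open>a\<close> and \<open>e\<close> round this factor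
    and this exponent up.\<close>
  define a where "a = nat \<lceil>D powr (real k * C)\<rceil>"
  define e where "e = nat \<lceil>real k * C * log 2 D\<rceil>"
  have bound: "length cs \<le> q * 3 * a * length x ^ Suc e"
    if n: "length x \<ge> 1" and cs: "computation M x cs" for x cs
  proof -
    define n where "n = length x"
    have n1: "n \<ge> 1" "real n \<ge> 1" using n by (auto simp: n_def)
    obtain hs where hs: "computation M x hs" "state (last hs) = accept M \<or> state (last hs) = reject M"
      using assms(2)[of x] unfolding accepts_def rejects_def by blast
    define B where "B = space hs"
    have B: "real B \<le> C * (1 + log 2 (real n))"
      using space[OF n] hs(1) unfolding in_space_def n_def B_def by blast
    have "real ((B * card (written M) ^ B) ^ k) \<le> (2 ^ B * real (card (written M)) ^ B) ^ k"
    proof -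
      have "real B \<le> 2 ^ B" by (simp add: less_imp_le)
      then show ?thesis by (auto intro!: power_mono mult_right_mono)
    qed
    also have "\<dots> = D ^ (B * k)" by (simp add: D_def power_mult_distrib power_mult)
    also have "\<dots> = D powr (real k * real B)"
      using D by (simp add: powr_realpow[symmetric] mult.commute)
    also have "\<dots> \<le> D powr (real k * (C * (1 + log 2 (real n))))"
      using D B by (intro powr_mono mult_left_mono) auto
    also have "\<dots> = D powr (real k * C) * real n powr (real k * C * log 2 D)"
    proof -
      have "D = 2 powr log 2 D" "real n = 2 powr log 2 (real n)" using D n1 by auto
      then have "D powr (real k * C * log 2 (real n)) = real n powr (real k * C * log 2 D)"
        by (metis mult.assoc mult.commute powr_powr)
      then show ?thesis by (simp add: algebra_simps powr_add)
    qed
    also have "\<dots> \<le> real a * real n ^ e"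
    proof (intro mult_mono)
      show "D powr (real k * C) \<le> real a" unfolding a_def by linarith
      have "real n powr (real k * C * log 2 D) \<le> real n powr real e"
        using n1 unfolding e_def by (intro powr_mono) linarith+
      also have "\<dots> = real n ^ e" using n1 by (simp add: powr_realpow)
      finally show "real n powr (real k * C * log 2 D) \<le> real n ^ e" .
    qed auto
    finally have pw: "(B * card (written M) ^ B) ^ k \<le> a * n ^ e"
      by (metis (mono_tags) of_nat_le_iff of_nat_mult of_nat_power)
    have "length cs \<le> length hs" by (rule length_le_halting[OF assms(1) cs hs])
    also have "\<dots> \<le> q * ((n + 2) * (B * card (written M) ^ B) ^ k)"
      using card_le_configs[OF ntm hs(1) distinct_halting[OF assms(1) hs]] by (simp add: q_def n_def B_def k_def)
    \<comment> \<open>For \<open>n \<ge> 1\<close>, \<open>n + 2\<close> is at most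
      \<open>3 * n\<close>; this is the 3 in the final polynomial.\<close>
    also have "\<dots> \<le> q * ((3 * n) * (a * n ^ e))" using pw n1 by (intro mult_le_mono) auto
    finally show ?thesis by (simp add: n_def algebra_simps)
  qed
  show thesis
  proof (rule that[of "monom (q * 3 * a) (Suc e)"])
    fix x :: "bool list" assume "length x \<ge> 1"
    from bound[OF this] show "in_time M x (poly (monom (q * 3 * a) (Suc e)) (length x))"
      unfolding in_time_def poly_monom by (meson diff_le_self le_trans)
  qed
qed

section \<open>Complementation and the contradiction with the hypothesis\<close>

definition exchange_answers :: "tm \<Rightarrow> tm" where
  "exchange_answers M = M\<lparr>accept := reject M, reject := accept M\<rparr>"

lemma dtm_exchange: "dtm M \<Longrightarrow> dtm (exchange_answers M)"
  unfolding dtm_def ntm_def exchange_answers_def by auto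

lemma computation_exchange: "computation (exchange_answers M) x cs \<longleftrightarrow> computation M x cs"
proof -
  have "step (exchange_answers M) x = step M x" by (intro ext) (simp add: step_def exchange_answers_def)
  then show ?thesis by (simp add: computation_def init_def exchange_answers_def)
qed

lemma exchange_simps:
  "accepts (exchange_answers M) x \<longleftrightarrow> rejects M x" "rejects (exchange_answers M) x \<longleftrightarrow> accepts M x"
  "in_space (exchange_answers M) x s \<longleftrightarrow> in_space M x s" "in_time (exchange_answers M) x t \<longleftrightarrow> in_time M x t"
  unfolding accepts_def rejects_def in_space_def in_time_def computation_exchange by (simp_all add: exchange_answers_def)

text \<open>Makes \<open>m_vbl \<phi> powr \<epsilon>\<close> at least 1, so that this factor cannot
  spoil a bound already met by \<open>l\<close>.\<close>

lemma m_vbl_ge_1: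
  assumes "is_2cnf \<phi>"
  shows "m_vbl \<phi> \<ge> 1"
proof -
  have C: "hd \<phi> \<in> set \<phi>" using assms by (simp add: is_2cnf_def)
  with assms have "length (hd \<phi>) \<in> {1, 2}" by (simp add: is_2cnf_def)
  then have "hd \<phi> \<noteq> []" by auto
  with C have "hd (hd \<phi>) \<in> set (concat \<phi>)" unfolding set_concat using hd_in_set by blast
  then have "var ` set (concat \<phi>) \<noteq> {}" by (metis empty_iff image_is_empty)
  then show ?thesis unfolding m_vbl_def by (simp add: Suc_leI card_gt_0_iff)
qed

lemma length_encode_ge_1: "is_2cnf \<phi> \<Longrightarrow> length (encode \<phi>) \<ge> 1"
  unfolding is_2cnf_def encode_def enc_clause_def by (cases \<phi>) auto

theorem theorem2:
  assumes LSH_2SAT3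
  shows "class_L \<noteq> class_NL"
proof
  assume eq: "class_L = class_NL"
  obtain M where M: "ntm M" "\<And>x. in_space M x (3 * (log 2 (2 * (real (length x) + 1)) + 3))"
    "\<And>\<phi>. is_2cnf \<phi> \<Longrightarrow> accepts M (encode \<phi>) \<longleftrightarrow> \<not> satisfiable \<phi>"
    using log_space_refuter by blast
  have "(\<lambda>n. 3 * (log 2 (2 * (real n + 1)) + 3)) \<in> O(\<lambda>n. ln (real n))" by real_asymp
  \<comment> \<open>The language is defined by the machine itself, so words that encode no formula
    need no treatment.\<close>
  with M(1,2) have "{x. accepts M x} \<in> class_NL"
    unfolding class_NL_def by (auto intro!: exI[of _ M] exI[of _ "\<lambda>n. 3 * (log 2 (2 * (real n + 1)) + 3)"])
  then obtain N s where N: "dtm N" "s \<in> O(\<lambda>n. ln (real n))" "\<And>x. in_space N x (s (length x))"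
    "\<And>x. accepts M x \<Longrightarrow> accepts N x" "\<And>x. \<not> accepts M x \<Longrightarrow> rejects N x"
    unfolding eq[symmetric] class_L_def by blast
  obtain C where C: "C \<ge> 0" "\<And>n. n \<ge> 1 \<Longrightarrow> s n \<le> C * (1 + log 2 (real n))"
    using bigo_ln_bound[OF N(2)] by blast
  have space: "in_space N x (C * (1 + log 2 (real (length x))))" if "length x \<ge> 1" for x
    using N(3)[of x] C(2)[OF that] unfolding in_space_def by force
  obtain p where p: "\<And>x. length x \<ge> 1 \<Longrightarrow> in_time N x (poly p (length x))"
    using log_space_poly_time[OF N(1) _ C(1) space] N(4,5) by blast
  define l where "l = (\<lambda>n. poly [:C, C:] (log 2 (real n)))"
  have "polylog l" unfolding polylog_def l_def by blast
  \<comment> \<open>Any exponent in the open unit interval would serve, because a power of a number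
    that is at least 1 with positive exponent is at least 1.\<close>
  moreover have "solves_2SAT3 (exchange_answers N) (1 / 2) l"
    unfolding solves_2SAT3_def Let_def exchange_simps
  proof (intro exI[of _ p] ballI conjI impI)
    fix \<phi> assume "\<phi> \<in> instances_2SAT3"
    then have \<phi>: "is_2cnf \<phi>" by (simp add: instances_2SAT3_def)
    show "rejects N (encode \<phi>)" if "satisfiable \<phi>" using that M(3)[OF \<phi>] N(5) by blast
    show "accepts N (encode \<phi>)" if "\<not> satisfiable \<phi>" using that M(3)[OF \<phi>] N(4) by blast
    show "in_time N (encode \<phi>) (poly p (length (encode \<phi>)))" using p length_encode_ge_1[OF \<phi>] by blast
    have "real (m_vbl \<phi>) powr (1 / 2) \<ge> 1" using m_vbl_ge_1[OF \<phi>] by (simp add: ge_one_powr_ge_zero)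
    moreover have "l (length (encode \<phi>)) = C * (1 + log 2 (real (length (encode \<phi>))))"
      by (simp add: l_def algebra_simps)
    moreover have "real (length (encode \<phi>)) \<ge> 1" using length_encode_ge_1[OF \<phi>] by linarith
    then have "log 2 (real (length (encode \<phi>))) \<ge> 0"
      by (intro zero_le_log_cancel_iff[THEN iffD2]) linarith+
    then have "C * (1 + log 2 (real (length (encode \<phi>)))) \<ge> 0"
      using C(1) by (intro mult_nonneg_nonneg add_nonneg_nonneg) simp_all
    ultimately have "C * (1 + log 2 (real (length (encode \<phi>)))) \<le> real (m_vbl \<phi>) powr (1 / 2) * l (length (encode \<phi>))"
      using mult_right_mono[of 1 "real (m_vbl \<phi>) powr (1 / 2)"] by simp
    then show "in_space N (encode \<phi>) (real (m_vbl \<phi>) powr (1 / 2) * l (length (encode \<phi>)))"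
      using space[OF length_encode_ge_1[OF \<phi>]] unfolding in_space_def by force
  qed
  ultimately show False using assms dtm_exchange[OF N(1)] unfolding LSH_2SAT3_def
    by (metis divide_less_eq_1_pos half_gt_zero one_less_numeral_iff semiring_norm(76) zero_less_one zero_less_numeral)
qed

end
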